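(* Let $k$ be a commutative unital ring and let $X$ be a cylindrical $k$-module. Let $B_t=T^vB^h+B^v$ be the total $B$-differential on the normalized total complex $\overline{Tot}(X)$, and let $B_d$ be the $B$-differential on the normalized diagonal $\bar d(X)$. Let $\overline{Sh}:\overline{Tot}(X)\to\bar d(X)$ and $\bar A:\bar d(X)\to\overline{Tot}(X)$ be the maps induced by the shuffle map and the Alexander-Whitney map. Then $$\bar A\,B_d\,\overline{Sh}=B_t$$ as maps $\overline{Tot}(X)\to\overline{Tot}(X)$ of degree $+1$.
   Context: **$\Lambda_\infty$-modules and cyclic modules.** A $\Lambda_\infty$-module is a simplicial $k$-module $M=(M_n)_{n\ge0}$ with faces $\delta_i$ and degeneracies $\sigma_i$, together with automorphisms $\tau_n:M_n\to M_n$ such that $\delta_i\tau_n=\tau_{n-1}\delta_{i-1}$ for $1\le i\le n$, $\delta_0\tau_n=\delta_n$, $\sigma_i\tau_n=\tau_{n+1}\sigma_{i-1}$ for $1\le i\le n$, and $\sigma_0\tau_n=\tau_{n+1}^2\sigma_n$. It is a cyclic module if moreover $\tau_n^{n+1}=1$ for all $n$. For a $\Lambda_\infty$-module $M$ put, on $M_m$: $b_M=\sum_{i=0}^m(-1)^i\delta_i:M_m\to M_{m-1}$; $\lambda=(-1)^m\tau_m$; $N=1+\lambda+\dots+\lambda^m$; $\sigma_{-1}=\tau_{m+1}\sigma_m:M_m\to M_{m+1}$; and $B_M=(1-\lambda)\sigma_{-1}N:M_m\to M_{m+1}$ (apply $N$ first). Modulo the images of the degeneracies, $B_M$ is induced by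 $\sigma_{-1}N$. **Cylindrical modules.** A cylindrical $k$-module $X$ is a family of $k$-modules $X_{p,q}$ ($p,q\ge0$) with horizontal operators $d_i:X_{p,q}\to X_{p-1,q}$, $s_i:X_{p,q}\to X_{p+1,q}$ ($0\le i\le p$), $t:X_{p,q}\to X_{p,q}$, and vertical operators $\delta_i:X_{p,q}\to X_{p,q-1}$, $\sigma_i:X_{p,q}\to X_{p,q+1}$ ($0\le i\le q$), $\tau:X_{p,q}\to X_{p,q}$. For each fixed $q$ (resp. fixed $p$) the horizontal (resp. vertical) operators (faces, degeneracies, cyclic operator) form a $\Lambda_\infty$-module, every horizontal operator commutes with every vertical operator, and $\tau^{q+1}t^{p+1}=\mathrm{id}$ on $X_{p,q}$. **Total complex.** $Tot(X)_n=\bigoplus_{p+q=n}X_{p,q}$. Let $b^h,B^h$ be the operators $b_M,B_M$ of the horizontal $\Lambda_\infty$-module. On $X_{p,q}$ let $b^v,B^v$ be $(-1)^p$ times the operators $b_M,B_M$ of the vertical $\Lambda_\infty$-module. Put $T^v=1-b^vB^v-B^vb^v$ and $B_t=T^vB^h+B^v$. $\overline{Tot}(X)$ is the quotient of $Tot(X)$ by the submodule generated by the images of all $s_i$ and all $\sigma_i$; $B_t$ descends to it. **Diagonal.** $d(X)_n=X_{n,n}$ is a cyclic module with faces $d_i\delta_i$, degeneracies $s_i\sigma_i$ and cyclic operator $t\tau$. $B_d$ is its operator $B_M$. $\bar d(X)$ is the quotient of $d(X)$ by the images of all $s_i\sigma_i$, with the induced $B_d$. **Shuffle map.** For $p,q\ge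 0$, $n=p+q$, let $Sh_{p,q}\subset S_n$ be the set of permutations $\eta$ with $\eta(1)<\dots<\eta(p)$ and $\eta(p+1)<\dots<\eta(n)$, and put $\bar\eta(j)=\eta(j)-1$. Define $\nabla_{p,q}:X_{p,q}\to X_{n,n}$ by $$\nabla_{p,q}=\sum_{\eta\in Sh_{p,q}}\operatorname{sgn}(\eta)\,s_{\bar\eta(n)}\cdots s_{\bar\eta(p+1)}\,\sigma_{\bar\eta(p)}\cdots\sigma_{\bar\eta(1)},$$ and $Sh=\sum_{p+q=n}\nabla_{p,q}:Tot(X)_n\to d(X)_n$. **Alexander-Whitney map.** For $p+q=n$ define $A_{p,q}:X_{n,n}\to X_{p,q}$ by $A_{p,q}=(-1)^{pq}\,\delta_{q+1}\cdots\delta_n\,d_0^{\,q}$ (with $q$ factors $d_0$), and $A=\sum_{p+q=n}A_{p,q}:d(X)_n\to Tot(X)_n$. Both $Sh$ and $A$ descend to the normalized quotients, giving $\overline{Sh}$ and $\bar A$. *)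

theory Defs
  imports "HOL-Algebra.Module" "HOL-Algebra.AbelCoset" "HOL-Combinatorics.Permutations"
begin

section \<open>Modules: linear maps, generated submodules, quotients\<close>

definition linear_map ::
    "('k, 'r) ring_scheme \<Rightarrow> ('k, 'a) module \<Rightarrow> ('k, 'b) module \<Rightarrow> ('a \<Rightarrow> 'b) \<Rightarrow> bool" where
  "linear_map R M N f \<longleftrightarrow>
     f \<in> carrier M \<rightarrow> carrier N \<and>
     (\<forall>x\<in>carrier M. \<forall>y\<in>carrier M. f (x \<oplus>\<^bsub>M\<^esub> y) = f x \<oplus>\<^bsub>N\<^esub> f y) \<and>
     (\<forall>a\<in>carrier R. \<forall>x\<in>carrier M. f (a \<odot>\<^bsub>M\<^esub> x) = a \<odot>\<^bsub>N\<^esub> f x)"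

definition gen_submodule ::
    "('k, 'r) ring_scheme \<Rightarrow> ('k, 'a) module \<Rightarrow> 'a set \<Rightarrow> 'a set" where
  "gen_submodule R M S = \<Inter> {H. submodule H R M \<and> S \<subseteq> H}"

text \<open>The fields \<open>mult\<close> and \<open>one\<close> of a module record carry no meaning.\<close>

definition quotient_module :: "('k, 'a) module \<Rightarrow> 'a set \<Rightarrow> ('k, 'a set) module" where
  "quotient_module M H =
     \<lparr>carrier = carrier (M A_Mod H), monoid.mult = undefined, one = undefined,
      ring.zero = H, add = (\<lambda>U V. U <+>\<^bsub>M\<^esub> V),
      smult = (\<lambda>a U. \<Union>x\<in>U. H +>\<^bsub>M\<^esub> (a \<odot>\<^bsub>M\<^esub> x))\<rparr>"

text \<open>The map of quotients induced by \<open>f\<close> into \<open>N / H\<close>, on a coset \<open>U\<close> of the source.  The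
  image is a singleton exactly if the class of \<open>f x\<close> does not depend on \<open>x \<in> U\<close>.\<close>

definition induced_map :: "('k, 'b) module \<Rightarrow> 'b set \<Rightarrow> ('a \<Rightarrow> 'b) \<Rightarrow> 'a set \<Rightarrow> 'b set" where
  "induced_map N H f U = the_elem ((\<lambda>x. H +>\<^bsub>N\<^esub> f x) ` U)"


section \<open>\<open>\<Lambda>\<^sub>\<infinity>\<close>-modules\<close>

text \<open>\<open>face M n i\<close> maps degree \<open>n\<close> to \<open>n - 1\<close> and is used only for \<open>n \<ge> 1\<close>; \<open>degen M n i\<close>
  maps degree \<open>n\<close> to \<open>n + 1\<close>; in both cases \<open>i \<le> n\<close>.\<close>

record ('k, 'a) lam_data =
  obj :: "nat \<Rightarrow> ('k, 'a) module"
  face :: "nat \<Rightarrow> nat \<Rightarrow> 'a \<Rightarrow> 'a"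
  degen :: "nat \<Rightarrow> nat \<Rightarrow> 'a \<Rightarrow> 'a"
  cyc :: "nat \<Rightarrow> 'a \<Rightarrow> 'a"

locale lambda_infty_module =
  fixes R :: "('k, 'r) ring_scheme" and M :: "('k, 'a) lam_data"
  assumes module_obj: "module R (obj M n)"
    and face_linear:
      "\<lbrakk>1 \<le> n; i \<le> n\<rbrakk> \<Longrightarrow> linear_map R (obj M n) (obj M (n - 1)) (face M n i)"
    and degen_linear:
      "i \<le> n \<Longrightarrow> linear_map R (obj M n) (obj M (n + 1)) (degen M n i)"
    and cyc_linear: "linear_map R (obj M n) (obj M n) (cyc M n)"
    and cyc_bij: "bij_betw (cyc M n) (carrier (obj M n)) (carrier (obj M n))"
    and face_face:
      "\<lbrakk>2 \<le> n; i < j; j \<le> n; x \<in> carrier (obj M n)\<rbrakk> \<Longrightarrow>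
        face M (n - 1) i (face M n j x) = face M (n - 1) (j - 1) (face M n i x)"
    and degen_degen:
      "\<lbrakk>i \<le> j; j \<le> n; x \<in> carrier (obj M n)\<rbrakk> \<Longrightarrow>
        degen M (n + 1) i (degen M n j x) = degen M (n + 1) (j + 1) (degen M n i x)"
    and face_degen_less:
      "\<lbrakk>i < j; j \<le> n; x \<in> carrier (obj M n)\<rbrakk> \<Longrightarrow>
        face M (n + 1) i (degen M n j x) = degen M (n - 1) (j - 1) (face M n i x)"
    and face_degen_same:
      "\<lbrakk>j \<le> n; i = j \<or> i = j + 1; x \<in> carrier (obj M n)\<rbrakk> \<Longrightarrow>
        face M (n + 1) i (degen M n j x) = x"
    and face_degen_greater:
      "\<lbrakk>j + 1 < i; i \<le> n + 1; x \<in> carrier (obj M n)\<rbrakk> \<Longrightarrow>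
        face M (n + 1) i (degen M n j x) = degen M (n - 1) j (face M n (i - 1) x)"
    and face_cyc:
      "\<lbrakk>1 \<le> i; i \<le> n; x \<in> carrier (obj M n)\<rbrakk> \<Longrightarrow>
        face M n i (cyc M n x) = cyc M (n - 1) (face M n (i - 1) x)"
    and face_0_cyc:
      "\<lbrakk>1 \<le> n; x \<in> carrier (obj M n)\<rbrakk> \<Longrightarrow> face M n 0 (cyc M n x) = face M n n x"
    and degen_cyc:
      "\<lbrakk>1 \<le> i; i \<le> n; x \<in> carrier (obj M n)\<rbrakk> \<Longrightarrow>
        degen M n i (cyc M n x) = cyc M (n + 1) (degen M n (i - 1) x)"
    and degen_0_cyc:
      "x \<in> carrier (obj M n) \<Longrightarrow>
        degen M n 0 (cyc M n x) = cyc M (n + 1) (cyc M (n + 1) (degen M n n x))"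

text \<open>Signs are integer multiples (\<open>add_pow\<close> with an \<open>int\<close> coefficient) in the target module.
  \<open>op_b M m\<close> is meant for \<open>m \<ge> 1\<close> only: in degree \<open>0\<close> the operator \<open>b\<close> is zero.\<close>

definition op_b :: "('k, 'a) lam_data \<Rightarrow> nat \<Rightarrow> 'a \<Rightarrow> 'a" where
  "op_b M m x = (\<Oplus>\<^bsub>obj M (m - 1)\<^esub>i\<in>{..m}. add_pow (obj M (m - 1)) ((-1 :: int) ^ i) (face M m i x))"

definition op_lam :: "('k, 'a) lam_data \<Rightarrow> nat \<Rightarrow> 'a \<Rightarrow> 'a" where
  "op_lam M m x = add_pow (obj M m) ((-1 :: int) ^ m) (cyc M m x)"

definition op_N :: "('k, 'a) lam_data \<Rightarrow> nat \<Rightarrow> 'a \<Rightarrow> 'a" where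
  "op_N M m x = (\<Oplus>\<^bsub>obj M m\<^esub>j\<in>{..m}. (op_lam M m ^^ j) x)"

definition extra_degen :: "('k, 'a) lam_data \<Rightarrow> nat \<Rightarrow> 'a \<Rightarrow> 'a" where
  "extra_degen M m x = cyc M (m + 1) (degen M m m x)"

definition op_B :: "('k, 'a) lam_data \<Rightarrow> nat \<Rightarrow> 'a \<Rightarrow> 'a" where
  "op_B M m x =
     (let y = extra_degen M m (op_N M m x) in y \<ominus>\<^bsub>obj M (m + 1)\<^esub> op_lam M (m + 1) y)"

definition degenerate :: "('k, 'r) ring_scheme \<Rightarrow> ('k, 'a) lam_data \<Rightarrow> nat \<Rightarrow> 'a set" where
  "degenerate R M n = gen_submodule R (obj M n)
     {degen M (n - 1) i x | i x. 1 \<le> n \<and> i \<le> n - 1 \<and> x \<in> carrier (obj M (n - 1))}"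

definition normalized ::
    "('k, 'r) ring_scheme \<Rightarrow> ('k, 'a) lam_data \<Rightarrow> nat \<Rightarrow> ('k, 'a set) module" where
  "normalized R M n = quotient_module (obj M n) (degenerate R M n)"

text \<open>Composites of faces or degeneracies starting in degree \<open>m\<close>; the head of the list is
  applied first.\<close>

primrec faces :: "('k, 'a) lam_data \<Rightarrow> nat \<Rightarrow> nat list \<Rightarrow> 'a \<Rightarrow> 'a" where
  "faces M m [] x = x"
| "faces M m (i # is) x = faces M (m - 1) is (face M m i x)"

primrec degens :: "('k, 'a) lam_data \<Rightarrow> nat \<Rightarrow> nat list \<Rightarrow> 'a \<Rightarrow> 'a" where
  "degens M m [] x = x"
| "degens M m (i # is) x = degens M (m + 1) is (degen M m i x)"


section \<open>Cylindrical modules\<close>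

text \<open>Each operator is indexed by the bidegree \<open>p q\<close> of its source.\<close>

record ('k, 'a) cyl_data =
  bi_obj :: "nat \<Rightarrow> nat \<Rightarrow> ('k, 'a) module"
  hface :: "nat \<Rightarrow> nat \<Rightarrow> nat \<Rightarrow> 'a \<Rightarrow> 'a"
  hdegen :: "nat \<Rightarrow> nat \<Rightarrow> nat \<Rightarrow> 'a \<Rightarrow> 'a"
  hcyc :: "nat \<Rightarrow> nat \<Rightarrow> 'a \<Rightarrow> 'a"
  vface :: "nat \<Rightarrow> nat \<Rightarrow> nat \<Rightarrow> 'a \<Rightarrow> 'a"
  vdegen :: "nat \<Rightarrow> nat \<Rightarrow> nat \<Rightarrow> 'a \<Rightarrow> 'a"
  vcyc :: "nat \<Rightarrow> nat \<Rightarrow> 'a \<Rightarrow> 'a"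

definition hor :: "('k, 'a) cyl_data \<Rightarrow> nat \<Rightarrow> ('k, 'a) lam_data" where
  "hor C q =
     \<lparr>obj = (\<lambda>p. bi_obj C p q), face = (\<lambda>p. hface C p q),
      degen = (\<lambda>p. hdegen C p q), cyc = (\<lambda>p. hcyc C p q)\<rparr>"

definition ver :: "('k, 'a) cyl_data \<Rightarrow> nat \<Rightarrow> ('k, 'a) lam_data" where
  "ver C p =
     \<lparr>obj = (\<lambda>q. bi_obj C p q), face = (\<lambda>q. vface C p q),
      degen = (\<lambda>q. vdegen C p q), cyc = (\<lambda>q. vcyc C p q)\<rparr>"

locale cylindrical_module =
  fixes R :: "('k, 'r) ring_scheme" and C :: "('k, 'a) cyl_data"
  assumes hor_lambda_infty: "lambda_infty_module R (hor C q)"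
    and ver_lambda_infty: "lambda_infty_module R (ver C p)"
    and hface_vface:
      "\<lbrakk>1 \<le> p; i \<le> p; 1 \<le> q; j \<le> q; x \<in> carrier (bi_obj C p q)\<rbrakk> \<Longrightarrow>
        hface C p (q - 1) i (vface C p q j x) = vface C (p - 1) q j (hface C p q i x)"
    and hface_vdegen:
      "\<lbrakk>1 \<le> p; i \<le> p; j \<le> q; x \<in> carrier (bi_obj C p q)\<rbrakk> \<Longrightarrow>
        hface C p (q + 1) i (vdegen C p q j x) = vdegen C (p - 1) q j (hface C p q i x)"
    and hface_vcyc:
      "\<lbrakk>1 \<le> p; i \<le> p; x \<in> carrier (bi_obj C p q)\<rbrakk> \<Longrightarrow>
        hface C p q i (vcyc C p q x) = vcyc C (p - 1) q (hface C p q i x)"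
    and hdegen_vface:
      "\<lbrakk>i \<le> p; 1 \<le> q; j \<le> q; x \<in> carrier (bi_obj C p q)\<rbrakk> \<Longrightarrow>
        hdegen C p (q - 1) i (vface C p q j x) = vface C (p + 1) q j (hdegen C p q i x)"
    and hdegen_vdegen:
      "\<lbrakk>i \<le> p; j \<le> q; x \<in> carrier (bi_obj C p q)\<rbrakk> \<Longrightarrow>
        hdegen C p (q + 1) i (vdegen C p q j x) = vdegen C (p + 1) q j (hdegen C p q i x)"
    and hdegen_vcyc:
      "\<lbrakk>i \<le> p; x \<in> carrier (bi_obj C p q)\<rbrakk> \<Longrightarrow>
        hdegen C p q i (vcyc C p q x) = vcyc C (p + 1) q (hdegen C p q i x)"
    and hcyc_vface:
      "\<lbrakk>1 \<le> q; j \<le> q; x \<in> carrier (bi_obj C p q)\<rbrakk> \<Longrightarrow>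
        hcyc C p (q - 1) (vface C p q j x) = vface C p q j (hcyc C p q x)"
    and hcyc_vdegen:
      "\<lbrakk>j \<le> q; x \<in> carrier (bi_obj C p q)\<rbrakk> \<Longrightarrow>
        hcyc C p (q + 1) (vdegen C p q j x) = vdegen C p q j (hcyc C p q x)"
    and hcyc_vcyc:
      "x \<in> carrier (bi_obj C p q) \<Longrightarrow> hcyc C p q (vcyc C p q x) = vcyc C p q (hcyc C p q x)"
    and cylindrical:
      "x \<in> carrier (bi_obj C p q) \<Longrightarrow>
        (vcyc C p q ^^ (q + 1)) ((hcyc C p q ^^ (p + 1)) x) = x"

definition diagonal :: "('k, 'a) cyl_data \<Rightarrow> ('k, 'a) lam_data" where
  "diagonal C =
     \<lparr>obj = (\<lambda>n. bi_obj C n n),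
      face = (\<lambda>n i x. hface C n (n - 1) i (vface C n n i x)),
      degen = (\<lambda>n i x. hdegen C n (n + 1) i (vdegen C n n i x)),
      cyc = (\<lambda>n x. hcyc C n n (vcyc C n n x))\<rparr>"

text \<open>An element of \<open>Tot C n\<close> is a family indexed by \<open>p \<le> n\<close> with \<open>p\<close>-th entry in
  \<open>bi_obj C p (n - p)\<close>; the direct sum is finite.\<close>

definition Tot :: "('k, 'a) cyl_data \<Rightarrow> nat \<Rightarrow> ('k, nat \<Rightarrow> 'a) module" where
  "Tot C n =
     \<lparr>carrier = (\<Pi>\<^sub>E p\<in>{..n}. carrier (bi_obj C p (n - p))),
      monoid.mult = undefined, one = undefined,
      ring.zero = (\<lambda>p\<in>{..n}. \<zero>\<^bsub>bi_obj C p (n - p)\<^esub>),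
      add = (\<lambda>f g. \<lambda>p\<in>{..n}. f p \<oplus>\<^bsub>bi_obj C p (n - p)\<^esub> g p),
      smult = (\<lambda>a f. \<lambda>p\<in>{..n}. a \<odot>\<^bsub>bi_obj C p (n - p)\<^esub> f p)\<rparr>"

definition tot_incl :: "('k, 'a) cyl_data \<Rightarrow> nat \<Rightarrow> nat \<Rightarrow> 'a \<Rightarrow> (nat \<Rightarrow> 'a)" where
  "tot_incl C n p x = (\<lambda>r\<in>{..n}. if r = p then x else \<zero>\<^bsub>bi_obj C r (n - r)\<^esub>)"

definition Tot_degenerate ::
    "('k, 'r) ring_scheme \<Rightarrow> ('k, 'a) cyl_data \<Rightarrow> nat \<Rightarrow> (nat \<Rightarrow> 'a) set" where
  "Tot_degenerate R C n = gen_submodule R (Tot C n)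
     ({tot_incl C n (p + 1) (hdegen C p q i x) | p q i x.
         p + 1 + q = n \<and> i \<le> p \<and> x \<in> carrier (bi_obj C p q)} \<union>
      {tot_incl C n p (vdegen C p q i x) | p q i x.
         p + q + 1 = n \<and> i \<le> q \<and> x \<in> carrier (bi_obj C p q)})"

definition Tot_normalized ::
    "('k, 'r) ring_scheme \<Rightarrow> ('k, 'a) cyl_data \<Rightarrow> nat \<Rightarrow> ('k, (nat \<Rightarrow> 'a) set) module" where
  "Tot_normalized R C n = quotient_module (Tot C n) (Tot_degenerate R C n)"

definition B_h :: "('k, 'a) cyl_data \<Rightarrow> nat \<Rightarrow> nat \<Rightarrow> 'a \<Rightarrow> 'a" where
  "B_h C p q x = op_B (hor C q) p x"

definition b_v :: "('k, 'a) cyl_data \<Rightarrow> nat \<Rightarrow> nat \<Rightarrow> 'a \<Rightarrow> 'a" where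
  "b_v C p q x = add_pow (bi_obj C p (q - 1)) ((-1 :: int) ^ p) (op_b (ver C p) q x)"

definition B_v :: "('k, 'a) cyl_data \<Rightarrow> nat \<Rightarrow> nat \<Rightarrow> 'a \<Rightarrow> 'a" where
  "B_v C p q x = add_pow (bi_obj C p (q + 1)) ((-1 :: int) ^ p) (op_B (ver C p) q x)"

text \<open>For \<open>q = 0\<close> the summand \<open>B\<^sup>v b\<^sup>v\<close> vanishes, because \<open>b\<^sup>v\<close> does.\<close>

definition T_v :: "('k, 'a) cyl_data \<Rightarrow> nat \<Rightarrow> nat \<Rightarrow> 'a \<Rightarrow> 'a" where
  "T_v C p q x =
     x \<ominus>\<^bsub>bi_obj C p q\<^esub> b_v C p (q + 1) (B_v C p q x)
       \<ominus>\<^bsub>bi_obj C p q\<^esub> (if q = 0 then \<zero>\<^bsub>bi_obj C p q\<^esub> else B_v C p (q - 1) (b_v C p q x))"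

definition B_t :: "('k, 'a) cyl_data \<Rightarrow> nat \<Rightarrow> (nat \<Rightarrow> 'a) \<Rightarrow> (nat \<Rightarrow> 'a)" where
  "B_t C n f =
     (\<Oplus>\<^bsub>Tot C (n + 1)\<^esub>p\<in>{..n}.
        tot_incl C (n + 1) (p + 1) (T_v C (p + 1) (n - p) (B_h C p (n - p) (f p)))
        \<oplus>\<^bsub>Tot C (n + 1)\<^esub> tot_incl C (n + 1) p (B_v C p (n - p) (f p)))"


section \<open>Shuffle and Alexander-Whitney maps\<close>

definition shuffle_perms :: "nat \<Rightarrow> nat \<Rightarrow> (nat \<Rightarrow> nat) set" where
  "shuffle_perms p q =
     {\<eta>. \<eta> permutes {1..p + q} \<and> strict_mono_on {1..p} \<eta> \<and> strict_mono_on {p + 1..p + q} \<eta>}"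

definition nabla :: "('k, 'a) cyl_data \<Rightarrow> nat \<Rightarrow> nat \<Rightarrow> 'a \<Rightarrow> 'a" where
  "nabla C p q x =
     (\<Oplus>\<^bsub>bi_obj C (p + q) (p + q)\<^esub>\<eta>\<in>shuffle_perms p q.
        add_pow (bi_obj C (p + q) (p + q)) (sign \<eta>)
          (degens (hor C (p + q)) p (map (\<lambda>j. \<eta> j - 1) [p + 1..<p + q + 1])
            (degens (ver C p) q (map (\<lambda>j. \<eta> j - 1) [1..<p + 1]) x)))"

definition Sh :: "('k, 'a) cyl_data \<Rightarrow> nat \<Rightarrow> (nat \<Rightarrow> 'a) \<Rightarrow> 'a" where
  "Sh C n f = (\<Oplus>\<^bsub>bi_obj C n n\<^esub>p\<in>{..n}. nabla C p (n - p) (f p))"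

definition AW_comp :: "('k, 'a) cyl_data \<Rightarrow> nat \<Rightarrow> nat \<Rightarrow> 'a \<Rightarrow> 'a" where
  "AW_comp C p q y =
     add_pow (bi_obj C p q) ((-1 :: int) ^ (p * q))
       (faces (ver C p) (p + q) (rev [q + 1..<p + q + 1])
         (faces (hor C (p + q)) (p + q) (replicate q 0) y))"

definition AW :: "('k, 'a) cyl_data \<Rightarrow> nat \<Rightarrow> 'a \<Rightarrow> (nat \<Rightarrow> 'a)" where
  "AW C n y = (\<lambda>p\<in>{..n}. AW_comp C p (n - p) y)"


section \<open>Induced maps on the normalized quotients\<close>

definition B_t_bar ::
    "('k, 'r) ring_scheme \<Rightarrow> ('k, 'a) cyl_data \<Rightarrow> nat \<Rightarrow> (nat \<Rightarrow> 'a) set \<Rightarrow> (nat \<Rightarrow> 'a) set" where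
  "B_t_bar R C n = induced_map (Tot C (n + 1)) (Tot_degenerate R C (n + 1)) (B_t C n)"

definition B_d_bar ::
    "('k, 'r) ring_scheme \<Rightarrow> ('k, 'a) cyl_data \<Rightarrow> nat \<Rightarrow> 'a set \<Rightarrow> 'a set" where
  "B_d_bar R C n =
     induced_map (obj (diagonal C) (n + 1)) (degenerate R (diagonal C) (n + 1))
       (op_B (diagonal C) n)"

definition Sh_bar ::
    "('k, 'r) ring_scheme \<Rightarrow> ('k, 'a) cyl_data \<Rightarrow> nat \<Rightarrow> (nat \<Rightarrow> 'a) set \<Rightarrow> 'a set" where
  "Sh_bar R C n =
     induced_map (obj (diagonal C) n) (degenerate R (diagonal C) n) (Sh C n)"

definition AW_bar ::
    "('k, 'r) ring_scheme \<Rightarrow> ('k, 'a) cyl_data \<Rightarrow> nat \<Rightarrow> 'a set \<Rightarrow> (nat \<Rightarrow> 'a) set" where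
  "AW_bar R C n = induced_map (Tot C n) (Tot_degenerate R C n) (AW C n)"

end

theory Submission
  imports Defs "HOL-Algebra.Generated_Groups"
begin

text \<open>
  Modulo degenerate elements, \<open>B\<close> is \<open>e N\<close> with the extra degeneracy \<open>e = \<sigma>\<^sub>-\<^sub>1\<close>.  Since vertical
  and horizontal operators commute, the composite of the three maps sends an element \<open>x\<close> of
  bidegree \<open>(p, q)\<close>, with \<open>n = p + q\<close> and \<open>r + s = n + 1\<close>, to a signed sum of the products of
  two words \<open>(d\<^sub>0\<^sup>s e t\<^sup>j s\<^sub>\<mu>) (\<delta>\<^sub>s\<^sub>+\<^sub>1 \<cdots> \<delta>\<^sub>n\<^sub>+\<^sub>1 e \<tau>\<^sup>j \<sigma>\<^sub>\<nu>) x\<close> in the component of bidegree \<open>(r, s)\<close>.  Here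
  \<open>j \<le> n\<close>, and \<open>\<mu>\<close> and \<open>\<nu>\<close> run over the partitions of \<open>{0..<n}\<close> into \<open>q\<close> and \<open>p\<close> elements that
  correspond to the shuffles.  The separation into two words is \<open>AW_comp_word\<close>.

  Passing a degeneracy through \<open>e t\<^sup>j\<close> rotates its index \<open>i\<close> to \<open>(i + j + 1) mod (n + 1)\<close>
  (\<open>extra_degen_cyc_pow_degen\<close>).  The face \<open>d\<^sub>0\<^sup>s\<close> absorbs the degeneracies with index below \<open>s\<close>
  and lets the others through; for the face \<open>\<delta>\<^sub>s\<^sub>+\<^sub>1 \<cdots> \<delta>\<^sub>n\<^sub>+\<^sub>1\<close> it is the other way round.  So a
  product is degenerate unless the rotation moves all of \<open>\<mu>\<close> below \<open>s\<close> and no element of \<open>\<nu>\<close>.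
  As the rotation is injective, this forces \<open>s \<in> {q, q + 1}\<close> and determines \<open>\<mu>\<close> from \<open>s\<close> and
  \<open>j\<close>:

  \<^item> for \<open>s = q + 1\<close> there is one term for each \<open>j \<le> q\<close>; its horizontal word is the identity, its
    vertical word is \<open>e \<tau>\<^sup>j\<close>, and the sum of these terms is \<open>B\<^sup>v\<close>;
  \<^item> for \<open>s = q\<close> there is one term for each \<open>j = q + a\<close> with \<open>a \<le> p\<close>; its horizontal word is
    \<open>e t\<^sup>a\<close>, its vertical word is \<open>\<tau>\<^sup>q\<^sup>+\<^sup>1\<close>, and the sum of these terms is \<open>\<tau>\<^sup>q\<^sup>+\<^sup>1 B\<^sup>h\<close>.

  The shuffles that occur exchange two adjacent blocks, so their signs are known
  (\<open>block_swap_sign\<close>).  The values of the words are \<open>back_face_word\<close> and \<open>front_face_word\<close>, and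
  \<open>AW_op_B_nabla_vertical\<close> and \<open>AW_op_B_nabla_horizontal\<close> collect the terms.

  It remains to see that \<open>T\<^sup>v = \<tau>\<^sup>q\<^sup>+\<^sup>1\<close>.  This is the identity \<open>b B + B b = 1 - \<tau>\<^sup>q\<^sup>+\<^sup>1\<close>
  (\<open>bB_plus_Bb_Suc\<close>), which follows from \<open>b (1 - \<lambda>) = (1 - \<lambda>) b'\<close>, \<open>b' e + e b' = 1\<close> and
  \<open>b' N = N b\<close>, where \<open>b'\<close> is \<open>b\<close> without its last face.

  The shuffle map, \<open>B\<^sub>d\<close> and the Alexander-Whitney map preserve degenerate elements, by similar
  index computations.  That \<open>B\<^sub>t\<close> respects the congruence then follows from the congruence
  between \<open>B\<^sub>t\<close> and the composite of the other three maps.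
\<close>

section \<open>Linear maps and congruences modulo a submodule\<close>

lemma module_abelian_group: "module R M \<Longrightarrow> abelian_group M"
  by (simp add: module_def)

lemma abelian_group_zero_neg: "abelian_group M \<Longrightarrow> \<ominus>\<^bsub>M\<^esub> \<zero>\<^bsub>M\<^esub> = \<zero>\<^bsub>M\<^esub>"
  using abelian_group.minus_equality[of M "\<zero>\<^bsub>M\<^esub>"
      "\<zero>\<^bsub>M\<^esub>"] abelian_monoid.zero_closed abelian_monoid.l_zero
  by (metis abelian_group.axioms(1))

lemma linear_mapI:
  assumes "\<And>x. x \<in> carrier M \<Longrightarrow> f x \<in> carrier N"
    and "\<And>x y. x \<in> carrier M \<Longrightarrow> y \<in> carrier M \<Longrightarrow> f (x \<oplus>\<^bsub>M\<^esub> y) = f x \<oplus>\<^bsub>N\<^esub> f y"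
    and "\<And>a x. a \<in> carrier R \<Longrightarrow> x \<in> carrier M \<Longrightarrow> f (a \<odot>\<^bsub>M\<^esub> x) = a \<odot>\<^bsub>N\<^esub> f x"
  shows "linear_map R M N f"
  using assms by (auto simp: linear_map_def)

lemma linear_map_closed: "linear_map R M N f \<Longrightarrow> x \<in> carrier M \<Longrightarrow> f x \<in> carrier N"
  by (auto simp: linear_map_def)

lemma linear_map_add:
  "linear_map R M N f \<Longrightarrow> x \<in> carrier M \<Longrightarrow> y \<in> carrier M \<Longrightarrow> f (x \<oplus>\<^bsub>M\<^esub> y) = f x \<oplus>\<^bsub>N\<^esub> f y"
  by (auto simp: linear_map_def)

lemma linear_map_smult:
  "linear_map R M N f \<Longrightarrow> a \<in> carrier R \<Longrightarrow> x \<in> carrier M \<Longrightarrow> f (a \<odot>\<^bsub>M\<^esub> x) = a \<odot>\<^bsub>N\<^esub> f x"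
  by (auto simp: linear_map_def)

lemma additive_int_mult:
  assumes "abelian_group M" "abelian_group N" "f \<in> carrier M \<rightarrow> carrier N"
    and "\<And>x y. x \<in> carrier M \<Longrightarrow> y \<in> carrier M \<Longrightarrow> f (x \<oplus>\<^bsub>M\<^esub> y) = f x \<oplus>\<^bsub>N\<^esub> f y"
    and "x \<in> carrier M"
  shows "f (add_pow M (k::int) x) = add_pow N k (f x)"
proof -
  have "f \<in> hom (add_monoid M) (add_monoid N)"
    using assms by (auto simp: hom_def)
  then show ?thesis
    unfolding add_pow_def using assms
    by (intro hom_int_pow) (auto intro: abelian_group.a_group)
qed

lemma linear_map_abelian_group_hom:
  assumes "module R M" "module R N" "linear_map R M N f"
  shows "abelian_group_hom M N f"
  using assms
  by (intro abelian_group_homI)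
    (auto simp: linear_map_def hom_def abelian_group.a_group group_hom_def group_hom_axioms_def
      dest!: module_abelian_group)

lemma linear_map_zero:
  "module R M \<Longrightarrow> module R N \<Longrightarrow> linear_map R M N f \<Longrightarrow> f \<zero>\<^bsub>M\<^esub> = \<zero>\<^bsub>N\<^esub>"
  by (rule abelian_group_hom.hom_zero[OF linear_map_abelian_group_hom])

lemma linear_map_neg:
  "module R M \<Longrightarrow> module R N \<Longrightarrow> linear_map R M N f \<Longrightarrow> x \<in> carrier M
    \<Longrightarrow> f (\<ominus>\<^bsub>M\<^esub> x) = \<ominus>\<^bsub>N\<^esub> f x"
  by (rule abelian_group_hom.hom_a_inv[OF linear_map_abelian_group_hom])

lemma linear_map_diff:
  assumes "module R M" "module R N" "linear_map R M N f" "x \<in> carrier M" "y \<in> carrier M"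
  shows "f (x \<ominus>\<^bsub>M\<^esub> y) = f x \<ominus>\<^bsub>N\<^esub> f y"
  using assms
  by (simp add: a_minus_def linear_map_add[OF assms(3)] linear_map_neg[OF assms(1-3)]
      abelian_group.a_inv_closed[OF module_abelian_group[OF assms(1)]])

lemma linear_map_int_mult:
  assumes "module R M" "module R N" "linear_map R M N f" "x \<in> carrier M"
  shows "f (add_pow M (k::int) x) = add_pow N k (f x)"
  using assms by (intro additive_int_mult) (auto simp: linear_map_def dest: module_abelian_group)

lemma linear_map_finsum:
  assumes "module R M" "module R N" "linear_map R M N f" "\<And>i. i \<in> A \<Longrightarrow> g i \<in> carrier M"
  shows "f (finsum M g A) = finsum N (\<lambda>i. f (g i)) A"
proof -
  interpret M: abelian_group M using assms(1) by (rule module_abelian_group)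
  interpret N: abelian_group N using assms(2) by (rule module_abelian_group)
  show ?thesis
    using assms(4)
  proof (induction A rule: infinite_finite_induct)
    case (insert i A)
    have g: "g \<in> A \<rightarrow> carrier M" "g i \<in> carrier M" using insert by auto
    then have fg: "(\<lambda>i. f (g i)) \<in> A \<rightarrow> carrier N" "f (g i) \<in> carrier N"
      using linear_map_closed[OF assms(3)] by auto
    show ?case
      using insert g fg by (simp add: linear_map_add[OF assms(3)])
  qed (use linear_map_zero[OF assms(1-3)] in auto)
qed

lemma linear_map_id: "linear_map R M M (\<lambda>x. x)"
  by (auto simp: linear_map_def)

lemma linear_map_comp:
  "linear_map R M N f \<Longrightarrow> linear_map R N P g \<Longrightarrow> linear_map R M P (\<lambda>x. g (f x))"
  by (auto simp: linear_map_def Pi_def)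

lemma linear_map_funpow: "linear_map R M M f \<Longrightarrow> linear_map R M M (f ^^ j)"
  by (induction j) (auto simp: linear_map_def Pi_def)

lemma int_mult_smult:
  assumes "module R M" "a \<in> carrier R" "x \<in> carrier M"
  shows "add_pow M (k::int) (a \<odot>\<^bsub>M\<^esub> x) = a \<odot>\<^bsub>M\<^esub> add_pow M k x"
  using assms
  by (intro additive_int_mult[symmetric])
    (auto simp: module.smult_closed module.smult_r_distr module_abelian_group)

lemma int_mult_add:
  assumes "abelian_group M" "x \<in> carrier M" "y \<in> carrier M"
  shows "add_pow M (k::int) (x \<oplus>\<^bsub>M\<^esub> y) = add_pow M k x \<oplus>\<^bsub>M\<^esub> add_pow M k y"
  unfolding add_pow_def
  using comm_group.int_pow_distrib[OF abelian_group.a_comm_group[OF assms(1)]] assms by simp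

lemma int_mult_closed:
  assumes "abelian_group M" "x \<in> carrier M"
  shows "add_pow M (k::int) x \<in> carrier M"
  unfolding add_pow_def
  using group.int_pow_closed[OF abelian_group.a_group[OF assms(1)]] assms by simp

lemma int_mult_mult:
  assumes "abelian_group M" "x \<in> carrier M"
  shows "add_pow M (k::int) (add_pow M (l::int) x) = add_pow M (k * l) x"
  unfolding add_pow_def
  using group.int_pow_pow[OF abelian_group.a_group[OF assms(1)]] assms by (simp add: mult.commute)

lemma int_mult_one:
  assumes "abelian_group M" "x \<in> carrier M"
  shows "add_pow M (1::int) x = x"
  unfolding add_pow_def
  using group.int_pow_1[OF abelian_group.a_group[OF assms(1)]] assms by simp

lemma int_mult_neg:
  assumes "abelian_group M" "x \<in> carrier M"
  shows "add_pow M (- k::int) x = \<ominus>\<^bsub>M\<^esub> add_pow M k x"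
  unfolding add_pow_def a_inv_def
  using group.int_pow_neg[OF abelian_group.a_group[OF assms(1)]] assms by simp

lemma linear_map_scaled:
  assumes "module R N" "linear_map R M N f"
  shows "linear_map R M N (\<lambda>x. add_pow N (k::int) (f x))"
  using assms
  by (intro linear_mapI)
    (auto simp: linear_map_closed[OF assms(2)] linear_map_add[OF assms(2)]
      linear_map_smult[OF assms(2)] int_mult_closed int_mult_add int_mult_smult[OF assms(1)]
      module_abelian_group[OF assms(1)])

lemma linear_map_minus:
  assumes "module R N" "linear_map R M N f" "linear_map R M N g"
  shows "linear_map R M N (\<lambda>x. f x \<ominus>\<^bsub>N\<^esub> g x)"
proof -
  interpret N: module R N by fact
  show ?thesis
    by (intro linear_mapI)
      (auto simp: linear_map_closed[OF assms(2)] linear_map_add[OF assms(2)] linear_map_smult[OF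
          assms(2)]
        linear_map_closed[OF assms(3)] linear_map_add[OF assms(3)] linear_map_smult[OF assms(3)]
        N.a_ac N.smult_r_distr
        a_minus_def N.minus_add N.smult_r_minus)
qed

lemma linear_map_sum:
  assumes "module R N" "\<And>i. i \<in> A \<Longrightarrow> linear_map R M N (F i)"
  shows "linear_map R M N (\<lambda>x. finsum N (\<lambda>i. F i x) A)"
proof -
  interpret N: module R N by fact
  have c: "\<And>i x. i \<in> A \<Longrightarrow> x \<in> carrier M \<Longrightarrow> F i x \<in> carrier N"
    using assms(2) by (auto intro: linear_map_closed)
  show ?thesis
  proof (rule linear_mapI)
    fix x y assume xy: "x \<in> carrier M" "y \<in> carrier M"
    have "finsum N (\<lambda>i. F i (x \<oplus>\<^bsub>M\<^esub> y)) A = finsum N (\<lambda>i. F i x \<oplus>\<^bsub>N\<^esub> F i y) A"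
      using c xy by (intro N.finsum_cong') (auto intro!: linear_map_add assms(2))
    also have "\<dots> = finsum N (\<lambda>i. F i x) A \<oplus>\<^bsub>N\<^esub> finsum N (\<lambda>i. F i y) A"
      using c xy by (intro N.finsum_addf) auto
    finally show "finsum N (\<lambda>i. F i (x \<oplus>\<^bsub>M\<^esub> y)) A
      = finsum N (\<lambda>i. F i x) A \<oplus>\<^bsub>N\<^esub> finsum N (\<lambda>i. F i y) A" .
  next
    fix a x assume ax: "a \<in> carrier R" "x \<in> carrier M"
    have "finsum N (\<lambda>i. F i (a \<odot>\<^bsub>M\<^esub> x)) A = finsum N (\<lambda>i. a \<odot>\<^bsub>N\<^esub> F i x) A"
      using c ax by (intro N.finsum_cong') (auto intro!: linear_map_smult assms(2))
    also have "\<dots> = a \<odot>\<^bsub>N\<^esub> finsum N (\<lambda>i. F i x) A"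
      using c ax
      by (intro linear_map_finsum[symmetric, OF assms(1) assms(1)] linear_mapI)
        (auto simp: N.smult_r_distr N.smult_assoc1[symmetric] N.R.m_comm)
    finally show "finsum N (\<lambda>i. F i (a \<odot>\<^bsub>M\<^esub> x)) A = a \<odot>\<^bsub>N\<^esub> finsum N (\<lambda>i. F i x) A" .
  qed (use c in auto)
qed

lemma submodule_gen:
  assumes "module R M" "S \<subseteq> carrier M"
  shows "submodule (gen_submodule R M S) R M"
proof -
  interpret M: module R M by fact
  have S: "gen_submodule R M S \<subseteq> carrier M"
    using M.carrier_is_submodule assms(2) by (auto simp: gen_submodule_def)
  show ?thesis
  proof (rule M.submoduleI)
    show "\<zero>\<^bsub>M\<^esub> \<in> gen_submodule R M S"
      using submodule.axioms(1) subgroup.one_closed by (fastforce simp: gen_submodule_def)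
  qed (use S M.submoduleE in \<open>auto simp: gen_submodule_def\<close>)
qed

lemma gen_submodule_incl: "S \<subseteq> gen_submodule R M S"
  by (auto simp: gen_submodule_def)

lemma submodule_zero: "submodule D R M \<Longrightarrow> \<zero>\<^bsub>M\<^esub> \<in> D"
  using submodule.axioms(1) subgroup.one_closed by fastforce

lemma submodule_int_mult:
  assumes "module R M" "submodule D R M" "x \<in> D"
  shows "add_pow M (k::int) x \<in> D"
  unfolding add_pow_def
  using group.subgroup_int_pow_closed[OF abelian_group.a_group[OF module_abelian_group[OF assms(1)]]
      submodule.axioms(1)[OF assms(2)] assms(3)] .

lemma submodule_finsum:
  assumes "module R M" "submodule D R M" "\<And>i. i \<in> A \<Longrightarrow> g i \<in> D"
  shows "finsum M g A \<in> D"
proof -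
  interpret M: module R M by fact
  have D: "D \<subseteq> carrier M" using M.submoduleE[OF assms(2)] by auto
  show ?thesis
    using assms(3)
  proof (induction A rule: infinite_finite_induct)
    case (insert i A)
    then have "g \<in> A \<rightarrow> carrier M" "g i \<in> carrier M" using D by auto
    then show ?case using insert M.submoduleE(5)[OF assms(2)] by simp
  qed (auto simp: submodule_zero[OF assms(2)])
qed

text \<open>The preimage of a submodule is a submodule, so it suffices to check generators.\<close>

lemma linear_map_gen_submodule:
  assumes "module R M" "module R N" "linear_map R M N f" "submodule D R N"
    and "S \<subseteq> carrier M" "\<And>x. x \<in> S \<Longrightarrow> f x \<in> D" "x \<in> gen_submodule R M S"
  shows "f x \<in> D"
proof -
  interpret M: module R M by fact
  interpret N: module R N by fact
  note D = N.submoduleE[OF assms(4)]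
  have "submodule {x \<in> carrier M. f x \<in> D} R M"
    using D
    by (intro M.submoduleI)
      (auto simp: linear_map_zero[OF assms(1-3)] submodule_zero[OF assms(4)]
        linear_map_neg[OF assms(1-3)] linear_map_add[OF assms(3)] linear_map_smult[OF assms(3)])
  moreover have "S \<subseteq> {x \<in> carrier M. f x \<in> D}" using assms(5,6) by auto
  ultimately show ?thesis using assms(7) by (auto simp: gen_submodule_def)
qed

definition congruent_mod :: "('k, 'a) module \<Rightarrow> 'a set \<Rightarrow> 'a \<Rightarrow> 'a \<Rightarrow> bool" where
  "congruent_mod M D x y \<longleftrightarrow> x \<in> carrier M \<and> y \<in> carrier M \<and> x \<ominus>\<^bsub>M\<^esub> y \<in> D"

context
  fixes R :: "('k, 'r) ring_scheme" and M :: "('k, 'a) module" and D :: "'a set"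
  assumes modM: "module R M" and subD: "submodule D R M"
begin

interpretation M: module R M by (rule modM)

lemma submodule_carrier: "x \<in> D \<Longrightarrow> x \<in> carrier M"
  using M.submoduleE(1)[OF subD] by auto

lemma congruent_mod_refl: "x \<in> carrier M \<Longrightarrow> congruent_mod M D x x"
  by (simp add: congruent_mod_def submodule_zero[OF subD] a_minus_def M.r_neg)

lemma congruent_mod_zero_iff: "congruent_mod M D x \<zero>\<^bsub>M\<^esub> \<longleftrightarrow> x \<in> D"
  using M.submoduleE(1)[OF subD]
      by (auto simp: congruent_mod_def a_minus_def abelian_group_zero_neg[OF
      M.M.abelian_group_axioms])

lemma congruent_mod_sym:
  assumes "congruent_mod M D x y" shows "congruent_mod M D y x"
proof -
  have "\<ominus>\<^bsub>M\<^esub> (x \<ominus>\<^bsub>M\<^esub> y) = y \<ominus>\<^bsub>M\<^esub> x" "\<ominus>\<^bsub>M\<^esub> (x \<ominus>\<^bsub>M\<^esub> y) \<in> D"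
    using assms M.submoduleE(3)[OF subD, of "x \<ominus>\<^bsub>M\<^esub> y"]
    by (auto simp: congruent_mod_def a_minus_def M.minus_add M.a_comm[of y])
  then show ?thesis using assms by (simp add: congruent_mod_def)
qed

lemma congruent_mod_add:
  assumes "congruent_mod M D x y" "congruent_mod M D z w"
  shows "congruent_mod M D (x \<oplus>\<^bsub>M\<^esub> z) (y \<oplus>\<^bsub>M\<^esub> w)"
proof -
  have "(x \<oplus>\<^bsub>M\<^esub> z) \<ominus>\<^bsub>M\<^esub> (y \<oplus>\<^bsub>M\<^esub> w) = (x \<ominus>\<^bsub>M\<^esub> y) \<oplus>\<^bsub>M\<^esub> (z \<ominus>\<^bsub>M\<^esub> w)"
    using assms by (auto simp: congruent_mod_def a_minus_def M.minus_add M.a_ac)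
  then show ?thesis
    using assms M.submoduleE(5)[OF subD] by (auto simp: congruent_mod_def)
qed

lemma congruent_mod_trans:
  assumes "congruent_mod M D x y" "congruent_mod M D y z"
  shows "congruent_mod M D x z"
proof -
  have c: "x \<in> carrier M" "y \<in> carrier M" "z \<in> carrier M"
    using assms by (auto simp: congruent_mod_def)
  have "x \<ominus>\<^bsub>M\<^esub> z = (x \<ominus>\<^bsub>M\<^esub> y) \<oplus>\<^bsub>M\<^esub> (y \<ominus>\<^bsub>M\<^esub> z)"
    using c by (simp add: a_minus_def M.a_assoc M.r_neg1)
  then show ?thesis
    using assms M.submoduleE(5)[OF subD] by (auto simp: congruent_mod_def)
qed

lemma congruent_mod_int_mult:
  assumes "congruent_mod M D x y"
  shows "congruent_mod M D (add_pow M (k::int) x) (add_pow M k y)"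
proof -
  have "add_pow M k (x \<ominus>\<^bsub>M\<^esub> y) = add_pow M k x \<ominus>\<^bsub>M\<^esub> add_pow M k y"
    using assms
    by (intro linear_map_diff[OF modM modM] linear_map_scaled modM linear_map_id)
      (auto simp: congruent_mod_def)
  then show ?thesis
    using assms submodule_int_mult[OF modM subD, of "x \<ominus>\<^bsub>M\<^esub> y" k]
    by (auto simp: congruent_mod_def int_mult_closed M.M.abelian_group_axioms)
qed

lemma congruent_mod_finsum:
  assumes "\<And>i. i \<in> A \<Longrightarrow> congruent_mod M D (f i) (g i)"
  shows "congruent_mod M D (finsum M f A) (finsum M g A)"
  using assms
proof (induction A rule: infinite_finite_induct)
  case (insert i A)
  then have "f \<in> A \<rightarrow> carrier M" "g \<in> A \<rightarrow> carrier M" "f i \<in> carrier M" "g i \<in> carrier M"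
    by (auto simp: congruent_mod_def)
  then show ?case using insert congruent_mod_add by simp
qed (auto intro: congruent_mod_refl)

lemma abelian_subgroup_submodule: "abelian_subgroup D M"
  by (intro abelian_subgroupI3 additive_subgroupI M.M.abelian_group_axioms submodule.axioms(1)[OF
      subD])

lemma coset_eq_iff_congruent:
  assumes "x \<in> carrier M" "y \<in> carrier M"
  shows "D +>\<^bsub>M\<^esub> x = D +>\<^bsub>M\<^esub> y \<longleftrightarrow> congruent_mod M D x y"
proof -
  interpret D: abelian_subgroup D M by (rule abelian_subgroup_submodule)
  have "D +>\<^bsub>M\<^esub> x = D +>\<^bsub>M\<^esub> y \<longleftrightarrow> x \<in> D +>\<^bsub>M\<^esub> y"
    using assms D.a_repr_independence' D.a_rcos_self by metis
  also have "\<dots> \<longleftrightarrow> x \<ominus>\<^bsub>M\<^esub> y \<in> D"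
    using assms D.a_rcos_module[of y x] by (auto simp: a_minus_def)
  finally show ?thesis using assms by (simp add: congruent_mod_def)
qed

lemma mem_coset_iff_congruent:
  assumes "x \<in> carrier M"
  shows "y \<in> D +>\<^bsub>M\<^esub> x \<longleftrightarrow> congruent_mod M D y x"
proof -
  interpret D: abelian_subgroup D M by (rule abelian_subgroup_submodule)
  show ?thesis
  proof
    assume y: "y \<in> D +>\<^bsub>M\<^esub> x"
    then have "y \<in> carrier M" using D.a_elemrcos_carrier assms by auto
    then show "congruent_mod M D y x"
      using D.a_repr_independence' y assms coset_eq_iff_congruent by metis
  next
    assume "congruent_mod M D y x"
    then show "y \<in> D +>\<^bsub>M\<^esub> x"
      using coset_eq_iff_congruent assms D.a_rcos_self unfolding congruent_mod_def by metis
  qed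
qed

lemma carrier_quotient_module:
  "c \<in> carrier (quotient_module M D) \<longleftrightarrow> (\<exists>x\<in>carrier M. c = D +>\<^bsub>M\<^esub> x)"
  by (auto simp: quotient_module_def A_FactGroup_def' A_RCOSETS_def')

end

text \<open>A function need not be linear to have a value on a coset: it only has to respect the
  congruences.\<close>

lemma induced_map_coset:
  assumes "module R M" "submodule D R M" "module R N" "submodule E R N" "x \<in> carrier M"
    and "\<And>y. congruent_mod M D y x \<Longrightarrow> congruent_mod N E (f y) (f x)"
  shows "induced_map N E f (D +>\<^bsub>M\<^esub> x) = E +>\<^bsub>N\<^esub> f x"
proof -
  have "x \<in> D +>\<^bsub>M\<^esub> x"
    using assms mem_coset_iff_congruent congruent_mod_refl by metis
  then obtain x0 where x0: "x0 \<in> D +>\<^bsub>M\<^esub> x" ..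
  have "E +>\<^bsub>N\<^esub> f y = E +>\<^bsub>N\<^esub> f x" if "y \<in> D +>\<^bsub>M\<^esub> x" for y
  proof -
    have "congruent_mod N E (f y) (f x)"
      using that assms mem_coset_iff_congruent by metis
    then show ?thesis
      using coset_eq_iff_congruent[OF assms(3,4)] unfolding congruent_mod_def by metis
  qed
  then have "(\<lambda>y. E +>\<^bsub>N\<^esub> f y) ` (D +>\<^bsub>M\<^esub> x) = (\<lambda>y. E +>\<^bsub>N\<^esub> f x) ` (D +>\<^bsub>M\<^esub> x)"
    by (rule image_cong[OF refl])
  also have "\<dots> = {E +>\<^bsub>N\<^esub> f x}"
    using x0 by (rule image_constant)
  finally have "(\<lambda>y. E +>\<^bsub>N\<^esub> f y) ` (D +>\<^bsub>M\<^esub> x) = {E +>\<^bsub>N\<^esub> f x}" .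
  then show ?thesis by (simp add: induced_map_def)
qed

lemma linear_map_congruent:
  assumes "module R M" "module R N" "linear_map R M N f" "submodule E R N"
    and "\<And>x. x \<in> D \<Longrightarrow> f x \<in> E" "congruent_mod M D x y"
  shows "congruent_mod N E (f x) (f y)"
  using assms(5)[of "x \<ominus>\<^bsub>M\<^esub> y"] assms(6) linear_map_diff[OF assms(1-3), of x y]
    linear_map_closed[OF assms(3)]
  by (auto simp: congruent_mod_def)

text \<open>The workhorse for the sums below: most of their summands are degenerate, and the others
  are replaced by explicit values.\<close>

lemma congruent_mod_finsum_support:
  assumes "module R M" "submodule D R M" "finite A" "S \<subseteq> A"
    and "\<And>i. i \<in> S \<Longrightarrow> congruent_mod M D (f i) (g i)" "\<And>i. i \<in> A - S \<Longrightarrow> f i \<in> D"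
  shows "congruent_mod M D (finsum M f A) (finsum M g S)"
proof -
  interpret M: module R M by fact
  have "f \<in> S \<rightarrow> carrier M" "f \<in> A - S \<rightarrow> carrier M"
    using assms submodule_carrier[OF assms(1,2)] by (auto simp: congruent_mod_def)
  then have "finsum M f (S \<union> (A - S)) = finsum M f S \<oplus>\<^bsub>M\<^esub> finsum M f (A - S)"
    using assms(3,4) by (intro M.finsum_Un_disjoint) (auto intro: finite_subset)
  moreover have "S \<union> (A - S) = A" using assms(4) by blast
  moreover have S: "congruent_mod M D (finsum M f S) (finsum M g S)"
    using assms by (intro congruent_mod_finsum[OF assms(1,2)])
  moreover have "congruent_mod M D (finsum M f (A - S)) \<zero>\<^bsub>M\<^esub>"
    unfolding congruent_mod_zero_iff[OF assms(1,2)]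
    using assms by (intro submodule_finsum[OF assms(1,2)])
  ultimately show ?thesis
    using congruent_mod_add[OF assms(1,2) S] by (fastforce simp: congruent_mod_def)
qed

lemma int_mult_finsum:
  fixes M :: "('k, 'a) module"
  assumes "module R M" "\<And>i. i \<in> A \<Longrightarrow> g i \<in> carrier M"
  shows "add_pow M (k::int) (finsum M g A) = finsum M (\<lambda>i. add_pow M k (g i)) A"
  using assms linear_map_scaled[OF assms(1) linear_map_id, of k]
  by (intro linear_map_finsum[OF assms(1) assms(1)]) simp_all

lemma congruent_mod_minus:
  assumes "module R M" "submodule D R M" "a \<in> carrier M" "d \<in> D"
  shows "congruent_mod M D (a \<ominus>\<^bsub>M\<^esub> d) a"
proof -
  interpret M: module R M by fact
  have d: "d \<in> carrier M" "\<ominus>\<^bsub>M\<^esub> d \<in> D"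
    using assms submodule_carrier[OF assms(1,2)] M.submoduleE(3)[OF assms(2)] by auto
  have "(a \<ominus>\<^bsub>M\<^esub> d) \<ominus>\<^bsub>M\<^esub> a = \<ominus>\<^bsub>M\<^esub> d"
    using assms d by (simp add: a_minus_def M.a_ac M.r_neg1 M.r_neg2)
  then show ?thesis using assms d by (simp add: congruent_mod_def)
qed

lemma abelian_group_diff_diff:
  assumes "abelian_group G" "x \<in> carrier G" "u \<in> carrier G" "v \<in> carrier G" "t \<in> carrier G"
    and "u \<oplus>\<^bsub>G\<^esub> v = x \<ominus>\<^bsub>G\<^esub> t"
  shows "x \<ominus>\<^bsub>G\<^esub> u \<ominus>\<^bsub>G\<^esub> v = t"
proof -
  interpret abelian_group G by fact
  have "x \<ominus>\<^bsub>G\<^esub> u \<ominus>\<^bsub>G\<^esub> v = x \<ominus>\<^bsub>G\<^esub> (u \<oplus>\<^bsub>G\<^esub> v)"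
    using assms(2-5) by (simp add: a_minus_def minus_add a_ac)
  also have "\<dots> = t"
    unfolding assms(6) using assms(2-5)
        by (simp add: a_minus_def minus_add a_ac r_neg r_neg1 r_neg2)
  finally show ?thesis .
qed

lemma abelian_group_diff_cancel:
  assumes "abelian_group G" "a \<in> carrier G" "m \<in> carrier G" "z \<in> carrier G"
  shows "(a \<oplus>\<^bsub>G\<^esub> m) \<ominus>\<^bsub>G\<^esub> (z \<oplus>\<^bsub>G\<^esub> m) = a \<ominus>\<^bsub>G\<^esub> z"
proof -
  interpret abelian_group G by fact
  show ?thesis
    using assms by (simp add: a_minus_def minus_add a_ac r_neg1 r_neg2)
qed

lemma abelian_group_diff_diff_cancel:
  assumes "abelian_group G" "y \<in> carrier G" "z \<in> carrier G" "u \<in> carrier G" "v \<in> carrier G"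
  shows "(y \<ominus>\<^bsub>G\<^esub> z) \<ominus>\<^bsub>G\<^esub> (u \<ominus>\<^bsub>G\<^esub> v) \<oplus>\<^bsub>G\<^esub> (z \<ominus>\<^bsub>G\<^esub> v) = y \<ominus>\<^bsub>G\<^esub> u"
proof -
  interpret abelian_group G by fact
  have "(y \<ominus>\<^bsub>G\<^esub> z) \<ominus>\<^bsub>G\<^esub> (u \<ominus>\<^bsub>G\<^esub> v) \<oplus>\<^bsub>G\<^esub> (z \<ominus>\<^bsub>G\<^esub> v)
    = (y \<oplus>\<^bsub>G\<^esub> (v \<oplus>\<^bsub>G\<^esub> z)) \<ominus>\<^bsub>G\<^esub> (u \<oplus>\<^bsub>G\<^esub> (v \<oplus>\<^bsub>G\<^esub> z))"
    using assms by (simp add: a_minus_def minus_add a_ac)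
  then show ?thesis
    using assms by (simp add: abelian_group_diff_cancel)
qed

section \<open>Words of operators in a \<open>\<Lambda>\<^sub>\<infinity>\<close>-module\<close>

lemma mod_less_twice: "(a::nat) < 2 * k \<Longrightarrow> a mod k = (if a < k then a else a - k)"
  by (simp add: le_mod_geq)

text \<open>The faces spanned by the first \<open>s + 1\<close> vertices and by all vertices but the first \<open>k\<close>.\<close>

abbreviation front_face :: "('k, 'a) lam_data \<Rightarrow> nat \<Rightarrow> nat \<Rightarrow> 'a \<Rightarrow> 'a" where
  "front_face M n s \<equiv> faces M n (rev [s + 1..<n + 1])"

abbreviation back_face :: "('k, 'a) lam_data \<Rightarrow> nat \<Rightarrow> nat \<Rightarrow> 'a \<Rightarrow> 'a" where
  "back_face M n k \<equiv> faces M n (replicate k 0)"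

context lambda_infty_module
begin

abbreviation X :: "nat \<Rightarrow> 'a set" where
  "X n \<equiv> carrier (obj M n)"

abbreviation cpow :: "nat \<Rightarrow> nat \<Rightarrow> 'a \<Rightarrow> 'a" where
  "cpow n j \<equiv> cyc M n ^^ j"

lemma face_closed [simp]: "i \<le> Suc n \<Longrightarrow> x \<in> X (Suc n) \<Longrightarrow> face M (Suc n) i x \<in> X n"
  using face_linear[of "Suc n" i] by (auto intro: linear_map_closed)

lemma degen_closed [simp]: "i \<le> n \<Longrightarrow> x \<in> X n \<Longrightarrow> degen M n i x \<in> X (Suc n)"
  using degen_linear[of i n] by (auto intro: linear_map_closed)

lemma cyc_closed [simp]: "x \<in> X n \<Longrightarrow> cyc M n x \<in> X n"
  using cyc_linear by (rule linear_map_closed)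

lemma cpow_linear: "linear_map R (obj M n) (obj M n) (cpow n j)"
  by (intro linear_map_funpow cyc_linear)

lemma cpow_closed [simp]: "x \<in> X n \<Longrightarrow> cpow n j x \<in> X n"
  using cpow_linear by (rule linear_map_closed)

lemma extra_degen_linear: "linear_map R (obj M n) (obj M (Suc n)) (extra_degen M n)"
  unfolding extra_degen_def
  using linear_map_comp[OF degen_linear[of n n] cyc_linear] by simp

lemma extra_degen_closed [simp]: "x \<in> X n \<Longrightarrow> extra_degen M n x \<in> X (Suc n)"
  using extra_degen_linear by (rule linear_map_closed)

lemma degen_degen_Suc:
  "i \<le> j \<Longrightarrow> j \<le> n \<Longrightarrow> x \<in> X n \<Longrightarrow>
    degen M (Suc n) (Suc j) (degen M n i x) = degen M (Suc n) i (degen M n j x)"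
  using degen_degen[of i j n x] by simp

lemma cyc_degen:
  "i < n \<Longrightarrow> x \<in> X n \<Longrightarrow> cyc M (Suc n) (degen M n i x) = degen M n (Suc i) (cyc M n x)"
  using degen_cyc[of "Suc i" n x] by simp

lemma cyc_pow_degen:
  "i + j \<le> n \<Longrightarrow> x \<in> X n \<Longrightarrow> cpow (Suc n) j (degen M n i x) = degen M n (i + j) (cpow n j x)"
  by (induction j) (simp_all add: cyc_degen)

lemma cyc_extra_degen: "x \<in> X n \<Longrightarrow> cyc M (Suc n) (extra_degen M n x) = degen M n 0 (cyc M n x)"
  using degen_0_cyc[of x n] by (simp add: extra_degen_def)

lemma cyc_pow_extra_degen:
  assumes "k \<le> n" "x \<in> X n"
  shows "cpow (Suc n) (Suc k) (extra_degen M n x) = degen M n k (cpow n (Suc k) x)"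
  using assms cyc_pow_degen[of 0 k n "cyc M n x"]
  by (simp add: cyc_extra_degen funpow_swap1)

lemma extra_degen_degen:
  "i \<le> n \<Longrightarrow> x \<in> X n \<Longrightarrow>
    extra_degen M (Suc n) (degen M n i x) = degen M (Suc n) (Suc i) (extra_degen M n x)"
  by (simp add: extra_degen_def degen_degen_Suc cyc_degen)

lemma extra_degen_extra_degen:
  "x \<in> X n \<Longrightarrow> extra_degen M (Suc n) (extra_degen M n x) = degen M (Suc n) 0 (extra_degen M n x)"
  using degen_0_cyc[of "degen M n n x" "Suc n"] degen_cyc[of "Suc n" "Suc n" "degen M n n x"]
  by (simp add: extra_degen_def degen_degen_Suc)

text \<open>Moving a degeneracy past \<open>\<tau>\<close> raises its index by one.  The last degeneracy and the next
  \<open>\<tau>\<close> form \<open>e\<close>, and this \<open>\<tau>\<close> no longer acts on \<open>x\<close>; a further \<open>\<tau>\<close> turns \<open>e\<close> into the degeneracy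
  with index 0.  The outer \<open>e\<close> raises all indices by one more and turns an inner \<open>e\<close> into the
  degeneracy with index 0.  So the indices rotate modulo \<open>n + 2\<close>, and one \<open>\<tau>\<close> is lost if the
  rotation wraps around.\<close>

lemma extra_degen_cyc_pow_degen:
  assumes x: "x \<in> X n" and i: "i \<le> n" and j: "j \<le> Suc n"
  shows "extra_degen M (Suc n) (cpow (Suc n) j (degen M n i x)) =
    degen M (Suc n) ((i + j + 1) mod (n + 2))
      (extra_degen M n (cpow n (if i + j \<le> n then j else j - 1) x))"
proof (cases "i + j \<le> n")
  case True
  then show ?thesis
    using x i by (simp add: cyc_pow_degen extra_degen_degen)
next
  case False
  \<comment> \<open>After \<open>a\<close> steps the index is \<open>n\<close>, one more step produces \<open>e\<close>, and \<open>b\<close> steps are left.\<close>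
  define a where "a = n - i"
  define b where "b = j - Suc a"
  have ab: "i + a = n" "j = b + Suc a" "b \<le> i" "b \<le> n"
    using False i j by (auto simp: a_def b_def)
  have m: "(i + j + 1) mod (n + 2) = b"
    using ab by (subst mod_less_twice) auto
  have "cpow (Suc n) (Suc a) (degen M n i x) = extra_degen M n (cpow n a x)"
    using ab x by (simp add: cyc_pow_degen extra_degen_def)
  then have *: "cpow (Suc n) j (degen M n i x) = cpow (Suc n) b (extra_degen M n (cpow n a x))"
    unfolding ab(2) by (simp only: funpow_add comp_apply)
  show ?thesis
  proof (cases b)
    case 0
    then show ?thesis
      using * m False x ab by (simp add: extra_degen_extra_degen)
  next
    case (Suc k)
    have "cpow (Suc n) b (extra_degen M n (cpow n a x)) = degen M n k (cpow n b (cpow n a x))"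
      unfolding Suc using ab x Suc by (intro cyc_pow_extra_degen) auto
    also have "cpow n b (cpow n a x) = cpow n (j - 1) x"
      using ab by (simp add: funpow_add)
    finally show ?thesis
      using * m False x ab Suc by (simp add: extra_degen_degen)
  qed
qed

lemma face_0_degen_0: "x \<in> X n \<Longrightarrow> face M (Suc n) 0 (degen M n 0 x) = x"
  using face_degen_same[of 0 n 0 x] by simp

lemma face_0_degen_Suc:
  "i \<le> n \<Longrightarrow> x \<in> X (Suc n) \<Longrightarrow>
    face M (Suc (Suc n)) 0 (degen M (Suc n) (Suc i) x) = degen M n i (face M (Suc n) 0 x)"
  using face_degen_less[of 0 "Suc i" "Suc n" x] by simp

lemma back_face_linear:
  "k \<le> n \<Longrightarrow> linear_map R (obj M n) (obj M (n - k)) (back_face M n k)"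
proof (induction k arbitrary: n)
  case 0
  then show ?case using linear_map_id by (simp cong: linear_map_def)
next
  case (Suc k)
  then obtain m where [simp]: "n = Suc m" by (cases n) auto
  show ?case
    using linear_map_comp[OF face_linear[of n 0], of "obj M (m - k)" "back_face M m k"]
      Suc.IH[of m] Suc.prems
    by simp
qed

text \<open>Deleting the first \<open>k\<close> vertices absorbs every degeneracy that collapses an edge with a
  deleted vertex and lets all the others through.\<close>

lemma back_face_degen:
  assumes "x \<in> X n" "i \<le> n" "k \<le> Suc n"
  shows "back_face M (Suc n) k (degen M n i x) =
    (if i < k then back_face M n (k - 1) x
     else degen M (n - k) (i - k) (back_face M n k x))"
  using assms
proof (induction k arbitrary: n i x)
  case (Suc k)
  show ?case
  proof (cases i)
    case 0
    then show ?thesis using Suc.prems by (simp add: face_0_degen_0)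
  next
    case (Suc i')
    then obtain n' where [simp]: "n = Suc n'" using Suc.prems by (cases n) auto
    have "back_face M (Suc n) (Suc k) (degen M n i x)
      = back_face M (Suc n') k (degen M n' i' (face M (Suc n') 0 x))"
      using Suc Suc.prems by (simp add: face_0_degen_Suc)
    also have "\<dots> = (if i' < k then back_face M n' (k - 1) (face M (Suc n') 0 x)
      else degen M (n' - k) (i' - k) (back_face M n' k (face M (Suc n') 0 x)))"
      using Suc Suc.prems by (intro Suc.IH) auto
    finally show ?thesis
      using Suc by (cases k) auto
  qed
qed simp

lemma front_face_linear:
  "s \<le> n \<Longrightarrow> linear_map R (obj M n) (obj M s) (front_face M n s)"
proof (induction n)
  case 0
  then show ?case using linear_map_id by (simp add: linear_map_def)
next
  case (Suc n)
  show ?case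
  proof (cases "s = Suc n")
    case True
    then show ?thesis by (simp add: linear_map_def)
  next
    case False
    then show ?thesis
      using linear_map_comp[OF face_linear[of "Suc n" "Suc n"], of "obj M s"
          "front_face M n s"] Suc
      by simp
  qed
qed

text \<open>The faces delete all vertices after \<open>s\<close>, so this time the degeneracies with large index,
  which collapse an edge with a deleted vertex, are absorbed.\<close>

lemma front_face_degen:
  assumes "x \<in> X n" "i \<le> n" "s \<le> Suc n"
  shows "front_face M (Suc n) s (degen M n i x) =
    (if i < s then degen M (s - 1) i (front_face M n (s - 1) x)
     else front_face M n s x)"
  using assms
proof (induction n arbitrary: i x)
  case 0
  then have [simp]: "i = 0" by simp
  show ?case
    using 0 face_degen_same[of 0 0 1 x] by (cases "s = 0") auto
next
  case (Suc n)
  show ?case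
  proof (cases "s = Suc (Suc n)")
    case True
    then show ?thesis using Suc.prems by simp
  next
    case False
    then have s: "s \<le> Suc n" using Suc.prems by simp
    then have *: "front_face M (Suc (Suc n)) s (degen M (Suc n) i x)
      = front_face M (Suc n) s
          (face M (Suc (Suc n)) (Suc (Suc n)) (degen M (Suc n) i x))"
      by simp
    show ?thesis
    proof (cases "i = Suc n")
      case True
      then show ?thesis
        using * s Suc.prems face_degen_same[of i "Suc n" "Suc (Suc n)" x] by simp
    next
      case False
      then have i: "i \<le> n" using Suc.prems by simp
      have "face M (Suc (Suc n)) (Suc (Suc n)) (degen M (Suc n) i x)
        = degen M n i (face M (Suc n) (Suc n) x)"
        using face_degen_greater[of i "Suc (Suc n)" "Suc n" x] i Suc.prems by simp
      then show ?thesis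
        using * s i Suc.prems Suc.IH[of "face M (Suc n) (Suc n) x" i] by (auto simp: Suc_diff_le)
    qed
  qed
qed

end

text \<open>The index lists of iterated degeneracies in normal form.  The bound makes the operators
  defined: since the list is strictly increasing, its entry at position \<open>k\<close> is at most \<open>m + k\<close>.\<close>

definition admissible :: "nat \<Rightarrow> nat list \<Rightarrow> bool" where
  "admissible m l \<longleftrightarrow> sorted_wrt (<) l \<and> set l \<subseteq> {..<m + length l}"

lemma admissible_Nil [simp]: "admissible m []"
  by (simp add: admissible_def)

lemma admissible_snoc:
  "admissible m (l @ [i]) \<longleftrightarrow> admissible m l \<and> i \<le> m + length l \<and> (\<forall>k\<in>set l. k < i)"
  by (fastforce simp: admissible_def sorted_wrt_append subset_iff)

lemma degens_snoc: "degens M m (l @ [i]) x = degen M (m + length l) i (degens M m l x)"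
  by (induction l arbitrary: m x) auto

context lambda_infty_module
begin

lemma degens_linear:
  "admissible m l \<Longrightarrow> linear_map R (obj M m) (obj M (m + length l)) (degens M m l)"
proof (induction l rule: rev_induct)
  case Nil
  then show ?case by (simp add: linear_map_def)
next
  case (snoc i l)
  then show ?case
    using linear_map_comp[OF snoc.IH degen_linear[of i "m + length l"]]
    by (simp add: admissible_snoc degens_snoc[abs_def])
qed

lemma degens_closed [simp]: "admissible m l \<Longrightarrow> x \<in> X m \<Longrightarrow> degens M m l x \<in> X (m + length l)"
  using degens_linear by (rule linear_map_closed)

text \<open>The degeneracies applied after the one with index \<open>i\<close> have larger indices, so the latter
  can be moved past them without changing its index.\<close>

lemma degens_pull_out:
  assumes "admissible m l" "i \<in> set l" "x \<in> X m" "m + length l = Suc n"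
  shows "\<exists>y\<in>X n. degens M m l x = degen M n i y"
  using assms
proof (induction l arbitrary: n rule: rev_induct)
  case (snoc k l)
  then have n: "n = m + length l" and l: "admissible m l" and k: "k \<le> n" "\<forall>j\<in>set l. j < k"
    by (auto simp: admissible_snoc)
  show ?case
  proof (cases "i = k")
    case True
    then show ?thesis using snoc.prems l n by (auto simp: degens_snoc)
  next
    case False
    then have il: "i \<in> set l" "i < k" using snoc.prems k by auto
    then obtain n' where n': "n = Suc n'" using k by (cases n) auto
    then obtain y where y: "y \<in> X n'" "degens M m l x = degen M n' i y"
      using snoc.IH[of n'] l il snoc.prems n by auto
    obtain k' where k': "k = Suc k'" "i \<le> k'" "k' \<le> n'" using il k n' by (cases k) auto
    then have "degens M m (l @ [k]) x = degen M n i (degen M n' k' y)"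
      using y n n' degen_degen_Suc[of i k' n' y] by (simp add: degens_snoc)
    then show ?thesis using y k' n' by auto
  qed
qed simp

text \<open>A degeneracy moves outwards through the increasing word; its index is raised by one for
  each index of the word that it reaches, hence it ends at an index outside the word.  This
  final index does not depend on \<open>x\<close>.\<close>

lemma degens_push:
  assumes "admissible (Suc m) l" "i \<le> m"
  shows "\<exists>k\<le>m + length l. k \<notin> set l \<and>
    (\<forall>x\<in>X m. \<exists>z\<in>X (m + length l). degens M (Suc m) l (degen M m i x) = degen M (m + length l) k z)"
  using assms
proof (induction l rule: rev_induct)
  case Nil
  then show ?case by (intro exI[of _ i]) auto
next
  case (snoc a l)
  let ?N = "m + length l"
  have l: "admissible (Suc m) l" and a: "a \<le> Suc ?N" "\<forall>t\<in>set l. t < a"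
    using snoc.prems by (auto simp: admissible_snoc)
  obtain k where k: "k \<le> ?N" "k \<notin> set l"
    and IH: "\<forall>x\<in>X m. \<exists>z\<in>X ?N. degens M (Suc m) l (degen M m i x) = degen M ?N k z"
    using snoc.IH[OF l snoc.prems(2)] by auto
  show ?case
  proof (cases "k < a")
    case True
    then obtain a' where a': "a = Suc a'" "k \<le> a'" "a' \<le> ?N" using a by (cases a) auto
    have "\<exists>z\<in>X (m + length (l @ [a])). degens M (Suc m) (l @ [a]) (degen M m i x)
        = degen M (m + length (l @ [a])) k z" if x: "x \<in> X m" for x
    proof -
      obtain z where z: "z \<in> X ?N" "degens M (Suc m) l (degen M m i x) = degen M ?N k z"
        using bspec[OF IH x] by auto
      then show ?thesis
        using a' degen_degen_Suc[of k a' ?N z]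
        by (intro bexI[of _ "degen M ?N a' z"]) (simp_all add: degens_snoc)
    qed
    then have "\<forall>x\<in>X m. \<exists>z\<in>X (m + length (l @ [a])). degens M (Suc m) (l @ [a]) (degen M m i x)
        = degen M (m + length (l @ [a])) k z" by (rule ballI)
    moreover have "k \<le> m + length (l @ [a])" "k \<notin> set (l @ [a])" using True k by auto
    ultimately show ?thesis by blast
  next
    case False
    have "\<exists>z\<in>X (m + length (l @ [a])). degens M (Suc m) (l @ [a]) (degen M m i x)
        = degen M (m + length (l @ [a])) (Suc k) z" if x: "x \<in> X m" for x
    proof -
      obtain z where z: "z \<in> X ?N" "degens M (Suc m) l (degen M m i x) = degen M ?N k z"
        using bspec[OF IH x] by auto
      then show ?thesis
        using False k degen_degen_Suc[of a k ?N z]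
        by (intro bexI[of _ "degen M ?N a z"]) (simp_all add: degens_snoc)
    qed
    then have "\<forall>x\<in>X m. \<exists>z\<in>X (m + length (l @ [a])). degens M (Suc m) (l @ [a]) (degen M m i x)
        = degen M (m + length (l @ [a])) (Suc k) z" by (rule ballI)
    moreover have "Suc k \<le> m + length (l @ [a])" "Suc k \<notin> set (l @ [a])"
      using False k a by auto
    ultimately show ?thesis by blast
  qed
qed

text \<open>A degeneracy that is rotated to an index not below \<open>k\<close> passes the deletion of the first
  \<open>k\<close> vertices.\<close>

lemma back_face_word_degenerate:
  assumes "admissible m l" "m + length l = n" "x \<in> X m" "j \<le> n" "k \<le> n + 1"
    and "i \<in> set l" "k \<le> (i + j + 1) mod (n + 1)"
  shows "\<exists>y\<in>X (n - k). \<exists>i'\<le>n - k. k \<le> n \<and>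
    back_face M (Suc n) k (extra_degen M n (cpow n j (degens M m l x))) = degen M (n - k) i' y"
proof -
  have "i < n" using assms by (auto simp: admissible_def)
  then obtain n' where n': "n = Suc n'" by (cases n) auto
  obtain y where y: "y \<in> X n'" "degens M m l x = degen M n' i y"
    using degens_pull_out[of m l i x n'] assms n' by auto
  define r where "r = (i + j + 1) mod (n + 1)"
  have r: "k \<le> r" "r \<le> n"
    using assms(7) less_Suc_eq_le[of r n] by (auto simp: r_def)
  define z where "z = extra_degen M n' (cpow n' (if i + j \<le> n' then j else j - 1) y)"
  have z: "z \<in> X n" using y by (simp add: z_def n')
  have "extra_degen M n (cpow n j (degens M m l x)) = degen M n r z"
    unfolding y n' r_def z_def using assms(4) \<open>i < n\<close> y n'
    by (subst extra_degen_cyc_pow_degen) auto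
  then have "back_face M (Suc n) k (extra_degen M n (cpow n j (degens M m l x)))
    = degen M (n - k) (r - k) (back_face M n k z)"
    using r z by (simp add: back_face_degen)
  moreover have "back_face M n k z \<in> X (n - k)"
    using linear_map_closed[OF back_face_linear z] r by auto
  ultimately show ?thesis using r by (intro bexI[of _ "back_face M n k z"] exI[of _ "r - k"]) auto
qed

text \<open>A degeneracy that is rotated to an index below \<open>s\<close> passes the deletion of the vertices
  after \<open>s\<close>.\<close>

lemma front_face_word_degenerate:
  assumes "admissible m l" "m + length l = n" "x \<in> X m" "j \<le> n" "s \<le> n + 1"
    and "i \<in> set l" "(i + j + 1) mod (n + 1) < s"
  shows "\<exists>y\<in>X (s - 1). \<exists>i'\<le>s - 1. 1 \<le> s \<and>
    front_face M (Suc n) s (extra_degen M n (cpow n j (degens M m l x)))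
      = degen M (s - 1) i' y"
proof -
  have "i < n" using assms by (auto simp: admissible_def)
  then obtain n' where n': "n = Suc n'" by (cases n) auto
  obtain y where y: "y \<in> X n'" "degens M m l x = degen M n' i y"
    using degens_pull_out[of m l i x n'] assms n' by auto
  define r where "r = (i + j + 1) mod (n + 1)"
  have r: "r < s" "r \<le> n"
    using assms(7) less_Suc_eq_le[of r n] by (auto simp: r_def)
  define z where "z = extra_degen M n' (cpow n' (if i + j \<le> n' then j else j - 1) y)"
  have z: "z \<in> X n" using y by (simp add: z_def n')
  have "extra_degen M n (cpow n j (degens M m l x)) = degen M n r z"
    unfolding y n' r_def z_def using assms(4) \<open>i < n\<close> y n'
    by (subst extra_degen_cyc_pow_degen) auto
  then have "front_face M (Suc n) s (extra_degen M n (cpow n j (degens M m l x)))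
    = degen M (s - 1) r (front_face M n (s - 1) z)"
    using r z assms(5) front_face_degen[of z n r s] by simp
  moreover have "front_face M n (s - 1) z \<in> X (s - 1)"
    using linear_map_closed[OF front_face_linear z] assms(5) by auto
  ultimately show ?thesis
    using r by (intro bexI[of _ "front_face M n (s - 1) z"] exI[of _ r]) auto
qed

end

text \<open>If the index \<open>i\<close> and its image are removed from the rotation by \<open>j + 1\<close> of \<open>{0..n + 1}\<close>
  and the gaps are closed, the result is the rotation of \<open>{0..n}\<close> that belongs to \<open>j'\<close>.  Only
  the indices below \<open>i\<close> matter, because the words of degeneracies are increasing.\<close>

lemma rotation_step:
  fixes i j k n :: nat
  assumes "i \<le> n" "j \<le> Suc n" "k < i"
  defines "j' \<equiv> if i + j \<le> n then j else j - 1"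
  shows "j' \<le> n"
    and "(k + j + 1) mod (n + 2) < (i + j + 1) mod (n + 2) \<Longrightarrow>
      (k + j' + 1) mod (n + 1) = (k + j + 1) mod (n + 2)"
    and "(i + j + 1) mod (n + 2) \<le> (k + j + 1) mod (n + 2) \<Longrightarrow>
      (k + j' + 1) mod (n + 1) + 1 = (k + j + 1) mod (n + 2)"
    and "(i + j + 1) mod (n + 2) \<noteq> (k + j + 1) mod (n + 2)"
    and "n \<le> k + j' \<longleftrightarrow> n + 1 \<le> k + j"
    and "i + j \<le> n \<Longrightarrow> k + j < n"
  using assms(1-3) by (auto simp: j'_def mod_less_twice split: if_splits)

text \<open>The power of \<open>\<tau>\<close> drops by one for each index that wraps around, and whether a smaller
  index does so can be read off before or after the index \<open>i\<close> is removed.\<close>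

lemma wrap_count:
  fixes i j n :: nat
  assumes "i \<le> n" "j \<le> Suc n" "\<forall>k\<in>set l. k < i"
  defines "j' \<equiv> if i + j \<le> n then j else j - 1"
  shows "j - card {k \<in> set (l @ [i]). Suc n \<le> k + j} = j' - card {k \<in> set l. n \<le> k + j'}"
proof -
  have eq: "{k \<in> set l. n \<le> k + j'} = {k \<in> set l. Suc n \<le> k + j}"
    using rotation_step(5)[OF assms(1,2)] assms(3) by (auto simp: j'_def)
  show ?thesis
  proof (cases "i + j \<le> n")
    case True
    then have "{k \<in> set (l @ [i]). Suc n \<le> k + j} = {k \<in> set l. Suc n \<le> k + j}" by auto
    then show ?thesis using eq True by (simp add: j'_def)
  next
    case False
    then have "{k \<in> set (l @ [i]). Suc n \<le> k + j} = insert i {k \<in> set l. Suc n \<le> k + j}" by auto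
    moreover have "i \<notin> {k \<in> set l. Suc n \<le> k + j}" using assms(3) by auto
    ultimately show ?thesis using eq False by (simp add: j'_def)
  qed
qed

context lambda_infty_module
begin

text \<open>If all degeneracies are absorbed, what remains of the word is the power of \<open>\<tau>\<close> that is
  left after the wrap-arounds, the extra degeneracy and the faces that have not been used up.\<close>

lemma back_face_word:
  assumes "admissible m l" "m + length l = n" "x \<in> X m" "j \<le> n" "k \<le> n + 1"
    and "\<And>i. i \<in> set l \<Longrightarrow> (i + j + 1) mod (n + 1) < k"
  shows "length l \<le> k \<and>
    back_face M (Suc n) k (extra_degen M n (cpow n j (degens M m l x))) =
      back_face M (Suc m) (k - length l)
        (extra_degen M m (cpow m (j - card {i \<in> set l. n \<le> i + j}) x))"
  using assms
proof (induction l arbitrary: n j k rule: rev_induct)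
  case (snoc i l)
  define n' where "n' = m + length l"
  have n: "n = Suc n'" using snoc.prems by (simp add: n'_def)
  have l: "admissible m l" and i: "i \<le> n'" "\<forall>t\<in>set l. t < i"
    using snoc.prems by (auto simp: admissible_snoc n'_def)
  define y where "y = degens M m l x"
  have y: "y \<in> X n'" using l snoc.prems by (simp add: y_def n'_def)
  define r where "r = (i + j + 1) mod (n' + 2)"
  define j' where "j' = (if i + j \<le> n' then j else j - 1)"
  define z where "z = extra_degen M n' (cpow n' j' y)"
  have r: "r < k" "r \<le> n" using snoc.prems(6)[of i]
      by (auto simp: r_def n less_Suc_eq_le[symmetric])
  have j: "j \<le> Suc n'" using snoc.prems n by simp
  have z: "z \<in> X n" using y by (simp add: z_def n)
  note step = rotation_step[OF i(1) j, folded j'_def r_def]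
  have "j' \<le> n'" using i j by (auto simp: j'_def)
  moreover have "(t + j' + 1) mod (n' + 1) < k - 1" if "t \<in> set l" for t
  proof -
    have t: "t < i" using that i by auto
    have "(t + j + 1) mod (n' + 2) < k" using snoc.prems(6)[of t] that n by simp
    then show ?thesis using step(2-4)[OF t] r by linarith
  qed
  ultimately have IH: "length l \<le> k - 1 \<and>
    back_face M (Suc n') (k - 1) z =
    back_face M (Suc m) (k - 1 - length l)
      (extra_degen M m (cpow m (j' - card {i \<in> set l. n' \<le> i + j'}) x))"
    unfolding z_def y_def using l snoc.prems n by (intro snoc.IH) (auto simp: n'_def)
  have "extra_degen M n (cpow n j (degens M m (l @ [i]) x)) = degen M n r z"
    using y i j by (simp add: degens_snoc n'_def[symmetric] y_def[symmetric] n z_def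
        extra_degen_cyc_pow_degen r_def j'_def)
  then have "back_face M (Suc n) k (extra_degen M n (cpow n j (degens M m (l @ [i]) x)))
    = back_face M n (k - 1) z"
    using z r snoc.prems by (simp add: back_face_degen)
  then show ?case
    using IH r wrap_count[OF i(1) j i(2), folded j'_def] n by auto
qed simp

lemma front_face_word:
  assumes "admissible m l" "m + length l = n" "x \<in> X m" "j \<le> n" "s \<le> n + 1"
    and "\<And>i. i \<in> set l \<Longrightarrow> s \<le> (i + j + 1) mod (n + 1)"
  shows "s \<le> m + 1 \<and>
    front_face M (Suc n) s (extra_degen M n (cpow n j (degens M m l x))) =
      front_face M (Suc m) s
        (extra_degen M m (cpow m (j - card {i \<in> set l. n \<le> i + j}) x))"
  using assms
proof (induction l arbitrary: n j rule: rev_induct)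
  case (snoc i l)
  define n' where "n' = m + length l"
  have n: "n = Suc n'" using snoc.prems by (simp add: n'_def)
  have l: "admissible m l" and i: "i \<le> n'" "\<forall>t\<in>set l. t < i"
    using snoc.prems by (auto simp: admissible_snoc n'_def)
  define y where "y = degens M m l x"
  have y: "y \<in> X n'" using l snoc.prems by (simp add: y_def n'_def)
  define r where "r = (i + j + 1) mod (n' + 2)"
  define j' where "j' = (if i + j \<le> n' then j else j - 1)"
  define z where "z = extra_degen M n' (cpow n' j' y)"
  have r: "s \<le> r" "r \<le> n" using snoc.prems(6)[of i]
      by (auto simp: r_def n less_Suc_eq_le[symmetric])
  have j: "j \<le> Suc n'" using snoc.prems n by simp
  have z: "z \<in> X n" using y by (simp add: z_def n)
  note step = rotation_step[OF i(1) j, folded j'_def r_def]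
  have "j' \<le> n'" using i j by (auto simp: j'_def)
  moreover have "s \<le> (t + j' + 1) mod (n' + 1)" if "t \<in> set l" for t
  proof -
    have t: "t < i" using that i by auto
    have "s \<le> (t + j + 1) mod (n' + 2)" using snoc.prems(6)[of t] that n by simp
    then show ?thesis using step(2-4)[OF t] r by linarith
  qed
  ultimately have IH: "s \<le> m + 1 \<and>
    front_face M (Suc n') s z =
    front_face M (Suc m) s
      (extra_degen M m (cpow m (j' - card {i \<in> set l. n' \<le> i + j'}) x))"
    unfolding z_def y_def using l r snoc.prems n by (intro snoc.IH) (auto simp: n'_def)
  have "extra_degen M n (cpow n j (degens M m (l @ [i]) x)) = degen M n r z"
    using y i j by (simp add: degens_snoc n'_def[symmetric] y_def[symmetric] n z_def
        extra_degen_cyc_pow_degen r_def j'_def)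
  then have "front_face M (Suc n) s
      (extra_degen M n (cpow n j (degens M m (l @ [i]) x)))
    = front_face M n s z"
    using z r snoc.prems front_face_degen[of z n r s] by simp
  then show ?case
    using IH r wrap_count[OF i(1) j i(2), folded j'_def] n by auto
qed simp

section \<open>The operators \<open>b\<close> and \<open>B\<close>\<close>

interpretation O: module R "obj M n" for n
  by (rule module_obj)

lemma obj_abelian_group [simp]: "abelian_group (obj M n)"
  by (rule O.M.abelian_group_axioms)

lemma op_lam_linear: "linear_map R (obj M n) (obj M n) (op_lam M n)"
  unfolding op_lam_def by (intro linear_map_scaled module_obj cyc_linear)

lemma op_lam_pow_linear: "linear_map R (obj M n) (obj M n) (op_lam M n ^^ j)"
  by (intro linear_map_funpow op_lam_linear)

lemmas op_lam_closed [simp] = linear_map_closed[OF op_lam_linear]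
lemmas op_lam_pow_closed [simp] = linear_map_closed[OF op_lam_pow_linear]

lemma op_lam_pow:
  "x \<in> X n \<Longrightarrow> (op_lam M n ^^ j) x = add_pow (obj M n) ((-1::int) ^ (n * j)) (cpow n j x)"
proof (induction j)
  case 0
  then show ?case by (simp add: int_mult_one)
next
  case (Suc j)
  then show ?case
    using linear_map_int_mult[OF module_obj module_obj cyc_linear, of "cpow n j x" n]
    by (simp add: op_lam_def int_mult_mult power_add)
qed

lemma op_N_linear: "linear_map R (obj M n) (obj M n) (op_N M n)"
  unfolding op_N_def by (intro linear_map_sum module_obj op_lam_pow_linear)

lemmas op_N_closed [simp] = linear_map_closed[OF op_N_linear]

lemma op_b_linear: "linear_map R (obj M (Suc n)) (obj M n) (op_b M (Suc n))"
  unfolding op_b_def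
  using face_linear[of "Suc n"] by (auto intro!: linear_map_sum linear_map_scaled module_obj)

lemmas op_b_closed [simp] = linear_map_closed[OF op_b_linear]

lemma op_B_linear: "linear_map R (obj M n) (obj M (Suc n)) (op_B M n)"
  unfolding op_B_def Let_def
  using linear_map_minus[OF module_obj
      linear_map_comp[OF op_N_linear extra_degen_linear, of n]
      linear_map_comp[OF linear_map_comp[OF op_N_linear extra_degen_linear] op_lam_linear, of n]]
  by simp

lemmas op_B_closed [simp] = linear_map_closed[OF op_B_linear]

lemma extra_degen_op_N:
  assumes "x \<in> X n"
  shows "extra_degen M n (op_N M n x) =
    (\<Oplus>\<^bsub>obj M (Suc n)\<^esub>j\<in>{..n}. add_pow (obj M (Suc n)) ((-1::int) ^ (n * j)) (extra_degen M n
        (cpow n j x)))"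
proof -
  have "extra_degen M n (op_N M n x) = (\<Oplus>\<^bsub>obj M (Suc n)\<^esub>j\<in>{..n}. extra_degen M n ((op_lam M n ^^ j)
      x))"
    unfolding op_N_def using assms
    by (intro linear_map_finsum[OF module_obj module_obj extra_degen_linear]) simp
  also have "\<dots> = (\<Oplus>\<^bsub>obj M (Suc n)\<^esub>j\<in>{..n}.
      add_pow (obj M (Suc n)) ((-1::int) ^ (n * j)) (extra_degen M n (cpow n j x)))"
    using assms
    by (intro O.M.finsum_cong')
      (auto simp: op_lam_pow linear_map_int_mult[OF module_obj module_obj extra_degen_linear]
        int_mult_closed)
  finally show ?thesis .
qed

text \<open>Here \<open>\<lambda> e = \<plusminus> \<tau>\<^sup>2 \<sigma>\<^sub>n = \<plusminus> \<sigma>\<^sub>0 \<tau>\<close>, so the second summand of \<open>B = e N - \<lambda> e N\<close> is degenerate.\<close>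

lemma op_B_eq_extra_degen:
  assumes "x \<in> X n"
  shows "op_B M n x = extra_degen M n (op_N M n x) \<ominus>\<^bsub>obj M (Suc n)\<^esub>
    degen M n 0 (add_pow (obj M n) ((-1::int) ^ Suc n) (cyc M n (op_N M n x)))"
  using assms degen_linear[of 0 n]
  by (simp add: op_B_def Let_def op_lam_def cyc_extra_degen
      linear_map_int_mult[OF module_obj module_obj degen_linear[of 0 n, simplified]])

text \<open>The partial sums of \<open>b\<close> interpolate between \<open>b\<close> and the differential without its last
  face, so that the identities that relate the two to \<open>\<lambda>\<close> can be proved by induction.\<close>

definition partial_b :: "nat \<Rightarrow> nat \<Rightarrow> 'a \<Rightarrow> 'a" where
  "partial_b n k x = (\<Oplus>\<^bsub>obj M n\<^esub>i\<in>{..<k}. add_pow (obj M n) ((-1 :: int) ^ i) (face M (Suc n) i x))"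

definition last_term :: "nat \<Rightarrow> 'a \<Rightarrow> 'a" where
  "last_term n x = add_pow (obj M n) ((-1 :: int) ^ Suc n) (face M (Suc n) (Suc n) x)"

lemma last_term_closed [simp]: "x \<in> X (Suc n) \<Longrightarrow> last_term n x \<in> X n"
  by (simp add: last_term_def int_mult_closed)

lemma partial_b_linear:
  "k \<le> n + 2 \<Longrightarrow> linear_map R (obj M (Suc n)) (obj M n) (partial_b n k)"
  unfolding partial_b_def
  using face_linear[of "Suc n"] by (auto intro!: linear_map_sum linear_map_scaled module_obj)

lemma partial_b_closed [simp]: "k \<le> n + 2 \<Longrightarrow> x \<in> X (Suc n) \<Longrightarrow> partial_b n k x \<in> X n"
  using partial_b_linear by (rule linear_map_closed)

lemma partial_b_0 [simp]: "partial_b n 0 x = \<zero>\<^bsub>obj M n\<^esub>"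
  by (simp add: partial_b_def)

lemma partial_b_Suc:
  assumes "k \<le> Suc n" "x \<in> X (Suc n)"
  shows "partial_b n (Suc k) x
    = partial_b n k x \<oplus>\<^bsub>obj M n\<^esub> add_pow (obj M n) ((-1 :: int) ^ k) (face M (Suc n) k x)"
  unfolding partial_b_def lessThan_Suc using assms
  by (subst O.M.finsum_insert) (auto simp: int_mult_closed O.M.a_comm)

lemma op_b_eq_partial_b: "op_b M (Suc n) x = partial_b n (n + 2) x"
  by (simp add: op_b_def partial_b_def lessThan_Suc_atMost)

lemma op_b_eq_last_term:
  "x \<in> X (Suc n) \<Longrightarrow> op_b M (Suc n) x = partial_b n (Suc n) x \<oplus>\<^bsub>obj M n\<^esub> last_term n x"
  using partial_b_Suc[of "Suc n" n x] by (simp add: op_b_eq_partial_b last_term_def)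

text \<open>The faces \<open>\<delta>\<^sub>1, \<dots>, \<delta>\<^sub>k\<close> shift past \<open>\<lambda>\<close> with the sign of their new position, and \<open>\<delta>\<^sub>0 \<lambda>\<close> is
  the signed last face.\<close>

lemma partial_b_op_lam:
  assumes "k \<le> Suc n" "x \<in> X (Suc n)"
  shows "partial_b n (Suc k) (op_lam M (Suc n) x)
    = op_lam M n (partial_b n k x) \<oplus>\<^bsub>obj M n\<^esub> last_term n x"
  using assms(1)
proof (induction k)
  case 0
  have "face M (Suc n) 0 (op_lam M (Suc n) x) = last_term n x"
    unfolding op_lam_def last_term_def using assms(2) face_0_cyc[of "Suc n" x]
      linear_map_int_mult[OF module_obj module_obj face_linear[of "Suc n" 0]]
    by simp
  moreover have "op_lam M n \<zero>\<^bsub>obj M n\<^esub> = \<zero>\<^bsub>obj M n\<^esub>"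
    by (rule linear_map_zero[OF module_obj module_obj op_lam_linear])
  ultimately show ?case using assms(2) by (simp add: partial_b_Suc int_mult_one)
next
  case (Suc k)
  have face: "face M (Suc n) (Suc k) (op_lam M (Suc n) x)
    = add_pow (obj M n) ((-1::int) ^ Suc n) (cyc M n (face M (Suc n) k x))"
    unfolding op_lam_def using assms(2) Suc.prems face_cyc[of "Suc k" "Suc n" x]
      linear_map_int_mult[OF module_obj module_obj face_linear[of "Suc n" "Suc k"]]
    by simp
  have "add_pow (obj M n) ((-1 :: int) ^ Suc k) (face M (Suc n) (Suc k) (op_lam M (Suc n) x))
    = op_lam M n (add_pow (obj M n) ((-1 :: int) ^ k) (face M (Suc n) k x))"
    unfolding face unfolding op_lam_def using assms(2) Suc.prems
      linear_map_int_mult[OF module_obj module_obj cyc_linear, of "face M (Suc n) k x" n]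
    by (simp add: int_mult_mult mult.commute)
  then show ?case
    using Suc assms(2)
    by (simp add: partial_b_Suc[of "Suc k"] partial_b_Suc[of k] linear_map_add[OF op_lam_linear]
        int_mult_closed O.M.a_ac)
qed

text \<open>For \<open>l = n + 1\<close> this expresses \<open>b' \<lambda>\<^sup>k\<^sup>+\<^sup>1\<close> by the terms \<open>\<plusminus> \<lambda>\<^sup>i \<delta>\<^sub>j\<close>: the faces that are
  carried around the cycle by \<open>\<lambda>\<close> reappear as the last faces of \<open>b\<close>, behind one factor \<open>\<lambda>\<close>
  less.\<close>

lemma partial_b_op_lam_pow:
  assumes "k < l" "l \<le> Suc n" "x \<in> X (Suc n)"
  shows "partial_b n l ((op_lam M (Suc n) ^^ Suc k) x) =
    (op_lam M n ^^ Suc k) (partial_b n (l - Suc k) x) \<oplus>\<^bsub>obj M n\<^esub>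
    (op_lam M n ^^ k) (op_b M (Suc n) x \<ominus>\<^bsub>obj M n\<^esub> partial_b n (Suc n - k) x)"
  using assms
proof (induction k arbitrary: x)
  case 0
  then obtain l' where l: "l = Suc l'" by (cases l) auto
  have "last_term n x = op_b M (Suc n) x \<ominus>\<^bsub>obj M n\<^esub> partial_b n (Suc n) x"
    using 0 by (simp add: op_b_eq_last_term a_minus_def O.M.a_ac O.M.r_neg1 O.M.r_neg2 O.M.r_neg)
  then show ?case using 0 l by (simp add: partial_b_op_lam)
next
  case (Suc k)
  define u where "u = op_lam M n"
  have lin: "linear_map R (obj M n) (obj M n) (u ^^ i)" for i
    unfolding u_def by (rule op_lam_pow_linear)
  have x': "op_lam M (Suc n) x \<in> X (Suc n)" using Suc.prems by simp
  define a where "a = partial_b n (l - Suc (Suc k)) x"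
  define b where "b = partial_b n (Suc n) x"
  define c where "c = partial_b n (Suc n - Suc k) x"
  define d where "d = last_term n x"
  have cl: "a \<in> X n" "b \<in> X n" "c \<in> X n" "d \<in> X n"
    using Suc.prems by (auto simp: a_def b_def c_def d_def)
  have ucl: "(u ^^ i) y \<in> X n" "u y \<in> X n" if "y \<in> X n" for i y
    using linear_map_closed[OF lin] that by (auto simp: u_def)
  have e: "l - Suc k = Suc (l - Suc (Suc k))" "Suc n - k = Suc (Suc n - Suc k)"
    using Suc.prems by auto
  have "partial_b n l ((op_lam M (Suc n) ^^ Suc (Suc k)) x)
    = partial_b n l ((op_lam M (Suc n) ^^ Suc k) (op_lam M (Suc n) x))"
    by (simp only: funpow_Suc_right comp_apply)
  also have "\<dots> = (u ^^ Suc k) (partial_b n (l - Suc k) (op_lam M (Suc n) x)) \<oplus>\<^bsub>obj M n\<^esub>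
    (u ^^ k) (op_b M (Suc n) (op_lam M (Suc n) x) \<ominus>\<^bsub>obj M n\<^esub> partial_b n (Suc n - k) (op_lam M
        (Suc n) x))"
    unfolding u_def using Suc.prems x' by (intro Suc.IH) auto
  also have "partial_b n (l - Suc k) (op_lam M (Suc n) x) = u a \<oplus>\<^bsub>obj M n\<^esub> d"
    unfolding e u_def a_def d_def using Suc.prems by (intro partial_b_op_lam) auto
  also have "op_b M (Suc n) (op_lam M (Suc n) x) = u b \<oplus>\<^bsub>obj M n\<^esub> d"
    using Suc.prems partial_b_op_lam[of "Suc n" n x]
    by (simp add: op_b_eq_partial_b u_def b_def d_def)
  also have "partial_b n (Suc n - k) (op_lam M (Suc n) x) = u c \<oplus>\<^bsub>obj M n\<^esub> d"
    unfolding e u_def c_def d_def using Suc.prems by (intro partial_b_op_lam) auto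
  also have "(u b \<oplus>\<^bsub>obj M n\<^esub> d) \<ominus>\<^bsub>obj M n\<^esub> (u c \<oplus>\<^bsub>obj M n\<^esub> d) = u (b \<ominus>\<^bsub>obj M n\<^esub> c)"
    using cl ucl linear_map_diff[OF module_obj module_obj op_lam_linear, of b n c]
    by (simp add: u_def abelian_group_diff_cancel)
  also have "(u ^^ k) (u (b \<ominus>\<^bsub>obj M n\<^esub> c)) = (u ^^ Suc k) (b \<ominus>\<^bsub>obj M n\<^esub> c)"
    by (simp only: funpow_Suc_right comp_apply)
  also have "(u ^^ Suc k) (u a \<oplus>\<^bsub>obj M n\<^esub> d) \<oplus>\<^bsub>obj M n\<^esub> (u ^^ Suc k) (b \<ominus>\<^bsub>obj M n\<^esub> c)
    = (u ^^ Suc (Suc k)) a \<oplus>\<^bsub>obj M n\<^esub> (u ^^ Suc k) ((b \<oplus>\<^bsub>obj M n\<^esub> d) \<ominus>\<^bsub>obj M n\<^esub> c)"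
  proof -
    have "(u ^^ Suc k) (u a \<oplus>\<^bsub>obj M n\<^esub> d) = (u ^^ Suc k) (u a) \<oplus>\<^bsub>obj M n\<^esub> (u ^^ Suc k) d"
      using cl ucl by (intro linear_map_add[OF lin]) auto
    moreover have "(u ^^ Suc k) (u a) = (u ^^ Suc (Suc k)) a"
      by (simp only: funpow_Suc_right comp_apply)
    moreover have "(b \<oplus>\<^bsub>obj M n\<^esub> d) \<ominus>\<^bsub>obj M n\<^esub> c = d \<oplus>\<^bsub>obj M n\<^esub> (b \<ominus>\<^bsub>obj M n\<^esub> c)"
      using cl by (simp add: a_minus_def O.M.a_ac)
    moreover have "(u ^^ Suc k) (d \<oplus>\<^bsub>obj M n\<^esub> (b \<ominus>\<^bsub>obj M n\<^esub> c))
      = (u ^^ Suc k) d \<oplus>\<^bsub>obj M n\<^esub> (u ^^ Suc k) (b \<ominus>\<^bsub>obj M n\<^esub> c)"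
      using cl by (intro linear_map_add[OF lin]) auto
    ultimately show ?thesis
      using cl ucl(1)[of _ "Suc k"] ucl(1)[of _ "Suc (Suc k)"]
      by (simp only: O.M.a_assoc O.M.minus_closed)
  qed
  finally show ?case
    using Suc.prems by (simp only: op_b_eq_last_term u_def a_def b_def c_def d_def)
qed

text \<open>The identity \<open>b' N = N b\<close>.  By the previous lemma, the sums over \<open>j\<close> of \<open>b' \<lambda>\<^sup>j\<close> and \<open>\<lambda>\<^sup>j b\<close>
  agree up to a telescoping term, which is zero at the end because the last partial sum is
  empty.\<close>

lemma partial_b_op_N:
  assumes "x \<in> X (Suc n)"
  shows "partial_b n (Suc n) (op_N M (Suc n) x) = op_N M n (op_b M (Suc n) x)"
proof -
  let ?f = "\<lambda>j. partial_b n (Suc n) ((op_lam M (Suc n) ^^ j) x)"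
  let ?g = "\<lambda>j. (op_lam M n ^^ j) (op_b M (Suc n) x)"
  have f: "?f j \<in> X n" and g: "?g j \<in> X n" for j using assms by simp_all
  have "finsum (obj M n) ?f {..k}
    = finsum (obj M n) ?g {..<k} \<oplus>\<^bsub>obj M n\<^esub> (op_lam M n ^^ k) (partial_b n (Suc n - k) x)"
    if "k \<le> Suc n" for k
    using that
  proof (induction k)
    case 0
    then show ?case using assms by simp
  next
    case (Suc k)
    define y where "y = (op_lam M n ^^ k) (partial_b n (Suc n - k) x)"
    have y: "y \<in> X n" using assms Suc.prems by (simp add: y_def)
    have G: "finsum (obj M n) ?g {..<k} \<in> X n" using g by (intro O.M.finsum_closed) auto
    have step: "?f (Suc k) = (op_lam M n ^^ Suc k) (partial_b n (Suc n - Suc k) x) \<oplus>\<^bsub>obj M n\<^esub> (?g k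
        \<ominus>\<^bsub>obj M n\<^esub> y)"
      using assms Suc.prems partial_b_op_lam_pow[of k "Suc n" n x]
        linear_map_diff[OF module_obj module_obj op_lam_pow_linear,
          of "op_b M (Suc n) x" n "partial_b n (Suc n - k) x" k]
      by (simp add: y_def)
    have "finsum (obj M n) ?f {..Suc k} = ?f (Suc k) \<oplus>\<^bsub>obj M n\<^esub> finsum (obj M n) ?f {..k}"
      unfolding atMost_Suc using f assms by (intro O.M.finsum_insert) auto
    also have "finsum (obj M n) ?f {..k} = finsum (obj M n) ?g {..<k} \<oplus>\<^bsub>obj M n\<^esub> y"
      using Suc by (simp add: y_def)
    finally have 1: "finsum (obj M n) ?f {..Suc k} = ?f (Suc k)
        \<oplus>\<^bsub>obj M n\<^esub> (finsum (obj M n) ?g {..<k} \<oplus>\<^bsub>obj M n\<^esub> y)" .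
    have 2: "finsum (obj M n) ?g {..<Suc k} = ?g k \<oplus>\<^bsub>obj M n\<^esub> finsum (obj M n) ?g {..<k}"
      unfolding lessThan_Suc using g by (intro O.M.finsum_insert) auto
    have z: "(op_lam M n ^^ Suc k) (partial_b n (Suc n - Suc k) x) \<in> X n"
      using assms by (intro op_lam_pow_closed) simp
    show ?case
      unfolding 1 2 step using y G g[of k] z
      by (simp only: a_minus_def O.M.a_ac O.M.a_closed O.M.a_inv_closed O.M.r_neg O.M.r_neg1
          O.M.r_neg2 O.M.r_zero)
  qed
  from this[of "Suc n"] have "finsum (obj M n) ?f {..Suc n} = op_N M n (op_b M (Suc n) x)"
    using assms linear_map_zero[OF module_obj module_obj op_lam_pow_linear, of "Suc n" n]
    by (simp add: op_N_def lessThan_Suc_atMost)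
  moreover have "partial_b n (Suc n) (op_N M (Suc n) x) = finsum (obj M n) ?f {..Suc n}"
    unfolding op_N_def using assms
    by (intro linear_map_finsum[OF module_obj module_obj partial_b_linear]) auto
  ultimately show ?thesis by simp
qed

lemma face_0_extra_degen: "x \<in> X n \<Longrightarrow> face M (Suc n) 0 (extra_degen M n x) = x"
  using face_0_cyc[of "Suc n" "degen M n n x"] face_degen_same[of n n "Suc n" x]
  by (simp add: extra_degen_def)

lemma face_extra_degen:
  assumes "x \<in> X (Suc n)" "i \<le> n"
  shows "face M (Suc (Suc n)) (Suc i) (extra_degen M (Suc n) x)
      = extra_degen M n (face M (Suc n) i x)"
  using assms face_cyc[of "Suc i" "Suc (Suc n)" "degen M (Suc n) (Suc n) x"]
    face_degen_less[of i "Suc n" "Suc n" x]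
  by (simp add: extra_degen_def)

lemma face_last_extra_degen:
  "x \<in> X n \<Longrightarrow> face M (Suc n) (Suc n) (extra_degen M n x) = cyc M n x"
  using face_cyc[of "Suc n" "Suc n" "degen M n n x"] face_degen_same[of n n n x]
  by (simp add: extra_degen_def)

text \<open>For \<open>k = n + 1\<close> this is \<open>b' e + e b' = 1\<close>: the face \<open>\<delta>\<^sub>0\<close> cancels \<open>e\<close>, and the other faces
  pass \<open>e\<close> with a shift of the index and hence with the opposite sign.\<close>

lemma partial_b_extra_degen:
  assumes "x \<in> X (Suc n)" "k \<le> Suc n"
  shows "partial_b (Suc n) (Suc k) (extra_degen M (Suc n) x)
    = x \<ominus>\<^bsub>obj M (Suc n)\<^esub> extra_degen M n (partial_b n k x)"
  using assms(2)
proof (induction k)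
  case 0
  have "extra_degen M n \<zero>\<^bsub>obj M n\<^esub> = \<zero>\<^bsub>obj M (Suc n)\<^esub>"
    by (rule linear_map_zero[OF module_obj module_obj extra_degen_linear])
  then show ?case
    using assms(1) by (simp add: partial_b_Suc face_0_extra_degen int_mult_one a_minus_def
        abelian_group_zero_neg)
next
  case (Suc k)
  have "extra_degen M n (partial_b n (Suc k) x) = extra_degen M n (partial_b n k x) \<oplus>\<^bsub>obj M (Suc n)\<^esub>
    add_pow (obj M (Suc n)) ((-1 :: int) ^ k) (extra_degen M n (face M (Suc n) k x))"
    using Suc.prems assms(1)
      linear_map_int_mult[OF module_obj module_obj extra_degen_linear, of "face M (Suc n) k x" n]
    by (simp add: partial_b_Suc linear_map_add[OF extra_degen_linear] int_mult_closed)
  then show ?case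
    using Suc assms(1)
    by (simp add: partial_b_Suc[of "Suc k"] face_extra_degen int_mult_closed int_mult_neg
        a_minus_def O.M.minus_add O.M.a_ac)
qed

text \<open>The identity \<open>b (1 - \<lambda>) = (1 - \<lambda>) b'\<close>: the last face of \<open>b\<close> and the image under \<open>\<lambda>\<close> of its
  first face cancel.\<close>

lemma op_b_diff_op_lam:
  assumes "y \<in> X (Suc n)"
  shows "op_b M (Suc n) (y \<ominus>\<^bsub>obj M (Suc n)\<^esub> op_lam M (Suc n) y)
    = partial_b n (Suc n) y \<ominus>\<^bsub>obj M n\<^esub> op_lam M n (partial_b n (Suc n) y)"
  using assms partial_b_op_lam[of "Suc n" n y]
    linear_map_diff[OF module_obj module_obj op_b_linear, of y n "op_lam M (Suc n) y"]
  by (simp add: op_b_eq_last_term[of y] op_b_eq_partial_b[of n "op_lam M (Suc n) y"]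
      abelian_group_diff_cancel)

lemma op_N_telescope:
  assumes "x \<in> X n"
  shows "op_N M n x \<ominus>\<^bsub>obj M n\<^esub> op_lam M n (op_N M n x) = x \<ominus>\<^bsub>obj M n\<^esub> cpow n (Suc n) x"
proof -
  let ?f = "\<lambda>j. (op_lam M n ^^ j) x"
  have f: "?f j \<in> X n" for j using assms by simp
  have F: "finsum (obj M n) ?f {..k} \<in> X n" for k using f by (intro O.M.finsum_closed) auto
  have "finsum (obj M n) ?f {..k} \<ominus>\<^bsub>obj M n\<^esub> op_lam M n (finsum (obj M n) ?f {..k})
    = x \<ominus>\<^bsub>obj M n\<^esub> ?f (Suc k)" for k
  proof (induction k)
    case 0
    then show ?case using assms by simp
  next
    case (Suc k)
    have 1: "finsum (obj M n) ?f {..Suc k} = ?f (Suc k) \<oplus>\<^bsub>obj M n\<^esub> finsum (obj M n) ?f {..k}"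
      unfolding atMost_Suc using f by (intro O.M.finsum_insert) auto
    have 2: "op_lam M n (finsum (obj M n) ?f {..Suc k})
      = ?f (Suc (Suc k)) \<oplus>\<^bsub>obj M n\<^esub> op_lam M n (finsum (obj M n) ?f {..k})"
      unfolding 1 using f F by (subst linear_map_add[OF op_lam_linear]) auto
    have "?f (Suc k) \<oplus>\<^bsub>obj M n\<^esub> finsum (obj M n) ?f {..k}
        \<ominus>\<^bsub>obj M n\<^esub> (?f (Suc (Suc k)) \<oplus>\<^bsub>obj M n\<^esub> op_lam M n (finsum (obj M n) ?f {..k}))
      = ?f (Suc k) \<ominus>\<^bsub>obj M n\<^esub> ?f (Suc (Suc k)) \<oplus>\<^bsub>obj M n\<^esub>
        (finsum (obj M n) ?f {..k} \<ominus>\<^bsub>obj M n\<^esub> op_lam M n (finsum (obj M n) ?f {..k}))"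
      using f[of "Suc k"] f[of "Suc (Suc k)"] F[of k] op_lam_closed[OF F[of k]]
      by (simp only: a_minus_def O.M.minus_add O.M.a_ac O.M.a_closed O.M.a_inv_closed)
    also have "\<dots> = x \<ominus>\<^bsub>obj M n\<^esub> ?f (Suc (Suc k))"
      unfolding Suc.IH using assms f[of "Suc k"] f[of "Suc (Suc k)"]
      by (simp only: a_minus_def O.M.minus_add O.M.a_ac O.M.a_closed O.M.a_inv_closed O.M.r_neg
          O.M.r_neg1 O.M.r_neg2 O.M.r_zero)
    finally show ?case unfolding 2 unfolding 1 .
  qed
  moreover have "?f (Suc n) = cpow n (Suc n) x"
    unfolding op_lam_pow[OF assms] using assms by (simp del: funpow.simps add: int_mult_one)
  ultimately show ?thesis unfolding op_N_def by simp
qed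

lemma bB_plus_Bb_0:
  assumes "x \<in> X 0"
  shows "op_b M (Suc 0) (op_B M 0 x) = x \<ominus>\<^bsub>obj M 0\<^esub> cpow 0 (Suc 0) x"
proof -
  have "partial_b 0 (Suc 0) (extra_degen M 0 (op_N M 0 x)) = op_N M 0 x"
    using assms by (simp add: partial_b_Suc face_0_extra_degen int_mult_one)
  then show ?thesis
    using op_N_telescope[OF assms] op_b_diff_op_lam[of "extra_degen M 0 (op_N M 0 x)" 0] assms
    by (simp add: op_B_def Let_def)
qed

text \<open>By the identities above, \<open>b B = b (1 - \<lambda>) e N = (1 - \<lambda>) b' e N = (1 - \<lambda>) (1 - e b') N\<close>,
  and \<open>b' N = N b\<close> turns the last part into \<open>- B b\<close>.  What remains is \<open>(1 - \<lambda>) N\<close>, which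
  telescopes.\<close>

lemma bB_plus_Bb_Suc:
  assumes "x \<in> X (Suc n)"
  shows "op_b M (Suc (Suc n)) (op_B M (Suc n) x) \<oplus>\<^bsub>obj M (Suc n)\<^esub> op_B M n (op_b M (Suc n) x)
    = x \<ominus>\<^bsub>obj M (Suc n)\<^esub> cpow (Suc n) (Suc (Suc n)) x"
proof -
  let ?u = "op_lam M (Suc n)"
  define y where "y = op_N M (Suc n) x"
  define z where "z = extra_degen M n (op_N M n (op_b M (Suc n) x))"
  have cl: "y \<in> X (Suc n)" "z \<in> X (Suc n)" "?u y \<in> X (Suc n)" "?u z \<in> X (Suc n)"
    using assms by (simp_all add: y_def z_def)
  have "partial_b (Suc n) (Suc (Suc n)) (extra_degen M (Suc n) y) = y \<ominus>\<^bsub>obj M (Suc n)\<^esub> z"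
    using cl assms partial_b_op_N[OF assms] partial_b_extra_degen[of y n "Suc n"]
        by (simp add: y_def z_def)
  then have "op_b M (Suc (Suc n)) (op_B M (Suc n) x)
    = (y \<ominus>\<^bsub>obj M (Suc n)\<^esub> z) \<ominus>\<^bsub>obj M (Suc n)\<^esub> (?u y \<ominus>\<^bsub>obj M (Suc n)\<^esub> ?u z)"
    using op_b_diff_op_lam[of "extra_degen M (Suc n) y" "Suc n"] cl
      linear_map_diff[OF module_obj module_obj op_lam_linear, of y "Suc n" z]
    by (simp add: op_B_def Let_def y_def[symmetric])
  moreover have "op_B M n (op_b M (Suc n) x) = z \<ominus>\<^bsub>obj M (Suc n)\<^esub> ?u z"
    by (simp add: op_B_def Let_def z_def)
  moreover have "(y \<ominus>\<^bsub>obj M (Suc n)\<^esub> z) \<ominus>\<^bsub>obj M (Suc n)\<^esub> (?u y \<ominus>\<^bsub>obj M (Suc n)\<^esub> ?u z)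
      \<oplus>\<^bsub>obj M (Suc n)\<^esub> (z \<ominus>\<^bsub>obj M (Suc n)\<^esub> ?u z) = y \<ominus>\<^bsub>obj M (Suc n)\<^esub> ?u y"
    using cl by (intro abelian_group_diff_diff_cancel) auto
  ultimately show ?thesis
    using op_N_telescope[OF assms] by (simp only: y_def)
qed

subsection \<open>Degenerate elements\<close>

lemma submodule_degenerate: "submodule (degenerate R M n) R (obj M n)"
  unfolding degenerate_def
proof (rule submodule_gen[OF module_obj], safe)
  fix i x assume "1 \<le> n" "i \<le> n - 1" "x \<in> X (n - 1)"
  then show "degen M (n - 1) i x \<in> X n" by (cases n) auto
qed

lemma degen_in_degenerate: "i \<le> n \<Longrightarrow> x \<in> X n \<Longrightarrow> degen M n i x \<in> degenerate R M (Suc n)"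
  unfolding degenerate_def by (rule subsetD[OF gen_submodule_incl]) auto

text \<open>In \<open>e \<lambda>\<^sup>j \<sigma>\<^sub>i x\<close> the rotated index is an honest degeneracy for every \<open>j\<close>, so each summand of
  \<open>e N \<sigma>\<^sub>i x\<close> is degenerate.\<close>

lemma op_B_degenerate:
  assumes "x \<in> degenerate R M n"
  shows "op_B M n x \<in> degenerate R M (Suc n)"
  using module_obj module_obj op_B_linear submodule_degenerate _ _ assms[unfolded degenerate_def]
proof (rule linear_map_gen_submodule, safe)
  fix i x assume a: "1 \<le> n" "i \<le> n - 1" "x \<in> X (n - 1)"
  then obtain n' where n: "n = Suc n'" by (cases n) auto
  show "degen M (n - 1) i x \<in> X n" using a n by simp
  define y where "y = degen M n' i x"
  have y: "y \<in> X n" using a n by (simp add: y_def)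
  have "extra_degen M n (op_N M n y) \<in> degenerate R M (Suc n)"
    unfolding extra_degen_op_N[OF y]
  proof (intro submodule_finsum[OF module_obj submodule_degenerate]
      submodule_int_mult[OF module_obj submodule_degenerate])
    fix j assume "j \<in> {..n}"
    moreover have "(i + j + 1) mod (n' + 2) \<le> n"
      using n by (simp add: less_Suc_eq_le[symmetric])
    ultimately show "extra_degen M n (cpow n j y) \<in> degenerate R M (Suc n)"
      using a n by (auto simp: y_def extra_degen_cyc_pow_degen intro!: degen_in_degenerate)
  qed
  moreover have "degen M n 0 (add_pow (obj M n) ((-1::int) ^ Suc n) (cyc M n (op_N M n y)))
    \<in> degenerate R M (Suc n)"
    using y by (intro degen_in_degenerate int_mult_closed) auto
  ultimately have "op_B M n y \<in> degenerate R M (Suc n)"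
    unfolding op_B_eq_extra_degen[OF y] a_minus_def
    using O.submoduleE[OF submodule_degenerate] by blast
  then show "op_B M n (degen M (n - 1) i x) \<in> degenerate R M (Suc n)"
    by (simp add: y_def n)
qed

end

section \<open>Natural families of maps\<close>

text \<open>Morphisms of \<open>\<Lambda>\<^sub>\<infinity>\<close>-modules, as far as they concern faces, degeneracies and cyclic
  operators. The vertical operators of a cylindrical module are such families between its rows;
  composites of them are families again, which lets whole vertical words move past horizontal
  ones.\<close>

definition lambda_hom ::
    "('k, 'a) lam_data \<Rightarrow> ('k, 'a) lam_data \<Rightarrow> (nat \<Rightarrow> 'a \<Rightarrow> 'a) \<Rightarrow> bool" where
  "lambda_hom M N \<phi> \<longleftrightarrow>
    (\<forall>n. \<forall>x\<in>carrier (obj M n). \<phi> n x \<in> carrier (obj N n) \<and> cyc N n (\<phi> n x) = \<phi> n (cyc M n x) \<and>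
      (\<forall>i\<le>n. degen N n i (\<phi> n x) = \<phi> (Suc n) (degen M n i x))) \<and>
    (\<forall>n. \<forall>x\<in>carrier (obj M (Suc n)). \<forall>i\<le>Suc n.
      face N (Suc n) i (\<phi> (Suc n) x) = \<phi> n (face M (Suc n) i x))"

lemma lambda_hom_closed:
  "lambda_hom M N \<phi> \<Longrightarrow> x \<in> carrier (obj M n) \<Longrightarrow> \<phi> n x \<in> carrier (obj N n)"
  by (auto simp: lambda_hom_def)

lemma lambda_hom_cyc:
  "lambda_hom M N \<phi> \<Longrightarrow> x \<in> carrier (obj M n) \<Longrightarrow> cyc N n (\<phi> n x) = \<phi> n (cyc M n x)"
  by (auto simp: lambda_hom_def)

lemma lambda_hom_degen:
  "lambda_hom M N \<phi> \<Longrightarrow> x \<in> carrier (obj M n) \<Longrightarrow> i \<le> n \<Longrightarrow>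
    degen N n i (\<phi> n x) = \<phi> (Suc n) (degen M n i x)"
  by (auto simp: lambda_hom_def)

lemma lambda_hom_face:
  "lambda_hom M N \<phi> \<Longrightarrow> x \<in> carrier (obj M (Suc n)) \<Longrightarrow> i \<le> Suc n \<Longrightarrow>
    face N (Suc n) i (\<phi> (Suc n) x) = \<phi> n (face M (Suc n) i x)"
  by (auto simp: lambda_hom_def)

lemma lambda_hom_id: "lambda_hom M M (\<lambda>n x. x)"
  by (simp add: lambda_hom_def)

lemma lambda_hom_comp:
  "lambda_hom M N \<phi> \<Longrightarrow> lambda_hom N P \<psi> \<Longrightarrow> lambda_hom M P (\<lambda>n x. \<psi> n (\<phi> n x))"
  by (simp add: lambda_hom_def)

lemma lambda_hom_funpow: "lambda_hom M M \<phi> \<Longrightarrow> lambda_hom M M (\<lambda>n. \<phi> n ^^ j)"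
  by (induction j) (auto simp: lambda_hom_def)

context lambda_infty_module
begin

lemma lambda_hom_cyc_pow:
  assumes "lambda_hom M N \<phi>" "x \<in> X n"
  shows "(cyc N n ^^ j) (\<phi> n x) = \<phi> n (cpow n j x)"
  using assms by (induction j) (auto simp: lambda_hom_cyc)

lemma lambda_hom_extra_degen:
  assumes "lambda_hom M N \<phi>" "x \<in> X n"
  shows "extra_degen N n (\<phi> n x) = \<phi> (Suc n) (extra_degen M n x)"
  using assms lambda_hom_cyc[of M N \<phi> "degen M n n x" "Suc n"]
  by (simp add: extra_degen_def lambda_hom_degen)

lemma lambda_hom_degens:
  assumes "lambda_hom M N \<phi>" "admissible m l" "x \<in> X m"
  shows "degens N m l (\<phi> m x) = \<phi> (m + length l) (degens M m l x)"
  using assms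
  by (induction l rule: rev_induct) (auto simp: admissible_snoc degens_snoc lambda_hom_degen)

lemma lambda_hom_faces_0:
  assumes "lambda_hom M N \<phi>" "k \<le> n" "x \<in> X n"
  shows "back_face N n k (\<phi> n x) = \<phi> (n - k) (back_face M n k x)"
  using assms
proof (induction k arbitrary: n x)
  case (Suc k)
  then obtain n' where "n = Suc n'" by (cases n) auto
  then show ?case using Suc by (simp add: lambda_hom_face)
qed simp

end

section \<open>Shuffles\<close>

definition hor_list :: "nat \<Rightarrow> nat \<Rightarrow> (nat \<Rightarrow> nat) \<Rightarrow> nat list" where
  "hor_list p q \<eta> = map (\<lambda>j. \<eta> j - 1) [p + 1..<p + q + 1]"

definition ver_list :: "nat \<Rightarrow> (nat \<Rightarrow> nat) \<Rightarrow> nat list" where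
  "ver_list p \<eta> = map (\<lambda>j. \<eta> j - 1) [1..<p + 1]"

lemma length_hor_list [simp]: "length (hor_list p q \<eta>) = q"
  and length_ver_list [simp]: "length (ver_list p \<eta>) = p"
  by (simp_all add: hor_list_def ver_list_def)

lemma finite_shuffle_perms: "finite (shuffle_perms p q)"
  by (rule finite_subset[OF _ finite_permutations[of "{1..p + q}"]]) (auto simp: shuffle_perms_def)

lemma shuffle_perms_range:
  assumes "\<eta> \<in> shuffle_perms p q" "j \<in> {1..p + q}"
  shows "\<eta> j \<in> {1..p + q}"
  using assms permutes_in_image[of \<eta> "{1..p + q}" j] by (auto simp: shuffle_perms_def)

lemma shuffle_perms_pred_less:
  assumes "\<eta> \<in> shuffle_perms p q" "1 \<le> j" "j \<le> p + q"
  shows "\<eta> j - 1 < p + q"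
  using shuffle_perms_range[OF assms(1), of j] assms(2,3) by auto

lemma sorted_wrt_map_upt:
  assumes "\<And>i j. a \<le> i \<Longrightarrow> i < j \<Longrightarrow> j < b \<Longrightarrow> f i < f j"
  shows "sorted_wrt (<) (map f [a..<b])"
  unfolding sorted_wrt_iff_nth_less using assms by simp

lemma admissible_hor_list:
  assumes "\<eta> \<in> shuffle_perms p q"
  shows "admissible p (hor_list p q \<eta>)"
proof -
  have "\<eta> i - 1 < \<eta> j - 1" if "p + 1 \<le> i" "i < j" "j < p + q + 1" for i j
    using strict_mono_onD[of "{p + 1..p + q}" \<eta> i j] shuffle_perms_range[OF assms, of i] assms that
    by (auto simp: shuffle_perms_def)
  then have "sorted_wrt (<) (hor_list p q \<eta>)"
    unfolding hor_list_def by (rule sorted_wrt_map_upt)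
  moreover have "set (hor_list p q \<eta>) \<subseteq> {..<p + q}"
    by (auto simp: hor_list_def intro!: shuffle_perms_pred_less[OF assms, unfolded One_nat_def])
  ultimately show ?thesis by (simp add: admissible_def)
qed

lemma admissible_ver_list:
  assumes "\<eta> \<in> shuffle_perms p q"
  shows "admissible q (ver_list p \<eta>)"
proof -
  have "\<eta> i - 1 < \<eta> j - 1" if "1 \<le> i" "i < j" "j < p + 1" for i j
    using strict_mono_onD[of "{1..p}" \<eta> i j] shuffle_perms_range[OF assms, of i] assms that
    by (auto simp: shuffle_perms_def)
  then have "sorted_wrt (<) (ver_list p \<eta>)"
    unfolding ver_list_def by (rule sorted_wrt_map_upt)
  moreover have "set (ver_list p \<eta>) \<subseteq> {..<p + q}"
    by (auto simp: ver_list_def intro!: shuffle_perms_pred_less[OF assms, unfolded One_nat_def])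
  ultimately show ?thesis by (simp add: admissible_def add.commute)
qed

lemma set_hor_list_eq:
  assumes "\<eta> \<in> shuffle_perms p q"
  shows "set (hor_list p q \<eta>) = {..<p + q} - set (ver_list p \<eta>)"
proof -
  have p: "\<eta> permutes {1..p + q}" using assms by (simp add: shuffle_perms_def)
  have inj: "inj_on (\<lambda>j. \<eta> j - 1) {1..p + q}"
  proof (rule inj_onI)
    fix i j assume a: "i \<in> {1..p + q}" "j \<in> {1..p + q}" "\<eta> i - 1 = \<eta> j - 1"
    then have "\<eta> i = \<eta> j"
      using shuffle_perms_range[OF assms, of i] shuffle_perms_range[OF assms, of j] by auto
    then show "i = j" using permutes_inj[OF p] by (auto dest: injD)
  qed
  have "(\<lambda>j. \<eta> j - 1) ` {1..p + q} = (\<lambda>i. i - 1) ` \<eta> ` {1..p + q}" by (simp add: image_image)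
  also have "\<dots> = (\<lambda>i. i - 1) ` {1..p + q}" by (simp only: permutes_image[OF p])
  also have "\<dots> = {..<p + q}"
  proof
    show "{..<p + q} \<subseteq> (\<lambda>i. i - 1) ` {1..p + q}"
    proof
      fix x assume "x \<in> {..<p + q}"
      then show "x \<in> (\<lambda>i. i - 1) ` {1..p + q}" by (intro image_eqI[of _ _ "Suc x"]) auto
    qed
  qed auto
  finally have im: "(\<lambda>j. \<eta> j - 1) ` {1..p + q} = {..<p + q}" .
  have "set (hor_list p q \<eta>) = (\<lambda>j. \<eta> j - 1) ` ({1..p + q} - {1..p})"
    by (auto simp: hor_list_def intro!: image_eqI)
  also have "\<dots> = (\<lambda>j. \<eta> j - 1) ` {1..p + q} - (\<lambda>j. \<eta> j - 1) ` {1..p}"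
    using inj by (intro inj_on_image_set_diff) auto
  also have "(\<lambda>j. \<eta> j - 1) ` {1..p} = set (ver_list p \<eta>)"
    by (auto simp: ver_list_def intro!: image_eqI)
  finally show ?thesis by (simp only: im)
qed

lemma set_ver_list_subset: "\<eta> \<in> shuffle_perms p q \<Longrightarrow> set (ver_list p \<eta>) \<subseteq> {..<p + q}"
  using admissible_ver_list by (fastforce simp: admissible_def)

lemma card_set_hor_list:
  "\<eta> \<in> shuffle_perms p q \<Longrightarrow> card (set (hor_list p q \<eta>)) = q"
  using admissible_hor_list[of \<eta> p q] strict_sorted_iff[of "hor_list p q \<eta>"]
  by (simp add: admissible_def distinct_card)

text \<open>The two words of a shuffle are increasing, so each is determined by its set of indices,
  and the two sets are complementary.\<close>

lemma shuffle_perms_eqI: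
  assumes \<eta>: "\<eta> \<in> shuffle_perms p q" and \<theta>: "\<theta> \<in> shuffle_perms p q"
    and "set (ver_list p \<eta>) = set (ver_list p \<theta>)"
  shows "\<eta> = \<theta>"
proof
  have "ver_list p \<eta> = ver_list p \<theta>"
    using assms admissible_ver_list[OF \<eta>] admissible_ver_list[OF \<theta>]
    by (intro strict_sorted_equal) (auto simp: admissible_def)
  moreover have "hor_list p q \<eta> = hor_list p q \<theta>"
    using assms admissible_hor_list[OF \<eta>] admissible_hor_list[OF \<theta>]
      set_hor_list_eq[OF \<eta>] set_hor_list_eq[OF \<theta>]
    by (intro strict_sorted_equal) (auto simp: admissible_def)
  ultimately have "map (\<lambda>j. \<eta> j - 1) ([1..<p + 1] @ [p + 1..<p + q + 1])
    = map (\<lambda>j. \<theta> j - 1) ([1..<p + 1] @ [p + 1..<p + q + 1])"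
    by (simp add: hor_list_def ver_list_def)
  then have *: "\<eta> j - 1 = \<theta> j - 1" if "j \<in> {1..p + q}" for j
    using that unfolding map_eq_conv by auto
  fix j show "\<eta> j = \<theta> j"
  proof (cases "j \<in> {1..p + q}")
    case True
    then show ?thesis
      using * shuffle_perms_range[OF \<eta> True] shuffle_perms_range[OF \<theta> True] by fastforce
  next
    case False
    then show ?thesis using \<eta> \<theta> by (simp add: shuffle_perms_def permutes_def)
  qed
qed

text \<open>Exchange of the adjacent blocks \<open>{c + 1..c + a}\<close> and \<open>{c + a + 1..c + a + b}\<close>.\<close>

definition block_swap :: "nat \<Rightarrow> nat \<Rightarrow> nat \<Rightarrow> nat \<Rightarrow> nat" where
  "block_swap c a b x =
    (if c < x \<and> x \<le> c + a then x + b else if c + a < x \<and> x \<le> c + a + b then x - a else x)"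

lemma block_swap_0: "block_swap c 0 b = id" "block_swap c a 0 = id"
  by (auto simp: block_swap_def)

lemma block_swap_1_Suc:
  "block_swap c 1 (Suc b) = transpose (c + 1 + b) (c + 2 + b) \<circ> block_swap c 1 b"
  by (rule ext) (auto simp: block_swap_def transpose_def)

lemma block_swap_Suc: "block_swap c (Suc a) b = block_swap c a b \<circ> block_swap (c + a) 1 b"
  by (rule ext) (auto simp: block_swap_def)

lemma block_swap_1_sign: "permutation (block_swap c 1 b) \<and> sign (block_swap c 1 b) = (-1) ^ b"
proof (induction b)
  case 0
  then show ?case by (simp add: block_swap_0 sign_id)
next
  case (Suc b)
  have "permutation (transpose (c + 1 + b) (c + 2 + b))" by (rule permutation_swap_id)
  then show ?case
    unfolding block_swap_1_Suc using Suc
    by (auto simp only: permutation_compose sign_compose sign_swap_id) simp_all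
qed

text \<open>The elements of the first block are moved one by one past the second block, and each of
  these moves consists of \<open>b\<close> adjacent transpositions.\<close>

lemma block_swap_sign: "permutation (block_swap c a b) \<and> sign (block_swap c a b) = (-1) ^ (a * b)"
proof (induction a)
  case 0
  then show ?case by (simp add: block_swap_0 sign_id)
next
  case (Suc a)
  then show ?case
    unfolding block_swap_Suc using block_swap_1_sign[of "c + a" b]
    by (simp only: permutation_compose sign_compose) (simp add: power_add)
qed

lemma block_swap_permutes:
  assumes "c + a + b \<le> n"
  shows "block_swap c a b permutes {1..n}"
  unfolding permutes_def
proof
  show "\<forall>x. x \<notin> {1..n} \<longrightarrow> block_swap c a b x = x" using assms by (auto simp: block_swap_def)
  have "bij (block_swap c a b)" using block_swap_sign by (intro permutation_bijective) auto
  then show "\<forall>y. \<exists>!x. block_swap c a b x = y" by (simp add: bij_iff)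
qed

text \<open>The shuffle that belongs to the term \<open>e \<tau>\<^sup>j\<close> with \<open>c = q - j\<close>.\<close>

lemma block_swap_first_shuffle:
  assumes "c \<le> q"
  shows "block_swap 0 p c \<in> shuffle_perms p q"
    and "set (ver_list p (block_swap 0 p c)) = {c..<p + c}"
proof -
  show "block_swap 0 p c \<in> shuffle_perms p q"
    using assms block_swap_permutes[of 0 p c "p + q"]
    by (auto simp: shuffle_perms_def block_swap_def strict_mono_on_def)
  have "set (ver_list p (block_swap 0 p c)) = (\<lambda>j. j + c - 1) ` {1..<p + 1}"
    unfolding ver_list_def by (auto simp: block_swap_def intro!: image_eqI)
  also have "\<dots> = {c..<p + c}"
  proof
    show "{c..<p + c} \<subseteq> (\<lambda>j. j + c - 1) ` {1..<p + 1}"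
    proof
      fix x assume "x \<in> {c..<p + c}"
      then show "x \<in> (\<lambda>j. j + c - 1) ` {1..<p + 1}" by (intro image_eqI[of _ _ "x + 1 - c"]) auto
    qed
  qed auto
  finally show "set (ver_list p (block_swap 0 p c)) = {c..<p + c}" .
qed

text \<open>The shuffle that belongs to the term \<open>\<tau>\<^sup>q\<^sup>+\<^sup>1 e t\<^sup>a\<close>.\<close>

lemma block_swap_last_shuffle:
  assumes "a \<le> p"
  shows "block_swap (p - a) a q \<in> shuffle_perms p q"
    and "set (hor_list p q (block_swap (p - a) a q)) = {p - a..<p + q - a}"
proof -
  show "block_swap (p - a) a q \<in> shuffle_perms p q"
    using assms block_swap_permutes[of "p - a" a q "p + q"]
    by (auto simp: shuffle_perms_def block_swap_def strict_mono_on_def)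
  have "set (hor_list p q (block_swap (p - a) a q)) = (\<lambda>j. j - a - 1) ` {p + 1..<p + q + 1}"
    unfolding hor_list_def using assms by (auto simp: block_swap_def intro!: image_eqI)
  also have "\<dots> = {p - a..<p + q - a}"
  proof
    show "{p - a..<p + q - a} \<subseteq> (\<lambda>j. j - a - 1) ` {p + 1..<p + q + 1}"
    proof
      fix x assume "x \<in> {p - a..<p + q - a}"
      then show "x \<in> (\<lambda>j. j - a - 1) ` {p + 1..<p + q + 1}"
        using assms by (intro image_eqI[of _ _ "x + a + 1"]) auto
    qed
  qed (use assms in auto)
  finally show "set (hor_list p q (block_swap (p - a) a q)) = {p - a..<p + q - a}" .
qed

text \<open>The condition that all degeneracies of both words are absorbed by the faces, in terms of
  the rotated indices.\<close>

definition survives :: "nat \<Rightarrow> nat \<Rightarrow> nat \<Rightarrow> nat \<Rightarrow> (nat \<Rightarrow> nat) \<Rightarrow> bool" where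
  "survives p q s j \<eta> \<longleftrightarrow>
    (\<forall>i\<in>set (hor_list p q \<eta>). (i + j + 1) mod (p + q + 1) < s) \<and>
    (\<forall>i\<in>set (ver_list p \<eta>). s \<le> (i + j + 1) mod (p + q + 1))"

lemma rotation_below:
  fixes j n s :: nat
  assumes "j \<le> n" "s \<le> n + 1"
  shows "{i. i < n \<and> (i + j + 1) mod (n + 1) < s} = {..<s - (j + 1)} \<union> {n - j..<min n (n - j + s)}"
proof -
  have "(i + j + 1) mod (n + 1) = (if i < n - j then i + j + 1 else i + j - n)" if "i < n" for i
    using assms that by (subst mod_less_twice) auto
  then show ?thesis using assms by (auto split: if_splits)
qed

text \<open>The two conditions say exactly that the horizontal indices are those that the rotation
  moves below \<open>s\<close>.\<close>

lemma survives_hor_list: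
  assumes "\<eta> \<in> shuffle_perms p q" "survives p q s j \<eta>" "j \<le> p + q" "s \<le> p + q + 1"
  shows "set (hor_list p q \<eta>) = {..<s - (j + 1)} \<union> {p + q - j..<min (p + q) (p + q - j + s)}"
proof -
  have "set (hor_list p q \<eta>) = {i. i < p + q \<and> (i + j + 1) mod (p + q + 1) < s}"
    using assms(2) set_ver_list_subset[OF assms(1)]
    unfolding set_hor_list_eq[OF assms(1)] survives_def by (fastforce simp: not_le[symmetric])
  then show ?thesis using rotation_below[OF assms(3,4)] by simp
qed

lemma survives_iff_set:
  assumes "\<eta> \<in> shuffle_perms p q" "j \<le> p + q" "s \<le> p + q + 1"
  shows "survives p q s j \<eta> \<longleftrightarrow>
    set (hor_list p q \<eta>) = {..<s - (j + 1)} \<union> {p + q - j..<min (p + q) (p + q - j + s)}"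
proof
  assume "set (hor_list p q \<eta>) = {..<s - (j + 1)} \<union> {p + q - j..<min (p + q) (p + q - j + s)}"
  then have eq: "set (hor_list p q \<eta>) = {i. i < p + q \<and> (i + j + 1) mod (p + q + 1) < s}"
    using rotation_below[OF assms(2,3)] by simp
  have ver: "set (ver_list p \<eta>) = {..<p + q} - set (hor_list p q \<eta>)"
    using set_hor_list_eq[OF assms(1)] set_ver_list_subset[OF assms(1)] by auto
  show "survives p q s j \<eta>"
    unfolding survives_def
  proof (intro conjI ballI)
    fix i assume "i \<in> set (hor_list p q \<eta>)"
    then show "(i + j + 1) mod (p + q + 1) < s" unfolding eq by blast
  next
    fix i assume "i \<in> set (ver_list p \<eta>)"
    then have "i < p + q" "\<not> (i + j + 1) mod (p + q + 1) < s" unfolding ver eq by blast+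
    then show "s \<le> (i + j + 1) mod (p + q + 1)" by (simp only: not_less)
  qed
qed (rule survives_hor_list[OF assms(1) _ assms(2,3)])

text \<open>There are \<open>q\<close> horizontal indices, but for \<open>j > q\<close> the rotation moves \<open>q + 1\<close> of the
  indices \<open>0, \<dots>, p + q - 1\<close> below \<open>q + 1\<close>.  For \<open>j \<le> q\<close> one of the places below \<open>q + 1\<close> is taken
  by the index \<open>p + q\<close>, and the other \<open>q\<close> places determine the shuffle.\<close>

lemma survives_Suc_iff:
  assumes \<eta>: "\<eta> \<in> shuffle_perms p q" and j: "j \<le> p + q"
  shows "survives p q (Suc q) j \<eta> \<longleftrightarrow> j \<le> q \<and> \<eta> = block_swap 0 p (q - j)"
proof (cases "j \<le> q")
  case True
  let ?\<theta> = "block_swap 0 p (q - j)"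
  note \<theta> = block_swap_first_shuffle[of "q - j" q p, OF diff_le_self]
  have "{..<p + q} - {q - j..<p + (q - j)} = {..<q - j} \<union> {p + q - j..<p + q}"
  proof -
    obtain c where "q = c + j" using True by (metis add.commute le_Suc_ex)
    then show ?thesis by auto
  qed
  then have "set (hor_list p q ?\<theta>) = {..<q - j} \<union> {p + q - j..<p + q}"
    unfolding set_hor_list_eq[OF \<theta>(1)] \<theta>(2) .
  then have surv: "survives p q (Suc q) j ?\<theta>"
    using \<theta> j True by (subst survives_iff_set) auto
  have "\<eta> = ?\<theta>" if "survives p q (Suc q) j \<eta>"
  proof (rule shuffle_perms_eqI[OF \<eta> \<theta>(1)])
    have "set (hor_list p q \<eta>) = set (hor_list p q ?\<theta>)"
      using survives_hor_list[OF \<eta> that j] survives_hor_list[OF \<theta>(1) surv j] by simp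
    then show "set (ver_list p \<eta>) = set (ver_list p ?\<theta>)"
      using set_hor_list_eq[OF \<eta>] set_hor_list_eq[OF \<theta>(1)] set_ver_list_subset[OF \<eta>]
        set_ver_list_subset[OF \<theta>(1)] by auto
  qed
  then show ?thesis using True surv by blast
next
  case False
  have "\<not> survives p q (Suc q) j \<eta>"
  proof
    assume "survives p q (Suc q) j \<eta>"
    then have "set (hor_list p q \<eta>) = {p + q - j..<p + q - j + Suc q}"
      using survives_hor_list[OF \<eta> _ j, of "Suc q"] False j by simp
    then show False using card_set_hor_list[OF \<eta>] by simp
  qed
  then show ?thesis using False by simp
qed

text \<open>For \<open>j < q\<close> one of the \<open>q\<close> places below \<open>q\<close> is taken by the index \<open>p + q\<close>, so there are
  not enough horizontal indices.\<close>

lemma survives_same_iff: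
  assumes \<eta>: "\<eta> \<in> shuffle_perms p q" and j: "j \<le> p + q"
  shows "survives p q q j \<eta> \<longleftrightarrow> q \<le> j \<and> \<eta> = block_swap (p + q - j) (j - q) q"
proof (cases "q \<le> j")
  case True
  let ?\<theta> = "block_swap (p + q - j) (j - q) q"
  obtain a where a: "j = q + a" using True by (metis le_Suc_ex)
  then have e: "p + q - j = p - a" "p - a + q = p + q - a" "j - q = a" "a \<le> p" using j by simp_all
  have \<theta>: "?\<theta> \<in> shuffle_perms p q" "set (hor_list p q ?\<theta>) = {p + q - j..<p + q - j + q}"
    using block_swap_last_shuffle[OF e(4), of q] unfolding e by simp_all
  have "p + q - j + q \<le> p + q" using True by simp
  then have surv: "survives p q q j ?\<theta>"
    using True by (subst survives_iff_set[OF \<theta>(1) j]) (simp_all add: \<theta>(2) min_def)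
  have "\<eta> = ?\<theta>" if "survives p q q j \<eta>"
  proof (rule shuffle_perms_eqI[OF \<eta> \<theta>(1)])
    have "set (hor_list p q \<eta>) = set (hor_list p q ?\<theta>)"
      using survives_hor_list[OF \<eta> that j] survives_hor_list[OF \<theta>(1) surv j] by simp
    then show "set (ver_list p \<eta>) = set (ver_list p ?\<theta>)"
      using set_hor_list_eq[OF \<eta>] set_hor_list_eq[OF \<theta>(1)] set_ver_list_subset[OF \<eta>]
        set_ver_list_subset[OF \<theta>(1)] by auto
  qed
  then show ?thesis using True surv by blast
next
  case False
  have "\<not> survives p q q j \<eta>"
  proof
    assume "survives p q q j \<eta>"
    then have "set (hor_list p q \<eta>) = {..<q - (j + 1)} \<union> {p + q - j..<p + q}"
      using survives_hor_list[OF \<eta> _ j, of q] False j by simp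
    then have "card (set (hor_list p q \<eta>)) \<le> (q - (j + 1)) + j"
      using card_Un_le[of "{..<q - (j + 1)}" "{p + q - j..<p + q}"] j by simp
    then show False using card_set_hor_list[OF \<eta>] False by simp
  qed
  then show ?thesis using False by simp
qed

section \<open>Cylindrical modules\<close>

lemma hor_simps:
  "obj (hor C q) = (\<lambda>p. bi_obj C p q)" "face (hor C q) = (\<lambda>p. hface C p q)"
  "degen (hor C q) = (\<lambda>p. hdegen C p q)" "cyc (hor C q) = (\<lambda>p. hcyc C p q)"
  by (simp_all add: hor_def)

lemma ver_simps:
  "obj (ver C p) = (\<lambda>q. bi_obj C p q)" "face (ver C p) = (\<lambda>q. vface C p q)"
  "degen (ver C p) = (\<lambda>q. vdegen C p q)" "cyc (ver C p) = (\<lambda>q. vcyc C p q)"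
  by (simp_all add: ver_def)

lemma diagonal_simps:
  "obj (diagonal C) n = bi_obj C n n"
  "face (diagonal C) n i x = hface C n (n - 1) i (vface C n n i x)"
  "degen (diagonal C) n i x = hdegen C n (n + 1) i (vdegen C n n i x)"
  "cyc (diagonal C) n x = hcyc C n n (vcyc C n n x)"
  by (simp_all add: diagonal_def)

sublocale cylindrical_module \<subseteq> H: lambda_infty_module R "hor C q" for q
  by (rule hor_lambda_infty)

sublocale cylindrical_module \<subseteq> V: lambda_infty_module R "ver C p" for p
  by (rule ver_lambda_infty)

context cylindrical_module
begin

abbreviation Y :: "nat \<Rightarrow> nat \<Rightarrow> 'a set" where
  "Y p q \<equiv> carrier (bi_obj C p q)"

lemma module_bi_obj: "module R (bi_obj C p q)"
  using H.module_obj[of q p] by (simp add: hor_simps)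

lemmas hface_closed [simp] = H.face_closed[unfolded hor_simps]
lemmas hdegen_closed [simp] = H.degen_closed[unfolded hor_simps]
lemmas hcyc_closed [simp] = H.cyc_closed[unfolded hor_simps]
lemmas vface_closed [simp] = V.face_closed[unfolded ver_simps]
lemmas vdegen_closed [simp] = V.degen_closed[unfolded ver_simps]
lemmas vcyc_closed [simp] = V.cyc_closed[unfolded ver_simps]

lemmas hor_degens_closed [simp] = H.degens_closed[unfolded hor_simps]
lemmas ver_degens_closed [simp] = V.degens_closed[unfolded ver_simps]
lemmas hor_extra_degen_closed [simp] = H.extra_degen_closed[unfolded hor_simps]
lemmas ver_extra_degen_closed [simp] = V.extra_degen_closed[unfolded ver_simps]
lemmas hcyc_pow_closed [simp] = H.cpow_closed[unfolded hor_simps]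
lemmas vcyc_pow_closed [simp] = V.cpow_closed[unfolded ver_simps]

lemma vface_hom: "j \<le> Suc q \<Longrightarrow> lambda_hom (hor C (Suc q)) (hor C q) (\<lambda>p. vface C p (Suc q) j)"
  using hface_vface[of "Suc _" _ "Suc q" j] hdegen_vface[of _ _ "Suc q" j] hcyc_vface[of "Suc q" j]
  by (simp add: lambda_hom_def hor_simps)

lemma vdegen_hom: "j \<le> q \<Longrightarrow> lambda_hom (hor C q) (hor C (Suc q)) (\<lambda>p. vdegen C p q j)"
  using hface_vdegen[of "Suc _" _ j q] hdegen_vdegen[of _ _ j q] hcyc_vdegen[of j q]
  by (simp add: lambda_hom_def hor_simps)

lemma vcyc_hom: "lambda_hom (hor C q) (hor C q) (\<lambda>p. vcyc C p q)"
  using hface_vcyc[of "Suc _"] hdegen_vcyc hcyc_vcyc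
  by (simp add: lambda_hom_def hor_simps)

lemma vcyc_pow_hom: "lambda_hom (hor C q) (hor C q) (\<lambda>p. vcyc C p q ^^ j)"
  by (rule lambda_hom_funpow[OF vcyc_hom])

lemma ver_extra_degen_hom:
  "lambda_hom (hor C q) (hor C (Suc q)) (\<lambda>p. extra_degen (ver C p) q)"
  using lambda_hom_comp[OF vdegen_hom[of q q] vcyc_hom]
      by (simp add: extra_degen_def[abs_def] ver_simps)

lemma ver_degens_hom:
  "admissible q l \<Longrightarrow> lambda_hom (hor C q) (hor C (q + length l)) (\<lambda>p. degens (ver C p) q l)"
proof (induction l rule: rev_induct)
  case Nil
  then show ?case using lambda_hom_id by (simp add: lambda_hom_def)
next
  case (snoc i l)
  then show ?case
    using lambda_hom_comp[OF snoc.IH vdegen_hom[of i "q + length l"]]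
    by (simp add: admissible_snoc degens_snoc[abs_def] ver_simps)
qed

lemma ver_front_face_hom:
  "s \<le> n \<Longrightarrow> lambda_hom (hor C n) (hor C s) (\<lambda>p. front_face (ver C p) n s)"
proof (induction n)
  case 0
  then show ?case by (simp add: lambda_hom_def)
next
  case (Suc n)
  show ?case
  proof (cases "s = Suc n")
    case True
    then show ?thesis by (simp add: lambda_hom_def)
  next
    case False
    then show ?thesis
      using lambda_hom_comp[OF vface_hom[of "Suc n" n], of "hor C s"
          "\<lambda>p. front_face (ver C p) n s"] Suc
      by (simp add: ver_simps)
  qed
qed

subsection \<open>The diagonal\<close>

lemma diagonal_face_linear:
  assumes "1 \<le> n" "i \<le> n"
  shows "linear_map R (obj (diagonal C) n) (obj (diagonal C) (n - 1)) (face (diagonal C) n i)"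
proof -
  have "linear_map R (bi_obj C n n) (bi_obj C n (n - 1)) (vface C n n i)"
    "linear_map R (bi_obj C n (n - 1)) (bi_obj C (n - 1) (n - 1)) (hface C n (n - 1) i)"
    using assms V.face_linear[of n i n] H.face_linear[of n i "n - 1"]
        by (simp_all add: hor_simps ver_simps)
  from linear_map_comp[OF this]
  show ?thesis by (simp add: diagonal_def)
qed

lemma diagonal_degen_linear:
  assumes "i \<le> n"
  shows "linear_map R (obj (diagonal C) n) (obj (diagonal C) (n + 1)) (degen (diagonal C) n i)"
proof -
  have "linear_map R (bi_obj C n n) (bi_obj C n (n + 1)) (vdegen C n n i)"
    "linear_map R (bi_obj C n (n + 1)) (bi_obj C (n + 1) (n + 1)) (hdegen C n (n + 1) i)"
    using assms V.degen_linear[of i n n] H.degen_linear[of i n "n + 1"]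
        by (simp_all add: hor_simps ver_simps)
  from linear_map_comp[OF this]
  show ?thesis by (simp add: diagonal_def)
qed

lemma diagonal_cyc_linear: "linear_map R (obj (diagonal C) n) (obj (diagonal C) n) (cyc
    (diagonal C) n)"
proof -
  have "linear_map R (bi_obj C n n) (bi_obj C n n) (vcyc C n n)"
    "linear_map R (bi_obj C n n) (bi_obj C n n) (hcyc C n n)"
    using V.cyc_linear[of n n] H.cyc_linear[of n n] by (simp_all add: hor_simps ver_simps)
  from linear_map_comp[OF this]
  show ?thesis by (simp add: diagonal_def)
qed

lemmas hv_commute =
  lambda_hom_face[OF vface_hom, unfolded hor_simps]
  lambda_hom_degen[OF vface_hom, unfolded hor_simps]
  lambda_hom_cyc[OF vface_hom, unfolded hor_simps]
  lambda_hom_face[OF vdegen_hom, unfolded hor_simps]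
  lambda_hom_degen[OF vdegen_hom, unfolded hor_simps]
  lambda_hom_cyc[OF vdegen_hom, unfolded hor_simps]
  lambda_hom_face[OF vcyc_hom, unfolded hor_simps]
  lambda_hom_degen[OF vcyc_hom, unfolded hor_simps]
  lambda_hom_cyc[OF vcyc_hom, unfolded hor_simps]

lemma lambda_infty_module_diagonal: "lambda_infty_module R (diagonal C)"
proof (rule lambda_infty_module.intro)
  show "module R (obj (diagonal C) n)" for n
    by (simp add: diagonal_simps module_bi_obj)
  show "bij_betw (cyc (diagonal C) n) (carrier (obj (diagonal C) n)) (carrier (obj
      (diagonal C) n))" for n
    using bij_betw_trans[OF V.cyc_bij[of n n, unfolded ver_simps] H.cyc_bij[of n n, unfolded
        hor_simps]]
    by (simp add: diagonal_def comp_def hor_simps ver_simps)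
next
  fix n i j x assume a: "2 \<le> n" "i < j" "j \<le> n" "x \<in> carrier (obj (diagonal C) n)"
  then obtain m where n: "n = Suc (Suc m)" by (metis One_nat_def Suc_1 le_iff_add plus_nat.simps)
  have x: "x \<in> Y n n" using a by (simp add: diagonal_simps)
  have j: "0 < j" "j - 1 \<le> Suc m" "i \<le> Suc m" "i \<le> n" using a n by auto
  show "face (diagonal C) (n - 1) i (face (diagonal C) n j x)
    = face (diagonal C) (n - 1) (j - 1) (face (diagonal C) n i x)"
    using a x n j H.face_face[of n i j x n, unfolded hor_simps]
      V.face_face[of n i j "hface C (Suc m) n i (hface C n n j x)" m, unfolded ver_simps]
    by (simp add: diagonal_simps hv_commute)
next
  fix n i j x assume a: "i \<le> j" "j \<le> n" "x \<in> carrier (obj (diagonal C) n)"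
  then show "degen (diagonal C) (n + 1) i (degen (diagonal C) n j x)
    = degen (diagonal C) (n + 1) (j + 1) (degen (diagonal C) n i x)"
    using H.degen_degen[of i j n x n, unfolded hor_simps]
      V.degen_degen[of i j n "hdegen C (Suc n) n i (hdegen C n n j x)"
          "Suc (Suc n)", unfolded ver_simps]
    by (simp add: diagonal_simps hv_commute)
next
  fix n i j x assume a: "i < j" "j \<le> n" "x \<in> carrier (obj (diagonal C) n)"
  then obtain m where n: "n = Suc m" by (cases n) auto
  then show "face (diagonal C) (n + 1) i (degen (diagonal C) n j x)
    = degen (diagonal C) (n - 1) (j - 1) (face (diagonal C) n i x)"
    using a H.face_degen_less[of i j n x n, unfolded hor_simps]
      V.face_degen_less[of i j n "hface C (Suc n) n i (hdegen C n n j x)" n, unfolded ver_simps]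
    by (simp add: diagonal_simps hv_commute)
next
  fix n i j x assume a: "j \<le> n" "i = j \<or> i = j + 1" "x \<in> carrier (obj (diagonal C) n)"
  then show "face (diagonal C) (n + 1) i (degen (diagonal C) n j x) = x"
    using H.face_degen_same[of j n i x n, unfolded hor_simps]
      V.face_degen_same[of j n i "hface C (Suc n) n i (hdegen C n n j x)" n, unfolded ver_simps]
    by (auto simp add: diagonal_simps hv_commute)
next
  fix n i j x assume a: "j + 1 < i" "i \<le> n + 1" "x \<in> carrier (obj (diagonal C) n)"
  then obtain m where n: "n = Suc m" by (cases n) auto
  then show "face (diagonal C) (n + 1) i (degen (diagonal C) n j x)
    = degen (diagonal C) (n - 1) j (face (diagonal C) n (i - 1) x)"
    using a H.face_degen_greater[of j i n x n, unfolded hor_simps]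
      V.face_degen_greater[of j i n "hface C (Suc n) n i (hdegen C n n j x)" n, unfolded ver_simps]
    by (simp add: diagonal_simps hv_commute)
next
  fix n i x assume a: "1 \<le> i" "i \<le> n" "x \<in> carrier (obj (diagonal C) n)"
  then obtain m where n: "n = Suc m" by (cases n) auto
  then show "face (diagonal C) n i (cyc (diagonal C) n x)
      = cyc (diagonal C) (n - 1) (face (diagonal C) n (i - 1) x)"
    using a H.face_cyc[of i n x n, unfolded hor_simps]
      V.face_cyc[of i n "hface C n n i (hcyc C n n x)" m, unfolded ver_simps]
    by (simp add: diagonal_simps hv_commute)
next
  fix n x assume a: "1 \<le> n" "x \<in> carrier (obj (diagonal C) n)"
  then obtain m where n: "n = Suc m" by (cases n) auto
  then show "face (diagonal C) n 0 (cyc (diagonal C) n x) = face (diagonal C) n n x"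
    using a H.face_0_cyc[of n x n, unfolded hor_simps]
      V.face_0_cyc[of n "hface C n n 0 (hcyc C n n x)" m, unfolded ver_simps]
    by (simp add: diagonal_simps hv_commute)
next
  fix n i x assume a: "1 \<le> i" "i \<le> n" "x \<in> carrier (obj (diagonal C) n)"
  then show "degen (diagonal C) n i (cyc (diagonal C) n x) = cyc (diagonal C) (n + 1) (degen
      (diagonal C) n (i - 1) x)"
    using H.degen_cyc[of i n x n, unfolded hor_simps]
      V.degen_cyc[of i n "hdegen C n n i (hcyc C n n x)" "Suc n", unfolded ver_simps]
    by (simp add: diagonal_simps hv_commute)
next
  fix n x assume a: "x \<in> carrier (obj (diagonal C) n)"
  then show "degen (diagonal C) n 0 (cyc (diagonal C) n x)
    = cyc (diagonal C) (n + 1) (cyc (diagonal C) (n + 1) (degen (diagonal C) n n x))"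
    using H.degen_0_cyc[of x n n, unfolded hor_simps]
      V.degen_0_cyc[of "hdegen C n n 0 (hcyc C n n x)" "Suc n" n, unfolded ver_simps]
    by (simp add: diagonal_simps hv_commute)
qed (rule diagonal_face_linear diagonal_degen_linear diagonal_cyc_linear; assumption)+

end

sublocale cylindrical_module \<subseteq> D: lambda_infty_module R "diagonal C"
  by (rule lambda_infty_module_diagonal)

context cylindrical_module
begin

lemma diagonal_cyc_pow:
  assumes "x \<in> Y n n"
  shows "(cyc (diagonal C) n ^^ j) x = (hcyc C n n ^^ j) ((vcyc C n n ^^ j) x)"
proof (induction j)
  case (Suc j)
  have "(hcyc C n n ^^ j) (vcyc C n n y) = vcyc C n n ((hcyc C n n ^^ j) y)" if "y \<in> Y n n" for y
    using that H.lambda_hom_cyc_pow[OF vcyc_hom, of y n n j] by (simp add: hor_simps)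
  then show ?case using Suc assms by (simp add: diagonal_simps)
qed simp

lemma diagonal_extra_degen:
  assumes "x \<in> Y n n"
  shows "extra_degen (diagonal C) n x = extra_degen (hor C (Suc n)) n (extra_degen (ver C n) n x)"
  using assms hdegen_vcyc[of n n "vdegen C n n n x" "Suc n"]
  by (simp add: extra_degen_def diagonal_simps hor_simps ver_simps)

text \<open>The vertical operators of a word can be moved inside, past all the horizontal ones.\<close>

lemma AW_comp_word:
  assumes x: "x \<in> Y p q" and n: "n = p + q" "r + s = Suc n"
    and h: "admissible p lh" "length lh = q" and v: "admissible q lv" "length lv = p"
  shows "AW_comp C r s (extra_degen (diagonal C) n ((cyc (diagonal C) n ^^ j)
      (degens (hor C n) p lh (degens (ver C p) q lv x)))) =
    add_pow (bi_obj C r s) ((-1::int) ^ (r * s))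
      (back_face (hor C s) (Suc n) s (extra_degen (hor C s) n ((hcyc C n s ^^ j) (degens
          (hor C s) p lh
        (front_face (ver C p) (Suc n) s
          (extra_degen (ver C p) n ((vcyc C p n ^^ j) (degens (ver C p) q lv x))))))))"
proof -
  define y where "y = degens (ver C p) q lv x"
  have y: "y \<in> Y p n" using ver_degens_closed[OF v(1) x] v n by (simp add: y_def add.commute)
  have pq: "p + length lh = n" using h n by simp
  define y1 where "y1 = (vcyc C p n ^^ j) y"
  have y1: "y1 \<in> Y p n" using y by (simp add: y1_def)
  define y2 where "y2 = extra_degen (ver C p) n y1"
  have y2: "y2 \<in> Y p (Suc n)" using y1 by (simp add: y2_def)
  define y3 where "y3 = front_face (ver C p) (Suc n) s y2"
  have s: "s \<le> Suc n" using n by simp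
  note hom = ver_front_face_hom[OF s]
  have y3: "y3 \<in> Y p s" using lambda_hom_closed[OF hom, of y2 p] y2 by (simp add: y3_def hor_simps)
  have cl: "degens (hor C q') p lh z \<in> Y n q'" if "z \<in> Y p q'" for q' z
    using hor_degens_closed[OF h(1) that] pq by simp
  have 1: "(vcyc C n n ^^ j) (degens (hor C n) p lh y) = degens (hor C n) p lh y1"
    using H.lambda_hom_degens[OF vcyc_pow_hom h(1), of y n j] y pq by (simp add: hor_simps y1_def)
  have 2: "extra_degen (ver C n) n ((hcyc C n n ^^ j) (degens (hor C n) p lh y1))
    = (hcyc C n (Suc n) ^^ j) (degens (hor C (Suc n)) p lh y2)"
    using H.lambda_hom_degens[OF ver_extra_degen_hom h(1), of y1 n] y1 pq cl[OF y1]
      H.lambda_hom_cyc_pow[OF ver_extra_degen_hom, of "degens (hor C n) p lh y1" n n j]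
    by (simp add: hor_simps y2_def)
  have 3: "front_face (ver C r) (Suc n) s (back_face (hor C (Suc n)) (Suc n) s
      (extra_degen (hor C (Suc n)) n ((hcyc C n (Suc n) ^^ j) (degens (hor C (Suc n)) p lh y2))))
    = back_face (hor C s) (Suc n) s
      (extra_degen (hor C s) n ((hcyc C n s ^^ j) (degens (hor C s) p lh y3)))"
  proof -
    define z where "z = degens (hor C (Suc n)) p lh y2"
    have z: "z \<in> Y n (Suc n)" using cl[OF y2] by (simp add: z_def)
    have "degens (hor C s) p lh y3 = front_face (ver C n) (Suc n) s z"
      unfolding z_def y3_def using y2 H.lambda_hom_degens[OF hom h(1), of y2] pq
          by (simp add: hor_simps)
    moreover have "(hcyc C n s ^^ j) (front_face (ver C n) (Suc n) s z)
      = front_face (ver C n) (Suc n) s ((hcyc C n (Suc n) ^^ j) z)"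
      using H.lambda_hom_cyc_pow[OF hom, of z n j] z by (simp add: hor_simps)
    moreover have "extra_degen (hor C s) n (front_face (ver C n) (Suc n) s w)
      = front_face (ver C (Suc n)) (Suc n) s (extra_degen (hor C (Suc n)) n w)"
      if "w \<in> Y n (Suc n)" for w
      using H.lambda_hom_extra_degen[OF hom, of w n] that by (simp add: hor_simps)
    moreover have "back_face (hor C s) (Suc n) s (front_face (ver C (Suc n)) (Suc n) s w)
      = front_face (ver C r) (Suc n) s (back_face (hor C (Suc n)) (Suc n) s w)"
      if "w \<in> Y (Suc n) (Suc n)" for w
    proof -
      have r: "r = Suc n - s" using n by simp
      show ?thesis
        unfolding r using H.lambda_hom_faces_0[OF hom s, of w] that by (simp add: hor_simps)
    qed
    ultimately show ?thesis using z by (simp add: z_def)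
  qed
  show ?thesis
    unfolding y_def[symmetric] y1_def[symmetric] y2_def[symmetric] y3_def[symmetric] 3[symmetric]
      AW_comp_def n(2)
    using cl[OF y] cl[OF y1]
    by (simp add: diagonal_cyc_pow diagonal_extra_degen 1 2)
qed

end

section \<open>The total complex\<close>

lemma Tot_simps:
  "carrier (Tot C n) = (\<Pi>\<^sub>E p\<in>{..n}. carrier (bi_obj C p (n - p)))"
  "\<zero>\<^bsub>Tot C n\<^esub> = (\<lambda>p\<in>{..n}. \<zero>\<^bsub>bi_obj C p (n - p)\<^esub>)"
  "f \<oplus>\<^bsub>Tot C n\<^esub> g = (\<lambda>p\<in>{..n}. f p \<oplus>\<^bsub>bi_obj C p (n - p)\<^esub> g p)"
  "a \<odot>\<^bsub>Tot C n\<^esub> f = (\<lambda>p\<in>{..n}. a \<odot>\<^bsub>bi_obj C p (n - p)\<^esub> f p)"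
  by (simp_all add: Tot_def)

text \<open>The component of \<open>Tot_degenerate\<close> in a single bidegree.\<close>

definition bidegenerate ::
    "('k, 'r) ring_scheme \<Rightarrow> ('k, 'a) cyl_data \<Rightarrow> nat \<Rightarrow> nat \<Rightarrow> 'a set" where
  "bidegenerate R C p q = gen_submodule R (bi_obj C p q)
    ({hdegen C p' q i x | p' i x. p = Suc p' \<and> i \<le> p' \<and> x \<in> carrier (bi_obj C p' q)} \<union>
     {vdegen C p q' i x | q' i x. q = Suc q' \<and> i \<le> q' \<and> x \<in> carrier (bi_obj C p q')})"

context cylindrical_module
begin

interpretation B: module R "bi_obj C p q" for p q
  by (rule module_bi_obj)

lemma bidegenerate_generators:
  "{hdegen C p' q i x | p' i x. p = Suc p' \<and> i \<le> p' \<and> x \<in> Y p' q} \<union>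
    {vdegen C p q' i x | q' i x. q = Suc q' \<and> i \<le> q' \<and> x \<in> Y p q'} \<subseteq> Y p q"
  by auto

lemma submodule_bidegenerate: "submodule (bidegenerate R C p q) R (bi_obj C p q)"
  unfolding bidegenerate_def by (rule submodule_gen[OF module_bi_obj bidegenerate_generators])

abbreviation bicong :: "nat \<Rightarrow> nat \<Rightarrow> 'a \<Rightarrow> 'a \<Rightarrow> bool" where
  "bicong p q \<equiv> congruent_mod (bi_obj C p q) (bidegenerate R C p q)"

lemma hdegen_bidegenerate: "i \<le> p \<Longrightarrow> x \<in> Y p q \<Longrightarrow> hdegen C p q i x \<in> bidegenerate R C (Suc p) q"
  unfolding bidegenerate_def by (rule subsetD[OF gen_submodule_incl]) auto

lemma vdegen_bidegenerate: "i \<le> q \<Longrightarrow> x \<in> Y p q \<Longrightarrow> vdegen C p q i x \<in> bidegenerate R C p (Suc q)"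
  unfolding bidegenerate_def by (rule subsetD[OF gen_submodule_incl]) auto

lemma module_Tot: "module R (Tot C n)"
proof (rule moduleI)
  show "cring R" by (rule B.R.cring_axioms)
  show "abelian_group (Tot C n)"
  proof (rule abelian_groupI)
    fix f assume "f \<in> carrier (Tot C n)"
    then have "f p \<in> Y p (n - p)" if "p \<le> n" for p using that by (auto simp: Tot_simps)
    then show "\<exists>g\<in>carrier (Tot C n). g \<oplus>\<^bsub>Tot C n\<^esub> f = \<zero>\<^bsub>Tot C n\<^esub>"
      by (intro bexI[of _ "\<lambda>p\<in>{..n}. \<ominus>\<^bsub>bi_obj C p (n - p)\<^esub> f p"])
        (auto simp: Tot_simps B.M.l_neg intro!: restrict_ext)
  qed (auto simp: Tot_simps PiE_iff B.M.a_ac extensional_def fun_eq_iff)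
qed (auto simp: Tot_simps PiE_iff B.smult_l_distr B.smult_r_distr B.smult_assoc1
    extensional_def fun_eq_iff)

lemma Tot_component_linear:
  "p \<le> n \<Longrightarrow> linear_map R (Tot C n) (bi_obj C p (n - p)) (\<lambda>f. f p)"
  by (rule linear_mapI) (auto simp: Tot_simps)

lemma tot_incl_linear:
  "p \<le> n \<Longrightarrow> linear_map R (bi_obj C p (n - p)) (Tot C n) (tot_incl C n p)"
  by (rule linear_mapI) (auto simp: Tot_simps tot_incl_def fun_eq_iff split: if_splits)

lemma tot_incl_closed [simp]:
  "p \<le> n \<Longrightarrow> x \<in> Y p (n - p) \<Longrightarrow> tot_incl C n p x \<in> carrier (Tot C n)"
  using tot_incl_linear by (rule linear_map_closed)

lemma Tot_finsum_component:
  assumes "p \<le> n" "\<And>i. i \<in> A \<Longrightarrow> g i \<in> carrier (Tot C n)"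
  shows "finsum (Tot C n) g A p = finsum (bi_obj C p (n - p)) (\<lambda>i. g i p) A"
  using linear_map_finsum[OF module_Tot module_bi_obj Tot_component_linear] assms by blast

lemma submodule_Tot_degenerate: "submodule (Tot_degenerate R C n) R (Tot C n)"
proof -
  have "tot_incl C n (p + 1) (hdegen C p q i x) \<in> carrier (Tot C n)"
    if "p + 1 + q = n" "i \<le> p" "x \<in> Y p q" for p q i x
    using that tot_incl_closed[of "p + 1" n "hdegen C p q i x"] by auto
  moreover have "tot_incl C n p (vdegen C p q i x) \<in> carrier (Tot C n)"
    if "p + q + 1 = n" "i \<le> q" "x \<in> Y p q" for p q i x
  proof -
    have "n - p = Suc q" using that by auto
    then show ?thesis using that tot_incl_closed[of p n "vdegen C p q i x"] by simp
  qed
  ultimately show ?thesis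
    unfolding Tot_degenerate_def by (intro submodule_gen[OF module_Tot]) blast
qed

lemma tot_incl_bidegenerate:
  assumes "p \<le> n" "x \<in> bidegenerate R C p (n - p)"
  shows "tot_incl C n p x \<in> Tot_degenerate R C n"
proof -
  have h: "tot_incl C n p (hdegen C p' (n - p) i x) \<in> Tot_degenerate R C n"
    if "p = Suc p'" "i \<le> p'" "x \<in> Y p' (n - p)" for p' i x
    unfolding Tot_degenerate_def using assms(1) that
    by (intro subsetD[OF gen_submodule_incl] UnI1 CollectI exI[of _ p'] exI[of _ "n - p"]
        exI[of _ i] exI[of _ x]) simp
  have v: "tot_incl C n p (vdegen C p q' i x) \<in> Tot_degenerate R C n"
    if "n - p = Suc q'" "i \<le> q'" "x \<in> Y p q'" for q' i x
    unfolding Tot_degenerate_def using assms(1) that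
    by (intro subsetD[OF gen_submodule_incl] UnI2 CollectI exI[of _ p] exI[of _ q']
        exI[of _ i] exI[of _ x]) simp
  show ?thesis
    by (rule linear_map_gen_submodule[OF module_bi_obj module_Tot tot_incl_linear[OF assms(1)]
          submodule_Tot_degenerate bidegenerate_generators _ assms(2)[unfolded bidegenerate_def]])
      (use h v in blast)
qed

text \<open>An element of the total complex is the sum of the inclusions of its entries.\<close>

lemma Tot_degenerateI:
  assumes f: "f \<in> carrier (Tot C n)" and "\<And>p. p \<le> n \<Longrightarrow> f p \<in> bidegenerate R C p (n - p)"
  shows "f \<in> Tot_degenerate R C n"
proof -
  have fp: "f p \<in> Y p (n - p)" if "p \<le> n" for p
    using f that by (auto simp: Tot_simps)
  let ?g = "\<lambda>p. tot_incl C n p (f p)"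
  have g: "?g p \<in> carrier (Tot C n)" if "p \<in> {..n}" for p
    using fp that by simp
  interpret T: module R "Tot C n" by (rule module_Tot)
  have "f = finsum (Tot C n) ?g {..n}"
  proof (rule PiE_ext[of _ "{..n}" "\<lambda>p. Y p (n - p)"])
    show "f \<in> (\<Pi>\<^sub>E p\<in>{..n}. Y p (n - p))" using f by (simp add: Tot_simps)
    have "finsum (Tot C n) ?g {..n} \<in> carrier (Tot C n)" using g by (intro T.M.finsum_closed) auto
    then show "finsum (Tot C n) ?g {..n} \<in> (\<Pi>\<^sub>E p\<in>{..n}. Y p (n - p))" by (simp add: Tot_simps)
    fix p assume p: "p \<in> {..n}"
    have "finsum (Tot C n) ?g {..n} p = finsum (bi_obj C p (n - p)) (\<lambda>i. ?g i p) {..n}"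
      using p g by (intro Tot_finsum_component) auto
    also have "\<dots> = finsum (bi_obj C p (n - p)) (\<lambda>i. if p
        = i then f p else \<zero>\<^bsub>bi_obj C p (n - p)\<^esub>) {..n}"
      using p fp by (intro B.M.finsum_cong') (auto simp: tot_incl_def)
    also have "\<dots> = f p"
      using p fp by (intro B.M.finsum_singleton) auto
    finally show "f p = finsum (Tot C n) ?g {..n} p" by simp
  qed
  moreover have "finsum (Tot C n) ?g {..n} \<in> Tot_degenerate R C n"
    using assms(2)
    by (intro submodule_finsum[OF module_Tot submodule_Tot_degenerate] tot_incl_bidegenerate) auto
  ultimately show ?thesis by simp
qed

lemma congruent_mod_TotI:
  assumes "f \<in> carrier (Tot C n)" "g \<in> carrier (Tot C n)"
    and "\<And>p. p \<le> n \<Longrightarrow> bicong p (n - p) (f p) (g p)"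
  shows "congruent_mod (Tot C n) (Tot_degenerate R C n) f g"
proof -
  interpret T: module R "Tot C n" by (rule module_Tot)
  have "(f \<ominus>\<^bsub>Tot C n\<^esub> g) p = f p \<ominus>\<^bsub>bi_obj C p (n - p)\<^esub> g p" if "p \<le> n" for p
    using linear_map_diff[OF module_Tot module_bi_obj Tot_component_linear[OF that]] assms by simp
  then have "f \<ominus>\<^bsub>Tot C n\<^esub> g \<in> Tot_degenerate R C n"
    using assms by (intro Tot_degenerateI) (auto simp: congruent_mod_def)
  then show ?thesis using assms by (simp add: congruent_mod_def)
qed

section \<open>The Alexander-Whitney map\<close>

lemma AW_comp_linear:
  assumes "r + s = n"
  shows "linear_map R (bi_obj C n n) (bi_obj C r s) (AW_comp C r s)"
proof -
  have "linear_map R (bi_obj C n n) (bi_obj C r n) (back_face (hor C n) n s)"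
    using H.back_face_linear[of s n n] assms by (auto simp: hor_simps)
  moreover have "linear_map R (bi_obj C r n) (bi_obj C r s) (front_face (ver C r) n s)"
    using V.front_face_linear[of s n r] assms by (simp add: ver_simps)
  ultimately have "linear_map R (bi_obj C n n) (bi_obj C r s)
    (\<lambda>x. front_face (ver C r) n s (back_face (hor C n) n s x))"
    by (rule linear_map_comp)
  then show ?thesis
    unfolding AW_comp_def assms by (rule linear_map_scaled[OF module_bi_obj])
qed

lemma AW_linear: "linear_map R (bi_obj C n n) (Tot C n) (AW C n)"
proof -
  have lin: "linear_map R (bi_obj C n n) (bi_obj C p (n - p)) (AW_comp C p (n - p))"
      if "p \<le> n" for p
    using that by (intro AW_comp_linear) simp
  show ?thesis
    using linear_map_closed[OF lin] linear_map_add[OF lin] linear_map_smult[OF lin]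
    by (intro linear_mapI) (auto simp: Tot_simps AW_def fun_eq_iff)
qed

text \<open>The faces keep the horizontal edges after vertex \<open>s\<close> and the vertical edges before it, and
  every edge that the diagonal degeneracy collapses is of one of these two kinds.\<close>

lemma AW_comp_degen_diagonal:
  assumes "z \<in> Y m m" "i \<le> m" "r + s = Suc m"
  shows "AW_comp C r s (degen (diagonal C) m i z) \<in> bidegenerate R C r s"
proof -
  define w where "w = vdegen C m m i z"
  have w: "w \<in> Y m (Suc m)" using assms by (simp add: w_def)
  have s: "s \<le> Suc m" using assms by simp
  note hom = ver_front_face_hom[OF s]
  define y where "y = back_face (hor C (Suc m)) (Suc m) s (hdegen C m (Suc m) i w)"
  have y: "y = (if i < s then back_face (hor C (Suc m)) m (s - 1) w
      else hdegen C (m - s) (Suc m) (i - s) (back_face (hor C (Suc m)) m s w))"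
    using H.back_face_degen[of w "Suc m" m i s] assms w by (simp add: y_def hor_simps)
  have "front_face (ver C r) (Suc m) s y \<in> bidegenerate R C r s"
  proof (cases "i < s")
    case True
    then obtain s' where s': "s = Suc s'" by (cases s) auto
    have r: "r = m - s'" using assms s' by simp
    define u where "u = back_face (hor C m) m s' z"
    have u: "u \<in> Y r m"
      using linear_map_closed[OF H.back_face_linear[of s' m m], unfolded hor_simps, of z] assms s' r
      by (simp add: u_def)
    have "y = vdegen C r m i u"
      using y True s' r assms H.lambda_hom_faces_0[OF vdegen_hom[OF assms(2)], of s' m z]
      by (simp add: w_def u_def hor_simps)
    then have "front_face (ver C r) (Suc m) s y
      = vdegen C r s' i (front_face (ver C r) m s' u)"
      using V.front_face_degen[of u r m i s] u assms True s' by (simp add: ver_simps)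
    moreover have "front_face (ver C r) m s' u \<in> Y r s'"
      using linear_map_closed[OF V.front_face_linear[of s' m r], unfolded ver_simps, of u] u assms
          s' by simp
    ultimately show ?thesis using True s' by (simp add: vdegen_bidegenerate)
  next
    case False
    then have r: "r = Suc (m - s)" "s \<le> m" "i - s \<le> m - s" using assms by auto
    define u where "u = back_face (hor C (Suc m)) m s w"
    have u: "u \<in> Y (m - s) (Suc m)"
      using linear_map_closed[OF H.back_face_linear[of s m "Suc m"], unfolded hor_simps, of w] w r
      by (simp add: u_def)
    have "front_face (ver C r) (Suc m) s y
      = hdegen C (m - s) s (i - s) (front_face (ver C (m - s)) (Suc m) s u)"
      using lambda_hom_degen[OF hom, of u "m - s" "i - s"] u r False y
      by (simp add: hor_simps u_def)
    moreover have "front_face (ver C (m - s)) (Suc m) s u \<in> Y (m - s) s"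
      using lambda_hom_closed[OF hom, of u "m - s"] u by (simp add: hor_simps)
    ultimately show ?thesis using r by (simp add: hdegen_bidegenerate)
  qed
  then show ?thesis
    unfolding AW_comp_def assms(3) using assms(1,2)
    by (intro submodule_int_mult[OF module_bi_obj submodule_bidegenerate])
      (simp add: diagonal_simps y_def w_def)
qed

lemma AW_comp_degenerate:
  assumes "y \<in> degenerate R (diagonal C) n" "r + s = n"
  shows "AW_comp C r s y \<in> bidegenerate R C r s"
  using module_bi_obj module_bi_obj AW_comp_linear[OF assms(2)] submodule_bidegenerate _ _
    assms(1)[unfolded degenerate_def diagonal_simps]
proof (rule linear_map_gen_submodule, safe)
  fix i x assume "1 \<le> n" "i \<le> n - 1" "x \<in> Y (n - 1) (n - 1)"
  then obtain m where m: "n = Suc m" "i \<le> m" "x \<in> Y m m" by (cases n) auto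
  then show "hdegen C (n - 1) (n - 1 + 1) i (vdegen C (n - 1) (n - 1) i x) \<in> Y n n"
    by simp
  show "AW_comp C r s (hdegen C (n - 1) (n - 1 + 1) i (vdegen C (n - 1) (n - 1) i x))
      \<in> bidegenerate R C r s"
    using AW_comp_degen_diagonal[of x m i r s] m assms by (simp add: diagonal_simps)
qed

lemma AW_degenerate:
  assumes "y \<in> degenerate R (diagonal C) n"
  shows "AW C n y \<in> Tot_degenerate R C n"
proof (rule Tot_degenerateI)
  have "y \<in> Y n n"
    using submodule_carrier[OF D.module_obj D.submodule_degenerate assms]
        by (simp add: diagonal_simps)
  then show "AW C n y \<in> carrier (Tot C n)" by (rule linear_map_closed[OF AW_linear])
  show "AW C n y p \<in> bidegenerate R C p (n - p)" if "p \<le> n" for p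
    using AW_comp_degenerate[OF assms] that by (simp add: AW_def)
qed

section \<open>The shuffle map\<close>

lemma nabla_eq:
  "nabla C p q x = (\<Oplus>\<^bsub>bi_obj C (p + q) (p + q)\<^esub>\<eta>\<in>shuffle_perms p q.
    add_pow (bi_obj C (p + q) (p + q)) (sign \<eta>)
      (degens (hor C (p + q)) p (hor_list p q \<eta>) (degens (ver C p) q (ver_list p \<eta>) x)))"
  unfolding nabla_def hor_list_def ver_list_def ..

lemma shuffle_word_linear:
  assumes "\<eta> \<in> shuffle_perms p q"
  shows "linear_map R (bi_obj C p q) (bi_obj C (p + q) (p + q))
    (\<lambda>x. degens (hor C (p + q)) p (hor_list p q \<eta>) (degens (ver C p) q (ver_list p \<eta>) x))"
proof -
  have "linear_map R (bi_obj C p q) (bi_obj C p (p + q)) (degens (ver C p) q (ver_list p \<eta>))"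
    using V.degens_linear[OF admissible_ver_list[OF assms], of p]
        by (simp add: ver_simps add.commute)
  moreover have "linear_map R (bi_obj C p (p + q)) (bi_obj C (p + q) (p + q))
      (degens (hor C (p + q)) p (hor_list p q \<eta>))"
    using H.degens_linear[OF admissible_hor_list[OF assms], of "p + q"] by (simp add: hor_simps)
  ultimately show ?thesis by (rule linear_map_comp)
qed

lemma nabla_linear: "linear_map R (bi_obj C p q) (bi_obj C (p + q) (p + q)) (nabla C p q)"
  unfolding nabla_eq[abs_def]
  by (intro linear_map_sum linear_map_scaled module_bi_obj shuffle_word_linear)

lemma Sh_linear: "linear_map R (Tot C n) (bi_obj C n n) (Sh C n)"
  unfolding Sh_def[abs_def]
proof (rule linear_map_sum[OF module_bi_obj])
  fix p assume "p \<in> {..n}"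
  then show "linear_map R (Tot C n) (bi_obj C n n) (\<lambda>f. nabla C p (n - p) (f p))"
    using linear_map_comp[OF Tot_component_linear[of p n] nabla_linear[of p "n - p"]] by simp
qed

lemma degen_diagonal_degenerate:
  "k \<le> m \<Longrightarrow> z \<in> Y m m \<Longrightarrow> vdegen C (Suc m) m k (hdegen C m m k z) \<in> degenerate R (diagonal C) (Suc m)"
  using D.degen_in_degenerate[of k m z] hdegen_vdegen[of k m k m z] by (simp add: diagonal_simps)

lemma submodule_degenerate_diagonal: "submodule (degenerate R (diagonal C) n) R (bi_obj C n n)"
  using D.submodule_degenerate[of n] by (simp add: diagonal_simps)

text \<open>In each term, \<open>s\<^sub>i\<close> moves to an index \<open>k\<close> outside the horizontal word.  Then \<open>k\<close> belongs to
  the vertical word, so \<open>s\<^sub>k\<close> and \<open>\<sigma>\<^sub>k\<close> can both be moved to the outside, where they form a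
  diagonal degeneracy.\<close>

lemma nabla_hdegen:
  assumes x: "x \<in> Y p q" and i: "i \<le> p"
  shows "nabla C (Suc p) q (hdegen C p q i x) \<in> degenerate R (diagonal C) (Suc p + q)"
  unfolding nabla_eq
proof (intro submodule_finsum[OF module_bi_obj submodule_degenerate_diagonal]
    submodule_int_mult[OF module_bi_obj submodule_degenerate_diagonal])
  fix \<eta> assume \<eta>: "\<eta> \<in> shuffle_perms (Suc p) q"
  define lh where "lh = hor_list (Suc p) q \<eta>"
  define lv where "lv = ver_list (Suc p) \<eta>"
  define m where "m = p + q"
  have lh: "admissible (Suc p) lh" "length lh = q" and lv: "admissible q lv" "length lv = Suc p"
    using admissible_hor_list[OF \<eta>] admissible_ver_list[OF \<eta>] by (simp_all add: lh_def lv_def)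
  obtain k where k: "k \<le> m" "k \<notin> set lh"
    and push: "\<And>w. w \<in> Y p m \<Longrightarrow> \<exists>z\<in>Y m m. degens (hor C m) (Suc p) lh (hdegen C p m i w)
        = hdegen C m m k z"
    using H.degens_push[OF lh(1) i, of m] lh(2) by (auto simp: hor_simps m_def)
  have "k \<in> set lv"
    using k set_hor_list_eq[OF \<eta>] by (auto simp: lh_def lv_def m_def)
  then obtain w where w: "w \<in> Y p m" "degens (ver C p) q lv x = vdegen C p m k w"
    using V.degens_pull_out[OF lv(1), of k x p m] x lv(2) by (auto simp: ver_simps m_def)
  obtain z where z: "z \<in> Y m m" "degens (hor C m) (Suc p) lh (hdegen C p m i w) = hdegen C m m k z"
    using push[OF w(1)] by blast
  have lv': "q + length lv = Suc m" and lh': "Suc p + length lh = Suc m"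
    using lh lv by (simp_all add: m_def)
  have "degens (ver C (Suc p)) q lv (hdegen C p q i x) = hdegen C p (Suc m) i (vdegen C p m k w)"
    using lambda_hom_degen[OF ver_degens_hom[OF lv(1)], of x p i] x i w lv' by (simp add: hor_simps)
  also have "\<dots> = vdegen C (Suc p) m k (hdegen C p m i w)"
    using hdegen_vdegen[of i p k m w] w i k by simp
  also have "degens (hor C (Suc m)) (Suc p) lh \<dots> = vdegen C (Suc m) m k (degens (hor C m)
      (Suc p) lh (hdegen C p m i w))"
    using H.lambda_hom_degens[OF vdegen_hom[OF k(1)] lh(1), of "hdegen C p m i w"] w i lh'
        by (simp add: hor_simps)
  finally have word: "degens (hor C (Suc m)) (Suc p) lh (degens (ver C (Suc p)) q lv
      (hdegen C p q i x))
    = vdegen C (Suc m) m k (degens (hor C m) (Suc p) lh (hdegen C p m i w))" .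
  have "Suc p + q = Suc m" by (simp add: m_def)
  then show "degens (hor C (Suc p + q)) (Suc p) (hor_list (Suc p) q \<eta>)
      (degens (ver C (Suc p)) q (ver_list (Suc p) \<eta>) (hdegen C p q i x))
          \<in> degenerate R (diagonal C) (Suc p + q)"
    unfolding lh_def[symmetric] lv_def[symmetric]
    by (simp only: word z(2) degen_diagonal_degenerate[OF k(1) z(1)])
qed

text \<open>As before, with the roles of the two words exchanged.\<close>

lemma nabla_vdegen:
  assumes x: "x \<in> Y p q" and i: "i \<le> q"
  shows "nabla C p (Suc q) (vdegen C p q i x) \<in> degenerate R (diagonal C) (p + Suc q)"
  unfolding nabla_eq
proof (intro submodule_finsum[OF module_bi_obj submodule_degenerate_diagonal]
    submodule_int_mult[OF module_bi_obj submodule_degenerate_diagonal])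
  fix \<eta> assume \<eta>: "\<eta> \<in> shuffle_perms p (Suc q)"
  define lh where "lh = hor_list p (Suc q) \<eta>"
  define lv where "lv = ver_list p \<eta>"
  define m where "m = p + q"
  have lh: "admissible p lh" "length lh = Suc q" and lv: "admissible (Suc q) lv" "length lv = p"
    using admissible_hor_list[OF \<eta>] admissible_ver_list[OF \<eta>] by (simp_all add: lh_def lv_def)
  obtain k z where k: "k \<le> m" "k \<notin> set lv"
    and z: "z \<in> Y p m" "degens (ver C p) (Suc q) lv (vdegen C p q i x) = vdegen C p m k z"
    using V.degens_push[OF lv(1) i, of p] lv(2) x by (auto simp: ver_simps m_def add.commute)
  have "k \<in> set lh"
    using k set_hor_list_eq[OF \<eta>] by (auto simp: lh_def lv_def m_def)
  then obtain w where w: "w \<in> Y m m" "degens (hor C m) p lh z = hdegen C m m k w"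
    using H.degens_pull_out[OF lh(1), of k z m m] z(1) lh(2) by (auto simp: hor_simps m_def)
  have lh': "p + length lh = Suc m" using lh by (simp add: m_def)
  have "degens (hor C (Suc m)) p lh (vdegen C p m k z)
      = vdegen C (Suc m) m k (degens (hor C m) p lh z)"
    using H.lambda_hom_degens[OF vdegen_hom[OF k(1)] lh(1) , of z] z lh' by (simp add: hor_simps)
  then have word: "degens (hor C (Suc m)) p lh (degens (ver C p) (Suc q) lv (vdegen C p q i x))
    = vdegen C (Suc m) m k (hdegen C m m k w)" by (simp only: z(2) w(2))
  have "p + Suc q = Suc m" by (simp add: m_def)
  then show "degens (hor C (p + Suc q)) p (hor_list p (Suc q) \<eta>)
      (degens (ver C p) (Suc q) (ver_list p \<eta>) (vdegen C p q i x))
          \<in> degenerate R (diagonal C) (p + Suc q)"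
    unfolding lh_def[symmetric] lv_def[symmetric]
    by (simp only: word degen_diagonal_degenerate[OF k(1) w(1)])
qed

lemma Sh_tot_incl:
  assumes "p + q = n" "x \<in> Y p q" "nabla C p q x \<in> degenerate R (diagonal C) n"
  shows "Sh C n (tot_incl C n p x) \<in> degenerate R (diagonal C) n"
  unfolding Sh_def
proof (rule submodule_finsum[OF module_bi_obj submodule_degenerate_diagonal])
  fix r assume r: "r \<in> {..n}"
  have "nabla C r (n - r) \<zero>\<^bsub>bi_obj C r (n - r)\<^esub> = \<zero>\<^bsub>bi_obj C n n\<^esub>"
    using linear_map_zero[OF module_bi_obj module_bi_obj nabla_linear[of r "n - r"]] r by simp
  moreover have "n - p = q" using assms by auto
  ultimately show "nabla C r (n - r) (tot_incl C n p x r) \<in> degenerate R (diagonal C) n"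
    using assms r submodule_zero[OF submodule_degenerate_diagonal] by (auto simp: tot_incl_def)
qed

lemma Sh_degenerate:
  assumes "f \<in> Tot_degenerate R C n"
  shows "Sh C n f \<in> degenerate R (diagonal C) n"
proof (rule linear_map_gen_submodule[OF module_Tot module_bi_obj Sh_linear
      submodule_degenerate_diagonal _ _ assms[unfolded Tot_degenerate_def]], goal_cases)
  case 1
  have "Tot_degenerate R C n \<subseteq> carrier (Tot C n)"
    using submodule_carrier[OF module_Tot submodule_Tot_degenerate] by auto
  then show ?case
    unfolding Tot_degenerate_def using gen_submodule_incl by (rule order_trans[rotated])
next
  case (2 f)
  then show ?case
  proof safe
    fix p q i x assume "x \<in> Y p q" "i \<le> p"
    then show "Sh C (p + 1 + q) (tot_incl C (p + 1 + q) (p + 1) (hdegen C p q i x))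
      \<in> degenerate R (diagonal C) (p + 1 + q)"
      using nabla_hdegen[of x p q i] by (intro Sh_tot_incl[of _ q]) simp_all
  next
    fix p q i x assume "x \<in> Y p q" "i \<le> q"
    then show "Sh C (p + q + 1) (tot_incl C (p + q + 1) p (vdegen C p q i x))
      \<in> degenerate R (diagonal C) (p + q + 1)"
      using nabla_vdegen[of x p q i] by (intro Sh_tot_incl[of _ "Suc q"]) simp_all
  qed
qed

section \<open>The operator \<open>T\<^sup>v\<close>\<close>

lemma b_v_B_v:
  assumes "x \<in> Y p q"
  shows "b_v C p (Suc q) (B_v C p q x) = op_b (ver C p) (Suc q) (op_B (ver C p) q x)"
  using assms V.op_B_closed[of x p q] V.op_b_closed[of "op_B (ver C p) q x" p q]
    linear_map_int_mult[OF module_bi_obj module_bi_obj V.op_b_linear[unfolded ver_simps],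
      of "op_B (ver C p) q x" p q "(-1) ^ p"]
  by (simp add: b_v_def B_v_def ver_simps int_mult_mult int_mult_one B.M.abelian_group_axioms
      flip: power_mult_distrib)

lemma B_v_b_v:
  assumes "x \<in> Y p (Suc q)"
  shows "B_v C p q (b_v C p (Suc q) x) = op_B (ver C p) q (op_b (ver C p) (Suc q) x)"
  using assms V.op_b_closed[of x p q] V.op_B_closed[of "op_b (ver C p) (Suc q) x" p q]
    linear_map_int_mult[OF module_bi_obj module_bi_obj V.op_B_linear[unfolded ver_simps],
      of "op_b (ver C p) (Suc q) x" p q "(-1) ^ p"]
  by (simp add: b_v_def B_v_def ver_simps int_mult_mult int_mult_one B.M.abelian_group_axioms
      flip: power_mult_distrib)

text \<open>The signs of \<open>b\<^sup>v\<close> and \<open>B\<^sup>v\<close> cancel in their composites, so this is the formula for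
  \<open>b B + B b\<close>.\<close>

lemma T_v_eq_vcyc_pow:
  assumes "x \<in> Y p q"
  shows "T_v C p q x = (vcyc C p q ^^ Suc q) x"
proof (cases q)
  case 0
  have "op_b (ver C p) (Suc 0) (op_B (ver C p) 0 x) \<in> Y p 0"
    using V.op_b_closed[of "op_B (ver C p) 0 x" p 0] V.op_B_closed[of x p 0] assms 0
        by (simp add: ver_simps)
  moreover have "op_b (ver C p) (Suc 0) (op_B (ver C p) 0 x) \<oplus>\<^bsub>bi_obj C p 0\<^esub> \<zero>\<^bsub>bi_obj C p 0\<^esub>
    = x \<ominus>\<^bsub>bi_obj C p 0\<^esub> (vcyc C p 0 ^^ Suc 0) x"
    using V.bB_plus_Bb_0[of x p] assms 0 by (simp add: ver_simps)
  ultimately show ?thesis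
    using assms 0 b_v_B_v[of x p 0] vcyc_pow_closed[of x p 0 "Suc 0"]
    by (simp add: T_v_def del: funpow.simps) (intro abelian_group_diff_diff, auto simp:
        B.M.abelian_group_axioms)
next
  case (Suc q')
  have bB: "op_b (ver C p) (Suc q) (op_B (ver C p) q x) \<in> Y p q"
    using V.op_b_closed[of "op_B (ver C p) q x" p q] V.op_B_closed[of x p q] assms
        by (simp add: ver_simps)
  have Bb: "op_B (ver C p) q' (op_b (ver C p) q x) \<in> Y p q"
    using V.op_B_closed[of "op_b (ver C p) q x" p q'] V.op_b_closed[of x p q'] assms Suc
        by (simp add: ver_simps)
  have sum: "op_b (ver C p) (Suc q) (op_B (ver C p) q x) \<oplus>\<^bsub>bi_obj C p q\<^esub> op_B (ver C p) q' (op_b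
      (ver C p) q x)
    = x \<ominus>\<^bsub>bi_obj C p q\<^esub> (vcyc C p q ^^ Suc q) x"
    using V.bB_plus_Bb_Suc[of x p q'] assms Suc by (simp add: ver_simps del: funpow.simps)
  have "T_v C p q x = x \<ominus>\<^bsub>bi_obj C p q\<^esub> op_b (ver C p) (Suc q) (op_B (ver C p) q x)
      \<ominus>\<^bsub>bi_obj C p q\<^esub> op_B (ver C p) q' (op_b (ver C p) q x)"
    using assms Suc b_v_B_v[of x p q] B_v_b_v[of x p q'] by (simp add: T_v_def)
  also have "\<dots> = (vcyc C p q ^^ Suc q) x"
    by (rule abelian_group_diff_diff[OF B.M.abelian_group_axioms assms bB Bb vcyc_pow_closed[OF
        assms] sum])
  finally show ?thesis .
qed

section \<open>The composite of the three maps\<close>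

text \<open>The contribution of one power of the cyclic operator and one shuffle, without the signs
  that these two carry.\<close>

definition AW_word ::
    "nat \<Rightarrow> nat \<Rightarrow> nat \<Rightarrow> nat \<Rightarrow> nat \<Rightarrow> (nat \<Rightarrow> nat) \<Rightarrow> 'a \<Rightarrow> 'a" where
  "AW_word r s p q j \<eta> x = AW_comp C r s (extra_degen (diagonal C) (p + q) ((cyc (diagonal C)
      (p + q) ^^ j)
      (degens (hor C (p + q)) p (hor_list p q \<eta>) (degens (ver C p) q (ver_list p \<eta>) x))))"

abbreviation shuffle_sum :: "nat \<Rightarrow> nat \<Rightarrow> nat \<Rightarrow> nat \<Rightarrow> nat \<Rightarrow> 'a \<Rightarrow> 'a" where
  "shuffle_sum r s p q j x \<equiv> (\<Oplus>\<^bsub>bi_obj C r s\<^esub>\<eta>\<in>shuffle_perms p q.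
    add_pow (bi_obj C r s) (sign \<eta>) (AW_word r s p q j \<eta> x))"

text \<open>If the vertical word is degenerate, its outer degeneracy commutes with the horizontal
  word.\<close>

lemma AW_word_degenerate:
  assumes \<eta>: "\<eta> \<in> shuffle_perms p q" and x: "x \<in> Y p q" and j: "j \<le> p + q"
    and rs: "r + s = Suc (p + q)" and not_survives: "\<not> survives p q s j \<eta>"
  shows "AW_word r s p q j \<eta> x \<in> bidegenerate R C r s"
proof -
  define n where "n = p + q"
  define lh where "lh = hor_list p q \<eta>"
  define lv where "lv = ver_list p \<eta>"
  have lh: "admissible p lh" "length lh = q" and lv: "admissible q lv" "length lv = p"
    using admissible_hor_list[OF \<eta>] admissible_ver_list[OF \<eta>] by (simp_all add: lh_def lv_def)
  have len: "p + length lh = n" "q + length lv = n" using lh lv by (simp_all add: n_def)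
  have n: "r + s = Suc n" "j \<le> n" "s \<le> Suc n" "s \<le> n + 1" using rs j by (simp_all add: n_def)
  define v where "v = front_face (ver C p) (Suc n) s
      (extra_degen (ver C p) n ((vcyc C p n ^^ j) (degens (ver C p) q lv x)))"
  \<comment> \<open>The horizontal word in row \<open>s\<close>; the number of its faces is fixed by \<open>r\<close>, so that a vertical
    degeneracy, which changes the row, commutes with it.\<close>
  define h where "h s z = back_face (hor C s) (Suc n) (Suc n - r) (extra_degen (hor C s) n
      ((hcyc C n s ^^ j) (degens (hor C s) p lh z)))" for s z
  have "s = Suc n - r" using n by simp
  then have word: "AW_word r s p q j \<eta> x = add_pow (bi_obj C r s) ((-1::int) ^ (r * s)) (h s v)"
    unfolding AW_word_def h_def v_def lh_def lv_def n_def using \<eta> x rs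
    by (subst AW_comp_word) (auto simp: admissible_hor_list admissible_ver_list)
  have cl: "degens (hor C s') p lh z \<in> Y n s'" if "z \<in> Y p s'" for s' z
    using hor_degens_closed[OF lh(1) that] len by simp
  have h_closed: "h s' z \<in> Y r s'" if "z \<in> Y p s'" for s' z
  proof -
    have "Suc n - (Suc n - r) = r" "Suc n - r \<le> Suc n" using n by auto
    then show ?thesis
      unfolding h_def using cl[OF that]
        linear_map_closed[OF H.back_face_linear[of "Suc n - r" "Suc n" s', unfolded hor_simps],
          of "extra_degen (hor C s') n ((hcyc C n s' ^^ j) (degens (hor C s') p lh z))"]
      by simp
  qed
  have "h s v \<in> bidegenerate R C r s"
  proof (cases "\<exists>i\<in>set lv. (i + j + 1) mod (n + 1) < s")
    case True
    then obtain i where i: "i \<in> set lv" "(i + j + 1) mod (n + 1) < s" by blast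
    obtain y i' where y: "y \<in> Y p (s - 1)" "i' \<le> s - 1" "1 \<le> s" "v = vdegen C p (s - 1) i' y"
      using V.front_face_word_degenerate[OF lv(1) len(2), of x p j s i] x n i
      unfolding v_def ver_simps by blast
    obtain s' where s': "s = Suc s'" using y by (cases s) auto
    have i': "i' \<le> s'" and y': "y \<in> Y p s'" using y s' by simp_all
    note hom = vdegen_hom[OF i']
    define w where "w = degens (hor C s') p lh y"
    have w: "w \<in> Y n s'" using cl[OF y'] by (simp add: w_def)
    define u where "u = extra_degen (hor C s') n ((hcyc C n s' ^^ j) w)"
    have u: "u \<in> Y (Suc n) s'" using w by (simp add: u_def)
    have "degens (hor C s) p lh v = vdegen C n s' i' w"
      using H.lambda_hom_degens[OF hom lh(1), of y] y y' s' len by (simp add: hor_simps w_def)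
    moreover have "(hcyc C n s ^^ j) (vdegen C n s' i' w) = vdegen C n s' i' ((hcyc C n s' ^^ j) w)"
      using H.lambda_hom_cyc_pow[OF hom, of w n j] w s' by (simp add: hor_simps)
    moreover have "extra_degen (hor C s) n (vdegen C n s' i' ((hcyc C n s' ^^ j) w))
        = vdegen C (Suc n) s' i' u"
      using H.lambda_hom_extra_degen[OF hom, of "(hcyc C n s' ^^ j) w" n] w s'
          by (simp add: hor_simps u_def)
    moreover have "back_face (hor C s) (Suc n) (Suc n - r) (vdegen C (Suc n) s' i' u)
      = vdegen C r s' i' (back_face (hor C s') (Suc n) (Suc n - r) u)"
    proof -
      have "Suc n - (Suc n - r) = r" "Suc n - r \<le> Suc n" using n by auto
      then show ?thesis
        using H.lambda_hom_faces_0[OF hom, of "Suc n - r" "Suc n" u] u s' by (simp add: hor_simps)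
    qed
    ultimately have "h s v = vdegen C r s' i' (h s' y)"
      by (simp add: h_def u_def w_def)
    then show ?thesis
      using vdegen_bidegenerate[OF i' h_closed[OF y']] s' by simp
  next
    case False
    then obtain i where i: "i \<in> set lh" "s \<le> (i + j + 1) mod (n + 1)"
      using not_survives by (auto simp: survives_def lh_def lv_def n_def not_less)
    have v: "v \<in> Y p s"
      unfolding v_def
      using V.extra_degen_closed[OF V.cpow_closed[OF V.degens_closed[OF lv(1), of x p]], of j]
        x n len lambda_hom_closed[OF ver_front_face_hom[OF n(3)],
          of "extra_degen (ver C p) n ((vcyc C p n ^^ j) (degens (ver C p) q lv x))" p]
      by (simp add: hor_simps ver_simps)
    obtain y i' where y: "y \<in> Y (n - s) s" "i' \<le> n - s" "s \<le> n"
      "back_face (hor C s) (Suc n) s (extra_degen (hor C s) n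
        ((hcyc C n s ^^ j) (degens (hor C s) p lh v))) = hdegen C (n - s) s i' y"
      using H.back_face_word_degenerate[OF lh(1) len(1), of v s j s i] v n i
      unfolding hor_simps by blast
    have "Suc n - r = s" "r = Suc (n - s)" using n y by auto
    then show ?thesis
      using y hdegen_bidegenerate[OF y(2,1)] by (simp add: h_def)
  qed
  then show ?thesis
    unfolding word by (rule submodule_int_mult[OF module_bi_obj submodule_bidegenerate])
qed

lemma AW_word_survives:
  assumes \<eta>: "\<eta> \<in> shuffle_perms p q" and x: "x \<in> Y p q" and j: "j \<le> p + q"
    and rs: "r + s = Suc (p + q)" and survives: "survives p q s j \<eta>"
  shows "q \<le> s" and "s \<le> q + 1"
    and "AW_word r s p q j \<eta> x = add_pow (bi_obj C r s) ((-1::int) ^ (r * s))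
      (back_face (hor C s) (Suc p) (s - q) (extra_degen (hor C s) p
        ((hcyc C p s ^^ (j - card {i \<in> set (hor_list p q \<eta>). p + q \<le> i + j}))
          (front_face (ver C p) (Suc q) s (extra_degen (ver C p) q
            ((vcyc C p q ^^ (j - card {i \<in> set (ver_list p \<eta>). p + q \<le> i + j})) x))))))" (is ?value)
proof -
  define n where "n = p + q"
  define lh where "lh = hor_list p q \<eta>"
  define lv where "lv = ver_list p \<eta>"
  have lh: "admissible p lh" "length lh = q" and lv: "admissible q lv" "length lv = p"
    using admissible_hor_list[OF \<eta>] admissible_ver_list[OF \<eta>] by (simp_all add: lh_def lv_def)
  have len: "p + length lh = n" "q + length lv = n" using lh lv by (simp_all add: n_def)
  have n: "r + s = Suc n" "j \<le> n" "s \<le> Suc n" "s \<le> n + 1" using rs j by (simp_all add: n_def)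
  define v where "v = front_face (ver C p) (Suc n) s
      (extra_degen (ver C p) n ((vcyc C p n ^^ j) (degens (ver C p) q lv x)))"
  have v: "v \<in> Y p s"
    unfolding v_def
    using V.extra_degen_closed[OF V.cpow_closed[OF V.degens_closed[OF lv(1), of x p]], of j]
      x n len lambda_hom_closed[OF ver_front_face_hom[OF n(3)],
        of "extra_degen (ver C p) n ((vcyc C p n ^^ j) (degens (ver C p) q lv x))" p]
    by (simp add: hor_simps ver_simps)
  have s: "\<And>i. i \<in> set lh \<Longrightarrow> (i + j + 1) mod (n + 1) < s" "\<And>i. i
      \<in> set lv \<Longrightarrow> s \<le> (i + j + 1) mod (n + 1)"
    using survives by (simp_all add: survives_def lh_def lv_def n_def)
  note hv = H.back_face_word[OF lh(1) len(1) _ n(2) n(4) s(1), unfolded hor_simps, OF v]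
  note vv = V.front_face_word[OF lv(1) len(2) _ n(2) n(4) s(2), unfolded ver_simps, OF x]
  show "q \<le> s" using conjunct1[OF hv] lh by simp
  show "s \<le> q + 1" using conjunct1[OF vv] by simp
  have "AW_word r s p q j \<eta> x = add_pow (bi_obj C r s) ((-1::int) ^ (r * s))
    (back_face (hor C s) (Suc n) s (extra_degen (hor C s) n
      ((hcyc C n s ^^ j) (degens (hor C s) p lh v))))"
    unfolding AW_word_def v_def lh_def lv_def n_def using \<eta> x rs
    by (subst AW_comp_word) (auto simp: admissible_hor_list admissible_ver_list)
  also have "back_face (hor C s) (Suc n) s (extra_degen (hor C s) n
      ((hcyc C n s ^^ j) (degens (hor C s) p lh v)))
    = back_face (hor C s) (Suc p) (s - q) (extra_degen (hor C s) p
        ((hcyc C p s ^^ (j - card {i \<in> set lh. n \<le> i + j})) v))"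
    using conjunct2[OF hv] lh by simp
  also have "v = front_face (ver C p) (Suc q) s (extra_degen (ver C p) q
            ((vcyc C p q ^^ (j - card {i \<in> set lv. n \<le> i + j})) x))"
    unfolding v_def by (rule conjunct2[OF vv])
  finally show ?value by (simp only: lh_def lv_def n_def)
qed

lemma AW_word_closed:
  assumes \<eta>: "\<eta> \<in> shuffle_perms p q" and x: "x \<in> Y p q" and rs: "r + s = Suc (p + q)"
  shows "AW_word r s p q j \<eta> x \<in> Y r s"
  using linear_map_closed[OF shuffle_word_linear[OF \<eta>] x]
    D.extra_degen_closed[OF D.cpow_closed[where j = j]]
    linear_map_closed[OF AW_comp_linear[OF rs]]
  by (simp add: AW_word_def diagonal_simps)

text \<open>No vertical index wraps around, and \<open>j\<close> horizontal indices do; so the horizontal word has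
  lost all its cyclic operators, and the face that remains in it cancels the extra degeneracy.\<close>

lemma AW_word_vertical:
  assumes x: "x \<in> Y p q" and j: "j \<le> q"
  shows "AW_word p (Suc q) p q j (block_swap 0 p (q - j)) x
    = add_pow (bi_obj C p (Suc q)) ((-1::int) ^ (p * Suc q)) (extra_degen (ver C p) q
        ((vcyc C p q ^^ j) x))"
proof -
  let ?\<eta> = "block_swap 0 p (q - j)"
  note \<eta> = block_swap_first_shuffle[of "q - j" q p, OF diff_le_self]
  have j': "j \<le> p + q" using j by simp
  have surv: "survives p q (Suc q) j ?\<eta>"
    using survives_Suc_iff[OF \<eta>(1) j'] j by simp
  have "{i \<in> set (hor_list p q ?\<eta>). p + q \<le> i + j} = {p + q - j..<p + q}"
    using survives_hor_list[OF \<eta>(1) surv j'] j by auto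
  then have 1: "j - card {i \<in> set (hor_list p q ?\<eta>). p + q \<le> i + j} = 0" using j' by simp
  have "{i \<in> set (ver_list p ?\<eta>). p + q \<le> i + j} = {}"
    unfolding \<eta>(2) using j by auto
  then have 2: "j - card {i \<in> set (ver_list p ?\<eta>). p + q \<le> i + j} = j"
    by (simp only: card.empty diff_zero)
  have "Suc q - q = 1" by simp
  then show ?thesis
    using AW_word_survives(3)[OF \<eta>(1) x j' _ surv, of p] x
      H.face_0_extra_degen[of "extra_degen (ver C p) q ((vcyc C p q ^^ j) x)" "Suc q" p]
    unfolding 1 2 by (simp add: hor_simps)
qed

text \<open>All \<open>q\<close> horizontal indices wrap around, and \<open>a\<close> vertical ones.  The vertical word keeps
  \<open>\<tau>\<^sup>q\<close> and one face, and \<open>\<delta>\<^sub>q\<^sub>+\<^sub>1 e = \<tau>\<close> supplies the remaining factor.\<close>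

lemma AW_word_horizontal:
  assumes x: "x \<in> Y p q" and a: "a \<le> p"
  shows "AW_word (Suc p) q p q (q + a) (block_swap (p - a) a q) x
    = add_pow (bi_obj C (Suc p) q) ((-1::int) ^ (Suc p * q))
        (extra_degen (hor C q) p ((hcyc C p q ^^ a) ((vcyc C p q ^^ Suc q) x)))"
proof -
  let ?\<eta> = "block_swap (p - a) a q"
  note \<eta> = block_swap_last_shuffle[OF a, of q]
  have j: "q + a \<le> p + q" using a by simp
  have surv: "survives p q q (q + a) ?\<eta>"
    using survives_same_iff[OF \<eta>(1) j] a by simp
  have "{i \<in> set (hor_list p q ?\<eta>). p + q \<le> i + (q + a)} = {p - a..<p + q - a}"
    unfolding \<eta>(2) using a by auto
  moreover have "card {p - a..<p + q - a} = q" using a by simp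
  ultimately have 1: "q + a - card {i \<in> set (hor_list p q ?\<eta>). p + q \<le> i + (q + a)} = a" by simp
  have ver: "set (ver_list p ?\<eta>) = {..<p + q} - {p - a..<p + q - a}"
    using set_hor_list_eq[OF \<eta>(1)] set_ver_list_subset[OF \<eta>(1)] \<eta>(2) by auto
  have "{i \<in> set (ver_list p ?\<eta>). p + q \<le> i + (q + a)} = {p + q - a..<p + q}"
    unfolding ver using a by auto
  moreover have "card {p + q - a..<p + q} = a" using a by simp
  ultimately have 2: "q + a - card {i \<in> set (ver_list p ?\<eta>). p + q \<le> i + (q + a)} = q" by simp
  show ?thesis
    using AW_word_survives(3)[OF \<eta>(1) x j _ surv, of "Suc p"] x
      V.face_last_extra_degen[of "(vcyc C p q ^^ q) x" p q]
    unfolding 1 2 by (simp add: ver_simps)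
qed

lemma op_B_diagonal_nabla:
  assumes x: "x \<in> Y p q" and rs: "r + s = Suc (p + q)"
  shows "bicong r s
    (AW_comp C r s (op_B (diagonal C) (p + q) (nabla C p q x)))
    (\<Oplus>\<^bsub>bi_obj C r s\<^esub>j\<in>{..p + q}. add_pow (bi_obj C r s) ((-1::int) ^ ((p + q) * j))
      (shuffle_sum r s p q j x))"
proof -
  let ?N = "bi_obj C r s"
  define n where "n = p + q"
  define D where "D = diagonal C"
  define y where "y = nabla C p q x"
  have y: "y \<in> carrier (obj D n)"
    using linear_map_closed[OF nabla_linear x] by (simp add: y_def D_def n_def diagonal_simps)
  have obj: "obj D m = bi_obj C m m" for m by (simp add: D_def diagonal_simps)
  have rs': "r + s = Suc n" using rs by (simp add: n_def)
  have mod: "module R (obj D m)" for m by (simp add: obj module_bi_obj)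
  have A: "linear_map R (obj D (Suc n)) ?N (AW_comp C r s)"
    using AW_comp_linear[OF rs'] by (simp add: obj)
  define z where "z = add_pow (obj D n) ((-1::int) ^ Suc n) (cyc D n (op_N D n y))"
  have z: "z \<in> Y n n"
    using D.op_N_closed[of y n] D.cyc_closed[of "op_N D n y" n] y unfolding z_def obj
    by (intro int_mult_closed) (auto simp: B.M.abelian_group_axioms D_def diagonal_simps)
  have EN: "extra_degen D n (op_N D n y) \<in> carrier (obj D (Suc n))"
    using D.extra_degen_closed[OF D.op_N_closed] y by (simp add: D_def)
  have dz: "degen D n 0 z \<in> carrier (obj D (Suc n))"
    using D.degen_closed[of 0 n z] z by (simp add: D_def diagonal_simps)
  have "AW_comp C r s (op_B D n y)
    = AW_comp C r s (extra_degen D n (op_N D n y)) \<ominus>\<^bsub>?N\<^esub> AW_comp C r s (degen D n 0 z)"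
    using D.op_B_eq_extra_degen[of y n] y linear_map_diff[OF mod module_bi_obj A EN dz]
    by (simp add: D_def z_def)
  moreover have "bicong r s \<dots> (AW_comp C r s (extra_degen D n (op_N D n y)))"
    using AW_comp_degen_diagonal[OF z _ rs', of 0] linear_map_closed[OF A EN]
    by (intro congruent_mod_minus[OF module_bi_obj submodule_bidegenerate]) (simp_all add: D_def)
  moreover have "AW_comp C r s (extra_degen D n (op_N D n y))
    = (\<Oplus>\<^bsub>?N\<^esub>j\<in>{..n}. add_pow ?N ((-1::int) ^ (n * j))
        (shuffle_sum r s p q j x))"
  proof -
    have L: "linear_map R (bi_obj C n n) ?N (\<lambda>y. AW_comp C r s (extra_degen D n
        ((cyc D n ^^ j) y)))" for j
      using linear_map_comp[OF linear_map_comp[OF D.cpow_linear D.extra_degen_linear] A[unfolded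
          D_def]]
      by (simp add: D_def diagonal_simps)
    have ej: "extra_degen D n ((cyc D n ^^ j) y) \<in> carrier (obj D (Suc n))" for j
      using D.extra_degen_closed[OF D.cpow_closed] y by (simp add: D_def)
    have "AW_comp C r s (extra_degen D n (op_N D n y))
      = AW_comp C r s (\<Oplus>\<^bsub>obj D (Suc n)\<^esub>j\<in>{..n}. add_pow (obj D (Suc n)) ((-1::int) ^ (n * j))
          (extra_degen D n ((cyc D n ^^ j) y)))"
      using D.extra_degen_op_N[of y n] y by (simp add: D_def)
    also have "\<dots> = (\<Oplus>\<^bsub>?N\<^esub>j\<in>{..n}. AW_comp C r s (add_pow (obj D (Suc n)) ((-1::int) ^ (n * j))
        (extra_degen D n ((cyc D n ^^ j) y))))"
      using ej by (intro linear_map_finsum[OF mod module_bi_obj A] int_mult_closed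
          module_abelian_group[OF mod])
    also have "\<dots> = (\<Oplus>\<^bsub>?N\<^esub>j\<in>{..n}. add_pow ?N ((-1::int) ^ (n * j))
        (shuffle_sum r s p q j x))"
    proof (rule B.M.finsum_cong')
      have W: "(shuffle_sum r s p q j x) \<in> Y r s" for j
        using AW_word_closed[OF _ x rs]
            by (intro B.M.finsum_closed) (auto intro!: int_mult_closed simp:
            B.M.abelian_group_axioms)
      then show "(\<lambda>j. add_pow ?N ((-1::int) ^ (n * j))
          (shuffle_sum r s p q j x)) \<in> {..n} \<rightarrow> Y r s"
        by (auto intro!: int_mult_closed simp: B.M.abelian_group_axioms)
      fix j
      have t: "degens (hor C n) p (hor_list p q \<eta>) (degens (ver C p) q (ver_list p \<eta>) x) \<in> Y n n"
        if "\<eta> \<in> shuffle_perms p q" for \<eta>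
        using linear_map_closed[OF shuffle_word_linear[OF that] x] by (simp add: n_def)
      have "AW_comp C r s (add_pow (obj D (Suc n)) ((-1::int) ^ (n * j)) (extra_degen D n
          ((cyc D n ^^ j) y)))
        = add_pow ?N ((-1::int) ^ (n * j)) (AW_comp C r s (extra_degen D n ((cyc D n ^^ j) y)))"
        by (rule linear_map_int_mult[OF mod module_bi_obj A ej])
      also have "AW_comp C r s (extra_degen D n ((cyc D n ^^ j) y))
        = (\<Oplus>\<^bsub>?N\<^esub>\<eta>\<in>shuffle_perms p q. AW_comp C r s (extra_degen D n ((cyc D n ^^ j)
            (add_pow (bi_obj C n n) (sign \<eta>) (degens (hor C n) p (hor_list p q \<eta>) (degens
              (ver C p) q (ver_list p \<eta>) x))))))"
        unfolding y_def nabla_eq n_def[symmetric] using t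
        by (intro linear_map_finsum[OF module_bi_obj module_bi_obj L] int_mult_closed
            B.M.abelian_group_axioms)
      also have "\<dots> = (shuffle_sum r s p q j x)"
        using t linear_map_int_mult[OF module_bi_obj module_bi_obj L] AW_word_closed[OF _ x rs]
        by (intro B.M.finsum_cong')
          (auto simp: AW_word_def D_def n_def intro!: int_mult_closed B.M.abelian_group_axioms)
      finally show "AW_comp C r s (add_pow (obj D (Suc n)) ((-1::int) ^ (n * j)) (extra_degen D n
          ((cyc D n ^^ j) y)))
        = add_pow ?N ((-1::int) ^ (n * j))
          (shuffle_sum r s p q j x)" .
    qed simp
    finally show ?thesis .
  qed
  ultimately show ?thesis by (simp add: D_def y_def n_def)
qed

lemma AW_words_degenerate:
  assumes x: "x \<in> Y p q" and j: "j \<le> p + q" and rs: "r + s = Suc (p + q)"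
    and "\<And>\<eta>. \<eta> \<in> shuffle_perms p q \<Longrightarrow> \<not> survives p q s j \<eta>"
  shows "(shuffle_sum r s p q j x)
    \<in> bidegenerate R C r s"
  using assms
  by (intro submodule_finsum[OF module_bi_obj submodule_bidegenerate]
      submodule_int_mult[OF module_bi_obj submodule_bidegenerate] AW_word_degenerate)

lemma AW_words_single:
  assumes x: "x \<in> Y p q" and j: "j \<le> p + q" and rs: "r + s = Suc (p + q)"
    and \<theta>: "\<theta> \<in> shuffle_perms p q"
    and "\<And>\<eta>. \<eta> \<in> shuffle_perms p q \<Longrightarrow> survives p q s j \<eta> \<Longrightarrow> \<eta> = \<theta>"
  shows "bicong r s
    (shuffle_sum r s p q j x)
    (add_pow (bi_obj C r s) (sign \<theta>) (AW_word r s p q j \<theta> x))"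
proof -
  let ?f = "\<lambda>\<eta>. add_pow (bi_obj C r s) (sign \<eta>) (AW_word r s p q j \<eta> x)"
  have cl: "?f \<theta> \<in> Y r s"
    using AW_word_closed[OF \<theta> x rs] by (simp add: int_mult_closed B.M.abelian_group_axioms)
  have "bicong r s
    (finsum (bi_obj C r s) ?f (shuffle_perms p q)) (finsum (bi_obj C r s) ?f {\<theta>})"
  proof (rule congruent_mod_finsum_support[OF module_bi_obj submodule_bidegenerate
      finite_shuffle_perms])
    show "{\<theta>} \<subseteq> shuffle_perms p q" using \<theta> by simp
    show "bicong r s (?f \<eta>) (?f \<eta>)" if "\<eta> \<in> {\<theta>}" for \<eta>
      using that cl congruent_mod_refl[OF module_bi_obj submodule_bidegenerate] by simp
    fix \<eta> assume "\<eta> \<in> shuffle_perms p q - {\<theta>}"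
    then have \<eta>: "\<eta> \<in> shuffle_perms p q" and "\<not> survives p q s j \<eta>" using assms(5) by auto
    then show "?f \<eta> \<in> bidegenerate R C r s"
      by (intro submodule_int_mult[OF module_bi_obj submodule_bidegenerate] AW_word_degenerate x j
          rs)
  qed
  then show ?thesis using cl by simp
qed

lemma B_v_closed [simp]: "x \<in> Y p q \<Longrightarrow> B_v C p q x \<in> Y p (Suc q)"
  using V.op_B_closed[of x p q]
      by (simp add: B_v_def ver_simps int_mult_closed B.M.abelian_group_axioms)

lemma B_h_closed [simp]: "x \<in> Y p q \<Longrightarrow> B_h C p q x \<in> Y (Suc p) q"
  using H.op_B_closed[of x q p] by (simp add: B_h_def hor_simps)

lemma T_v_closed [simp]: "x \<in> Y p q \<Longrightarrow> T_v C p q x \<in> Y p q"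
  by (simp only: T_v_eq_vcyc_pow vcyc_pow_closed)

lemma B_v_congruent:
  assumes x: "x \<in> Y p q"
  shows "bicong p (Suc q) (B_v C p q x)
    (\<Oplus>\<^bsub>bi_obj C p (Suc q)\<^esub>j\<in>{..q}. add_pow (bi_obj C p (Suc q)) ((-1::int) ^ p * (-1) ^ (q * j))
      (extra_degen (ver C p) q ((vcyc C p q ^^ j) x)))"
proof -
  let ?M = "bi_obj C p (Suc q)"
  define z where "z = add_pow (bi_obj C p q) ((-1::int) ^ Suc q) (vcyc C p q (op_N (ver C p) q x))"
  have N: "op_N (ver C p) q x \<in> Y p q"
    using V.op_N_closed[of x p q] x by (simp add: ver_simps)
  have z: "z \<in> Y p q"
    using N by (simp add: z_def int_mult_closed B.M.abelian_group_axioms)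
  have e: "extra_degen (ver C p) q ((vcyc C p q ^^ j) x) \<in> Y p (Suc q)" for j using x by simp
  have "op_B (ver C p) q x = extra_degen (ver C p) q (op_N (ver C p) q x) \<ominus>\<^bsub>?M\<^esub> vdegen C p q 0 z"
    using V.op_B_eq_extra_degen[of x p q] x by (simp add: ver_simps z_def)
  moreover have "bicong p (Suc q) \<dots> (extra_degen (ver C p) q (op_N (ver C p) q x))"
    using z N by (intro congruent_mod_minus[OF module_bi_obj submodule_bidegenerate]
        vdegen_bidegenerate) auto
  ultimately have "bicong p (Suc q) (B_v C p q x)
      (add_pow ?M ((-1::int) ^ p) (extra_degen (ver C p) q (op_N (ver C p) q x)))"
    unfolding B_v_def
    by (simp add: congruent_mod_int_mult[OF module_bi_obj submodule_bidegenerate])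
  also have "extra_degen (ver C p) q (op_N (ver C p) q x)
    = (\<Oplus>\<^bsub>?M\<^esub>j\<in>{..q}. add_pow ?M ((-1::int) ^ (q * j)) (extra_degen (ver C p) q ((vcyc C p q ^^ j)
        x)))"
    using V.extra_degen_op_N[of x p q] x by (simp add: ver_simps)
  also have "add_pow ?M ((-1::int) ^ p) \<dots>
    = (\<Oplus>\<^bsub>?M\<^esub>j\<in>{..q}. add_pow ?M ((-1::int) ^ p) (add_pow ?M ((-1::int) ^ (q * j)) (extra_degen
        (ver C p) q ((vcyc C p q ^^ j) x))))"
    using e by (intro int_mult_finsum[OF module_bi_obj] int_mult_closed B.M.abelian_group_axioms)
  finally show ?thesis
    using e by (simp add: int_mult_mult B.M.abelian_group_axioms)
qed

text \<open>As \<open>T\<^sup>v\<close> is a power of \<open>\<tau>\<close>, it commutes with the horizontal operators; in particular it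
  preserves the horizontal degeneracies by which \<open>B\<^sup>h\<close> differs from \<open>e N\<close>.\<close>

lemma T_v_B_h_congruent:
  assumes x: "x \<in> Y p q"
  shows "bicong (Suc p) q (T_v C (Suc p) q (B_h C p q x))
    (\<Oplus>\<^bsub>bi_obj C (Suc p) q\<^esub>a\<in>{..p}. add_pow (bi_obj C (Suc p) q) ((-1::int) ^ (p * a))
      (extra_degen (hor C q) p ((hcyc C p q ^^ a) ((vcyc C p q ^^ Suc q) x))))"
proof -
  let ?M = "bi_obj C (Suc p) q"
  let ?w = "\<lambda>y a. extra_degen (hor C q) p ((hcyc C p q ^^ a) y)"
  let ?eN = "extra_degen (hor C q) p (op_N (hor C q) p x)"
  let ?T = "\<lambda>p. vcyc C p q ^^ Suc q"
  note hom = vcyc_pow_hom[of q "Suc q"]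
  have T: "linear_map R ?M ?M (?T (Suc p))"
    using V.cpow_linear[of "Suc p" q "Suc q"] by (simp add: ver_simps del: funpow.simps)
  define z where "z = add_pow (bi_obj C p q) ((-1::int) ^ Suc p) (hcyc C p q (op_N (hor C q) p x))"
  have N: "op_N (hor C q) p x \<in> Y p q"
    using H.op_N_closed[of x q p] x by (simp add: hor_simps)
  have z: "z \<in> Y p q"
    using N by (simp add: z_def int_mult_closed B.M.abelian_group_axioms)
  have e: "?w x a \<in> Y (Suc p) q" for a using x by simp
  have eN: "?eN \<in> Y (Suc p) q" using N by simp
  have "T_v C (Suc p) q (B_h C p q x) = ?T (Suc p) (op_B (hor C q) p x)"
    using T_v_eq_vcyc_pow[OF B_h_closed[OF x]] by (simp only: B_h_def)
  also have "op_B (hor C q) p x = ?eN \<ominus>\<^bsub>?M\<^esub> hdegen C p q 0 z"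
    using H.op_B_eq_extra_degen[of x q p] x by (simp add: hor_simps z_def)
  also have "?T (Suc p) \<dots> = ?T (Suc p) (?eN) \<ominus>\<^bsub>?M\<^esub> ?T (Suc p) (hdegen C p q 0 z)"
    using eN z by (intro linear_map_diff[OF module_bi_obj module_bi_obj T]) auto
  also have "?T (Suc p) (hdegen C p q 0 z) = hdegen C p q 0 (?T p z)"
    using lambda_hom_degen[OF hom, of z p 0] z by (simp add: hor_simps del: funpow.simps)
  also have "?T (Suc p) (?eN)
    = (\<Oplus>\<^bsub>?M\<^esub>a\<in>{..p}. ?T (Suc p) (add_pow ?M ((-1::int) ^ (p * a)) (?w x a)))"
  proof -
    have "?eN
      = (\<Oplus>\<^bsub>?M\<^esub>a\<in>{..p}. add_pow ?M ((-1::int) ^ (p * a)) (?w x a))"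
      using H.extra_degen_op_N[of x q p] x by (simp add: hor_simps)
    then show ?thesis
      using e by (simp only:) (intro linear_map_finsum[OF module_bi_obj module_bi_obj T]
          int_mult_closed
          B.M.abelian_group_axioms)
  qed
  also have "\<dots> = (\<Oplus>\<^bsub>?M\<^esub>a\<in>{..p}. add_pow ?M ((-1::int) ^ (p * a))
      (?w (?T p x) a))"
  proof (rule B.M.finsum_cong')
    show "(\<lambda>a. add_pow ?M ((-1::int) ^ (p * a)) (?w (?T p x) a)) \<in> {..p} \<rightarrow> Y (Suc p) q"
      using vcyc_pow_closed[OF x, of "Suc q"]
      by (simp add: int_mult_closed B.M.abelian_group_axioms del: funpow.simps)
    fix a
    have "?T (Suc p) (?w x a) = ?w (?T p x) a"
      using H.lambda_hom_extra_degen[OF hom, of "(hcyc C p q ^^ a) x" p]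
        H.lambda_hom_cyc_pow[OF hom, of x p a] x
      by (simp add: hor_simps del: funpow.simps)
    then show "?T (Suc p) (add_pow ?M ((-1::int) ^ (p * a)) (?w x a))
      = add_pow ?M ((-1::int) ^ (p * a)) (?w (?T p x) a)"
      using linear_map_int_mult[OF module_bi_obj module_bi_obj T e] by (simp only:)
  qed simp
  finally have eq: "T_v C (Suc p) q (B_h C p q x)
    = (\<Oplus>\<^bsub>?M\<^esub>a\<in>{..p}. add_pow ?M ((-1::int) ^ (p * a))
      (?w (?T p x) a)) \<ominus>\<^bsub>?M\<^esub> hdegen C p q 0 (?T p z)" .
  show ?thesis
    unfolding eq
    using z vcyc_pow_closed[OF x, of "Suc q"] vcyc_pow_closed[OF z, of "Suc q"]
    by (intro congruent_mod_minus[OF module_bi_obj submodule_bidegenerate] hdegen_bidegenerate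
        B.M.finsum_closed)
      (auto intro!: int_mult_closed simp: B.M.abelian_group_axioms simp del: funpow.simps)
qed

lemma AW_op_B_nabla_vertical:
  assumes x: "x \<in> Y p q"
  shows "bicong p (Suc q)
    (AW_comp C p (Suc q) (op_B (diagonal C) (p + q) (nabla C p q x))) (B_v C p q x)"
proof -
  let ?t = "\<lambda>j. add_pow (bi_obj C p (Suc q)) ((-1::int) ^ ((p + q) * j)) (shuffle_sum p
      (Suc q) p q j x)"
  let ?M = "bi_obj C p (Suc q)" and ?D = "bidegenerate R C p (Suc q)"
  let ?e = "\<lambda>j. extra_degen (ver C p) q ((vcyc C p q ^^ j) x)"
  note mods = module_bi_obj submodule_bidegenerate
  have rs: "p + Suc q = Suc (p + q)" by simp
  have "bicong p (Suc q)
    (\<Oplus>\<^bsub>?M\<^esub>j\<in>{..p + q}. ?t j)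
    (\<Oplus>\<^bsub>?M\<^esub>j\<in>{..q}. add_pow ?M ((-1::int) ^ p * (-1) ^ (q * j)) (?e j))"
  proof (rule congruent_mod_finsum_support[OF mods])
    show "finite {..p + q}" "{..q} \<subseteq> {..p + q}" by auto
    fix j assume "j \<in> {..p + q} - {..q}"
    then show "?t j \<in> ?D"
      using survives_Suc_iff by (intro submodule_int_mult[OF mods] AW_words_degenerate[OF x _ rs])
          auto
  next
    fix j assume "j \<in> {..q}"
    then have j: "j \<le> q" "j \<le> p + q" by auto
    let ?\<theta> = "block_swap 0 p (q - j)"
    have e: "?e j \<in> Y p (Suc q)" using x by simp
    obtain c where c: "q = j + c" using j by (metis le_Suc_ex)
    \<comment> \<open>The signs of \<open>\<lambda>\<^sup>j\<close> on the diagonal, of the shuffle and of the Alexander-Whitney map; the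
      result is the sign of \<open>\<lambda>\<^sup>j\<close> in the vertical direction and the sign in the definition of
      \<open>B\<^sup>v\<close>.\<close>
    have sgn: "(-1::int) ^ ((p + q) * j) * (sign ?\<theta> * (-1) ^ (p * Suc q))
        = (-1) ^ p * (-1) ^ (q * j)"
      using block_swap_sign[of 0 p "q - j"] unfolding c
      by (auto simp: minus_one_power_iff simp flip: power_add)
    have "bicong p (Suc q) (?t j)
      (add_pow ?M ((-1::int) ^ ((p + q) * j)) (add_pow ?M (sign ?\<theta>) (AW_word p (Suc q) p q j ?\<theta>
          x)))"
      using block_swap_first_shuffle[of "q - j" q p] survives_Suc_iff j
      by (intro congruent_mod_int_mult[OF mods] AW_words_single[OF x _ rs]) auto
    also have "add_pow ?M ((-1::int) ^ ((p + q) * j)) (add_pow ?M (sign ?\<theta>) (AW_word p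
        (Suc q) p q j ?\<theta> x))
      = add_pow ?M ((-1::int) ^ p * (-1) ^ (q * j)) (?e j)"
      unfolding AW_word_vertical[OF x j(1)] sgn[symmetric] using e
      by (simp only: int_mult_mult B.M.abelian_group_axioms)
    finally show "bicong p (Suc q) (?t j)
      (add_pow ?M ((-1::int) ^ p * (-1) ^ (q * j)) (?e j))" .
  qed
  then show ?thesis
    using op_B_diagonal_nabla[OF x rs] B_v_congruent[OF x] congruent_mod_trans[OF mods]
        congruent_mod_sym[OF mods]
    by blast
qed

lemma AW_op_B_nabla_horizontal:
  assumes x: "x \<in> Y p q"
  shows "bicong (Suc p) q
    (AW_comp C (Suc p) q (op_B (diagonal C) (p + q) (nabla C p q x))) (T_v C (Suc p) q
        (B_h C p q x))"
proof -
  let ?t = "\<lambda>j. add_pow (bi_obj C (Suc p) q) ((-1::int) ^ ((p + q) * j)) (shuffle_sum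
      (Suc p) q p q j x)"
  let ?M = "bi_obj C (Suc p) q" and ?D = "bidegenerate R C (Suc p) q"
  let ?e = "\<lambda>a. extra_degen (hor C q) p ((hcyc C p q ^^ a) ((vcyc C p q ^^ Suc q) x))"
  note mods = module_bi_obj submodule_bidegenerate
  have rs: "Suc p + q = Suc (p + q)" by simp
  have e: "?e a \<in> Y (Suc p) q" for a
    using vcyc_pow_closed[OF x, of "Suc q"] by (simp del: funpow.simps)
  let ?g = "\<lambda>j. add_pow ?M ((-1::int) ^ (p * (j - q))) (?e (j - q))"
  have g: "?g j \<in> Y (Suc p) q" for j
    using e by (intro int_mult_closed B.M.abelian_group_axioms)
  have "bicong (Suc p) q
    (\<Oplus>\<^bsub>?M\<^esub>j\<in>{..p + q}. ?t j)
    (finsum ?M ?g ((\<lambda>a. q + a) ` {..p}))"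
  proof (rule congruent_mod_finsum_support[OF mods])
    show "finite {..p + q}" "(\<lambda>a. q + a) ` {..p} \<subseteq> {..p + q}" by auto
    fix j assume "j \<in> {..p + q} - (\<lambda>a. q + a) ` {..p}"
    then have j: "j < q" "j \<le> p + q"
      by (auto simp: image_iff not_le[symmetric]) (metis add_le_cancel_left add.commute atMost_iff
          le_Suc_ex)
    then show "?t j \<in> ?D"
      using survives_same_iff by (intro submodule_int_mult[OF mods] AW_words_degenerate[OF x _ rs])
          auto
  next
    fix j assume "j \<in> (\<lambda>a. q + a) ` {..p}"
    then obtain a where a: "a \<le> p" and ja: "j = q + a" by auto
    have j: "j \<le> p + q" and e1: "p + q - j = p - a" "j - q = a" using a ja by auto
    let ?\<theta> = "block_swap (p - a) a q"
    have sgn: "(-1::int) ^ ((p + q) * j) * (sign ?\<theta> * (-1) ^ (Suc p * q)) = (-1) ^ (p * a)"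
      using block_swap_sign[of "p - a" a q] unfolding ja
      by (auto simp: minus_one_power_iff simp flip: power_add)
    have "bicong (Suc p) q (?t j)
      (add_pow ?M ((-1::int) ^ ((p + q) * j)) (add_pow ?M (sign ?\<theta>) (AW_word (Suc p) q p q j ?\<theta>
          x)))"
      using block_swap_last_shuffle(1)[OF a, of q] survives_same_iff[OF _ j] e1
      by (intro congruent_mod_int_mult[OF mods] AW_words_single[OF x j rs]) auto
    also have "add_pow ?M ((-1::int) ^ ((p + q) * j)) (add_pow ?M (sign ?\<theta>) (AW_word
        (Suc p) q p q j ?\<theta> x))
      = ?g j"
      unfolding ja AW_word_horizontal[OF x a] sgn[unfolded ja, symmetric] using e
      by (simp only: int_mult_mult B.M.abelian_group_axioms diff_add_inverse sgn[unfolded ja])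
    finally show "bicong (Suc p) q (?t j) (?g j)" .
  qed
  also have "finsum ?M ?g ((\<lambda>a. q + a) ` {..p}) = (\<Oplus>\<^bsub>?M\<^esub>a\<in>{..p}. ?g (q + a))"
    using g by (intro B.M.finsum_reindex) auto
  also have "\<dots> = (\<Oplus>\<^bsub>?M\<^esub>a\<in>{..p}. add_pow ?M ((-1::int) ^ (p * a)) (?e a))"
    by (simp only: diff_add_inverse)
  finally show ?thesis
    using op_B_diagonal_nabla[OF x rs] T_v_B_h_congruent[OF x] congruent_mod_trans[OF mods]
        congruent_mod_sym[OF mods]
    by blast
qed

text \<open>In the other bidegrees no term survives.\<close>

lemma AW_op_B_nabla_other:
  assumes x: "x \<in> Y p q" and rs: "r + s = Suc (p + q)" and r: "r \<noteq> p" "r \<noteq> Suc p"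
  shows "AW_comp C r s (op_B (diagonal C) (p + q) (nabla C p q x)) \<in> bidegenerate R C r s"
proof -
  note mods = module_bi_obj submodule_bidegenerate
  have "\<not> survives p q s j \<eta>" if "\<eta> \<in> shuffle_perms p q" "j \<le> p + q" for j \<eta>
    using AW_word_survives(1,2)[OF that(1) x that(2) rs] r rs by auto
  then have "(\<Oplus>\<^bsub>bi_obj C r s\<^esub>j\<in>{..p + q}. add_pow (bi_obj C r s) ((-1::int) ^ ((p + q) * j))
      (shuffle_sum r s p q j x))
    \<in> bidegenerate R C r s"
    by (intro submodule_finsum[OF mods] submodule_int_mult[OF mods] AW_words_degenerate[OF x _ rs])
        auto
  then show ?thesis
    using op_B_diagonal_nabla[OF x rs] congruent_mod_trans[OF mods] congruent_mod_zero_iff[OF mods]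
        by blast
qed

lemma B_t_term_closed:
  assumes "f \<in> carrier (Tot C n)" "p \<le> n"
  shows "tot_incl C (n + 1) (p + 1) (T_v C (p + 1) (n - p) (B_h C p (n - p) (f p)))
    \<oplus>\<^bsub>Tot C (n + 1)\<^esub> tot_incl C (n + 1) p (B_v C p (n - p) (f p)) \<in> carrier (Tot C (n + 1))"
proof -
  interpret T: module R "Tot C (n + 1)" by (rule module_Tot)
  have "f p \<in> Y p (n - p)" using assms by (auto simp: Tot_simps)
  moreover have "n + 1 - p = Suc (n - p)" using assms by simp
  ultimately show ?thesis
    using assms by (intro T.M.a_closed tot_incl_closed) auto
qed

lemma B_t_closed:
  assumes "f \<in> carrier (Tot C n)"
  shows "B_t C n f \<in> carrier (Tot C (n + 1))"
proof -
  interpret T: module R "Tot C (n + 1)" by (rule module_Tot)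
  show ?thesis
    unfolding B_t_def using B_t_term_closed[OF assms]
        by (intro T.M.finsum_closed funcsetI) (simp only: atMost_iff)
qed

theorem AW_op_B_Sh:
  assumes f: "f \<in> carrier (Tot C n)"
  shows "congruent_mod (Tot C (n + 1)) (Tot_degenerate R C (n + 1))
    (AW C (n + 1) (op_B (diagonal C) n (Sh C n f))) (B_t C n f)"
proof (rule congruent_mod_TotI)
  interpret T: module R "Tot C (n + 1)" by (rule module_Tot)
  have fp: "f p \<in> Y p (n - p)" if "p \<le> n" for p using f that by (auto simp: Tot_simps)
  have B: "linear_map R (bi_obj C n n) (bi_obj C (n + 1) (n + 1)) (op_B (diagonal C) n)"
    using D.op_B_linear[of n] by (simp add: diagonal_simps)
  have nab: "nabla C p (n - p) (f p) \<in> Y n n" if "p \<le> n" for p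
    using linear_map_closed[OF nabla_linear fp[OF that]] that by simp
  show "AW C (n + 1) (op_B (diagonal C) n (Sh C n f)) \<in> carrier (Tot C (n + 1))"
    by (intro linear_map_closed[OF AW_linear] linear_map_closed[OF B] linear_map_closed[OF
        Sh_linear] f)
  show "B_t C n f \<in> carrier (Tot C (n + 1))" by (rule B_t_closed[OF f])
  fix r assume r: "r \<le> n + 1"
  define s where "s = n + 1 - r"
  have rs: "r + s = Suc n" using r by (simp add: s_def)
  note mods = module_bi_obj[of r s] submodule_bidegenerate[of r s]
  have L: "linear_map R (bi_obj C n n) (bi_obj C r s) (\<lambda>y. AW_comp C r s (op_B (diagonal C) n y))"
    using linear_map_comp[OF B, of "bi_obj C r s" "AW_comp C r s"] AW_comp_linear[OF rs] by simp
  let ?h = "\<lambda>p. tot_incl C (n + 1) (p + 1) (T_v C (p + 1) (n - p) (B_h C p (n - p) (f p)))"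
  let ?v = "\<lambda>p. tot_incl C (n + 1) p (B_v C p (n - p) (f p))"
  have "AW C (n + 1) (op_B (diagonal C) n (Sh C n f)) r = AW_comp C r s (op_B (diagonal C) n
      (Sh C n f))"
    using r by (simp add: AW_def s_def)
  also have "\<dots> = (\<Oplus>\<^bsub>bi_obj C r s\<^esub>p\<in>{..n}. AW_comp C r s (op_B (diagonal C) n (nabla C p (n - p)
      (f p))))"
    unfolding Sh_def using nab by (intro linear_map_finsum[OF module_bi_obj module_bi_obj L]) auto
  finally have 1: "AW C (n + 1) (op_B (diagonal C) n (Sh C n f)) r
    = (\<Oplus>\<^bsub>bi_obj C r s\<^esub>p\<in>{..n}. AW_comp C r s (op_B (diagonal C) n (nabla C p (n - p) (f p))))" .
  have "B_t C n f r = (\<Oplus>\<^bsub>bi_obj C r s\<^esub>p\<in>{..n}. (?h p \<oplus>\<^bsub>Tot C (n + 1)\<^esub> ?v p) r)"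
    unfolding B_t_def s_def using r B_t_term_closed[OF f]
        by (intro Tot_finsum_component) (simp_all only: atMost_iff)
  moreover have "bicong r s
    (AW_comp C r s (op_B (diagonal C) n (nabla C p (n - p) (f p)))) ((?h p \<oplus>\<^bsub>Tot C (n + 1)\<^esub> ?v p) r)"
    if "p \<in> {..n}" for p
  proof -
    define q where "q = n - p"
    have n: "n = p + q" using that by (simp add: q_def)
    have x: "f p \<in> Y p q" using fp that by (simp add: q_def)
    have sum: "(?h p \<oplus>\<^bsub>Tot C (n + 1)\<^esub> ?v p) r = ?h p r \<oplus>\<^bsub>bi_obj C r s\<^esub> ?v p r"
      using r by (simp add: Tot_simps s_def)
    consider "r = p" | "r = Suc p" | "r \<noteq> p" "r \<noteq> Suc p" by blast
    then show ?thesis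
    proof cases
      case 1
      then have "s = Suc q" using rs n by simp
      then show ?thesis
        using AW_op_B_nabla_vertical[OF x] 1 n x r unfolding sum
        by (simp add: tot_incl_def)
    next
      case 2
      then have "s = q" using rs n by simp
      then show ?thesis
        using AW_op_B_nabla_horizontal[OF x] 2 n x r unfolding sum
        by (simp add: tot_incl_def)
    next
      case 3
      have z: "?h p r \<oplus>\<^bsub>bi_obj C r s\<^esub> ?v p r = \<zero>\<^bsub>bi_obj C r s\<^esub>"
        using 3 r by (simp add: tot_incl_def s_def)
      show ?thesis
        unfolding sum z congruent_mod_zero_iff[OF mods]
        using AW_op_B_nabla_other[OF x _ 3, of s] rs n by simp
    qed
  qed
  ultimately show "bicong r (n + 1 - r)
    (AW C (n + 1) (op_B (diagonal C) n (Sh C n f)) r) (B_t C n f r)"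
    unfolding 1 s_def[symmetric] by (simp only:) (rule congruent_mod_finsum[OF mods])
qed

end

theorem proposition3p3:
  fixes R :: "('k, 'r) ring_scheme" and C :: "('k, 'a) cyl_data"
  assumes "cring R" and "cylindrical_module R C"
  shows "\<forall>n. \<forall>c\<in>carrier (Tot_normalized R C n).
           AW_bar R C (n + 1) (B_d_bar R C n (Sh_bar R C n c)) = B_t_bar R C n c"
proof (intro allI ballI)
  interpret cylindrical_module R C by fact
  fix n c assume "c \<in> carrier (Tot_normalized R C n)"
  then obtain f where f: "f \<in> carrier (Tot C n)" and c: "c = Tot_degenerate R C n +>\<^bsub>Tot C n\<^esub> f"
    unfolding Tot_normalized_def carrier_quotient_module[OF module_Tot submodule_Tot_degenerate]
        by blast
  let ?D = "diagonal C"
  note T = module_Tot submodule_Tot_degenerate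
  note G = D.module_obj D.submodule_degenerate
  have Sh: "linear_map R (Tot C n) (obj ?D n) (Sh C n)"
    using Sh_linear by (simp add: diagonal_simps)
  have B: "linear_map R (obj ?D n) (obj ?D (n + 1)) (op_B ?D n)"
    using D.op_B_linear by simp
  have A: "linear_map R (obj ?D (n + 1)) (Tot C (n + 1)) (AW C (n + 1))"
    using AW_linear[of "n + 1"] by (simp add: diagonal_simps)
  define y where "y = Sh C n f"
  define z where "z = op_B ?D n y"
  have y: "y \<in> carrier (obj ?D n)" using linear_map_closed[OF Sh f] by (simp add: y_def)
  have z: "z \<in> carrier (obj ?D (n + 1))" using linear_map_closed[OF B y] by (simp add: z_def)
  have cong_Sh: "congruent_mod (obj ?D n) (degenerate R ?D n) (Sh C n g) (Sh C n f)"
    if "congruent_mod (Tot C n) (Tot_degenerate R C n) g f" for g f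
    using that by (intro linear_map_congruent[OF module_Tot D.module_obj Sh D.submodule_degenerate
        Sh_degenerate])
  have cong_B: "congruent_mod (obj ?D (n + 1)) (degenerate R ?D (n + 1)) (op_B ?D n g)
      (op_B ?D n f)"
    if "congruent_mod (obj ?D n) (degenerate R ?D n) g f" for g f
    using that D.op_B_degenerate
    by (intro linear_map_congruent[OF D.module_obj D.module_obj B D.submodule_degenerate]) auto
  have cong_A: "congruent_mod (Tot C (n + 1)) (Tot_degenerate R C (n + 1)) (AW C (n + 1) g) (AW C
      (n + 1) f)"
    if "congruent_mod (obj ?D (n + 1)) (degenerate R ?D (n + 1)) g f" for g f
    using that by (intro linear_map_congruent[OF D.module_obj module_Tot A submodule_Tot_degenerate
        AW_degenerate])
  have "Sh_bar R C n c = degenerate R ?D n +>\<^bsub>obj ?D n\<^esub> y"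
    unfolding Sh_bar_def c y_def using cong_Sh by (intro induced_map_coset[OF T G f])
  moreover have "B_d_bar R C n (degenerate R ?D n +>\<^bsub>obj ?D n\<^esub> y) = degenerate R ?D (n + 1) +>\<^bsub>obj ?D
      (n + 1)\<^esub> z"
    unfolding B_d_bar_def z_def using cong_B by (intro induced_map_coset[OF G G y])
  moreover have "AW_bar R C (n + 1) (degenerate R ?D (n + 1) +>\<^bsub>obj ?D (n + 1)\<^esub> z)
    = Tot_degenerate R C (n + 1) +>\<^bsub>Tot C (n + 1)\<^esub> AW C (n + 1) z"
    unfolding AW_bar_def using cong_A by (intro induced_map_coset[OF G T z])
  moreover have "B_t_bar R C n c = Tot_degenerate R C (n + 1) +>\<^bsub>Tot C (n + 1)\<^esub> B_t C n f"
    unfolding B_t_bar_def c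
  proof (rule induced_map_coset[OF T T f])
    \<comment> \<open>\<open>B\<^sub>t\<close> respects the congruence because the composite of the other three maps does.\<close>
    fix g assume g: "congruent_mod (Tot C n) (Tot_degenerate R C n) g f"
    then have "g \<in> carrier (Tot C n)" by (simp add: congruent_mod_def)
    then show "congruent_mod (Tot C (n + 1)) (Tot_degenerate R C (n + 1)) (B_t C n g) (B_t C n f)"
      using cong_A[OF cong_B[OF cong_Sh[OF g]]] AW_op_B_Sh[of g n] AW_op_B_Sh[OF f]
        congruent_mod_trans[OF T] congruent_mod_sym[OF T] by blast
  qed
  moreover have "Tot_degenerate R C (n + 1) +>\<^bsub>Tot C (n + 1)\<^esub> AW C (n + 1) z
    = Tot_degenerate R C (n + 1) +>\<^bsub>Tot C (n + 1)\<^esub> B_t C n f"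
    using AW_op_B_Sh[OF f] coset_eq_iff_congruent[OF T]
    by (simp add: congruent_mod_def z_def y_def)
  ultimately show "AW_bar R C (n + 1) (B_d_bar R C n (Sh_bar R C n c)) = B_t_bar R C n c"
    by (simp only:)
qed

end
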